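(* For every $m\in\mathbb Z_{\ge0}$, $R_{\mathcal N(m)}$ is a commutative ring with a $\mathbb Z$-basis $\{\,\mathrm{ch}\,\mathbf B_{\mathcal N(m)}(\lambda,\alpha)\mid(\lambda,\alpha)\in\mathcal C(m)\,\}$.
   Context: $\mathcal N(m)=\{-m<\cdots<-1<\frac12<1<\frac32<2<\cdots\}$; integers are even, elements of $\frac12+\mathbb Z_{\ge0}$ are odd. $P=\bigoplus_{b\in\mathcal N(m)}\mathbb Z\epsilon_b$ with $(\epsilon_a,\epsilon_b)=(-1)^{|a|}\delta_{ab}$. Simple roots: $\alpha_i=\epsilon_{i-1}-\epsilon_i$ for $-m+1\le i\le-1$, $\alpha_0=\epsilon_{-1}-\epsilon_{1/2}$ (if $m\ge1$) and $\alpha_r=\epsilon_r-\epsilon_{r+\frac12}$ for $r\in\frac12\mathbb Z_{>0}$. Crystal operators on the set $\mathbf W$ of finite words in $\mathcal N(m)$ (including the empty word, on which all $e_i,f_i$ give $\mathbf 0$): a word $w_1\cdots w_r$ is identified with $w_1\otimes\cdots\otimes w_r$. On letters: $\mathrm{wt}(b)=\epsilon_b$, $f_i b=b'$ and $e_ib'=b$ iff $\alpha_i=\epsilon_b-\epsilon_{b'}$, otherwise $\mathbf 0$ (formal symbol); $\varepsilon_i(b)$ (resp. $\varphi_i(b)$) is $1$ if $e_ib\ne\mathbf 0$ (resp. $f_ib\neq\mathbf 0$), else $0$. Tensor product rule: $\mathrm{wt}$ is additive. For $i\in\mathbb Z_{\ge0}$: $e_i,f_i$ act on $b_1$ in $b_1\otimes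 b_2$ if $(\alpha_i,\mathrm{wt}(b_1))\ne0$, otherwise on $b_2$. For $i\in\frac12+\mathbb Z_{\ge0}$: they act on $b_2$ if $(\alpha_i,\mathrm{wt}(b_2))\neq0$, otherwise on $b_1$. In both cases $\varepsilon_i,\varphi_i$ are those of the factor acted on. For $i\le-1$: $e_i(b_1\otimes b_2)=e_ib_1\otimes b_2$ if $\varphi_i(b_1)\ge\varepsilon_i(b_2)$, else $b_1\otimes e_ib_2$; $f_i(b_1\otimes b_2)=f_ib_1\otimes b_2$ if $\varphi_i(b_1)>\varepsilon_i(b_2)$, else $b_1\otimes f_ib_2$; $\varepsilon_i(b_1\otimes b_2)=\max\{\varepsilon_i(b_1),\varepsilon_i(b_2)-(\alpha_i,\mathrm{wt}(b_1))\}$, $\varphi_i(b_1\otimes b_2)=\max\{\varphi_i(b_1)+(\alpha_i,\mathrm{wt}(b_2)),\varphi_i(b_2)\}$. $\mathbf W$ is a colored oriented graph ($w\xrightarrow{i}w'$ iff $w'=f_iw$); $C(w)$ is the connected component of $w$. Let $\mathbf z=\{z_b\mid b\in\mathcal N(m)\}$ be commuting formal variables, $\mathbf z^\mu=\prod_bz_b^{\mu_b}$ for $\mu=\sum\mu_b\epsilon_b$. The character of a connected component is $\mathrm{ch}\,C=\sum_{w\in C}\mathbf z^{\mathrm{wt}(w)}$ (a formal power series), and $R_{\mathcal N(m)}$ is the $\mathbb Z$-span of $\{\mathrm{ch}\,C(w)\mid w\in\mathbf W\}$, with multiplication of formal power series. $\mathcal C(m)$ is the set of pairs $(\lambda,\alpha)$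 with $\lambda=(\lambda_1,\dots,\lambda_m)$ a partition of length at most $m$ and $\alpha$ a (possibly empty) composition that is non-empty only if $\lambda_m\neq0$; $\mathcal C(0)$ is the set of compositions (including the empty one). A composition is identified with its ribbon diagram (rows of lengths $\alpha_1,\alpha_2,\dots$ from top to bottom, the leftmost node of row $i+1$ directly below the rightmost node of row $i$). $(\lambda,\alpha)$ is identified with the diagram obtained by placing the first (northwest) node of $\alpha$ (the joint) directly below the leftmost node in the $m$-th row of the Young diagram $\lambda$ (the body). $\mathbf B_{\mathcal N(m)}(\lambda,\alpha)$ is the set of fillings of this diagram with entries in $\mathcal N(m)$ such that entries weakly increase along rows (left to right) and columns (top to bottom), even entries strictly increase in columns, odd entries strictly increase in rows, and all body entries are $<b$ if the joint entry $b$ is in $\mathbb Z_{>0}$, and $\le b$ if $b\in\frac12+\mathbb Z_{\ge0}$. $\mathrm{ch}\,\mathbf B_{\mathcal N(m)}(\lambda,\alpha)=\sum_T\prod_{\text{entries }b\text{ of }T}z_b$. *)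

theory Defs
  imports Complex_Main "HOL-Library.Poly_Mapping" "HOL-Library.FuncSet" "HOL-Algebra.Ring"
begin

section \<open>Formal power series in arbitrarily many commuting variables\<close>

text \<open>A series with integer coefficients is given by its coefficients; the exponent \<open>\<mu>\<close> stands
  for the monomial \<open>\<Prod>b. z\<^sub>b ^ \<mu> b\<close>.\<close>

typedef 'v series = "UNIV :: (('v \<Rightarrow>\<^sub>0 nat) \<Rightarrow> int) set"
  morphisms coeff Series ..

setup_lifting type_definition_series

lemma series_eqI: "(\<And>\<mu>. coeff f \<mu> = coeff g \<mu>) \<Longrightarrow> f = g"
  by (metis coeff_inject ext)

lemma finite_below_exponent: "finite {a. \<exists>b. a + b = (\<mu> :: 'v \<Rightarrow>\<^sub>0 nat)}"
proof -
  let ?F = "(\<Pi>\<^sub>E x\<in>Poly_Mapping.keys \<mu>. {..Poly_Mapping.lookup \<mu> x})"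
  let ?r = "\<lambda>a :: 'v \<Rightarrow>\<^sub>0 nat. restrict (Poly_Mapping.lookup a) (Poly_Mapping.keys \<mu>)"
  let ?A = "{a. \<exists>b. a + b = \<mu>}"
  have le: "Poly_Mapping.lookup a x \<le> Poly_Mapping.lookup \<mu> x" if "a \<in> ?A" for a x
    using that by (auto simp: lookup_add)
  have "finite ?F"
    by (intro finite_PiE) auto
  moreover have "?r ` ?A \<subseteq> ?F"
    using le by (auto simp: PiE_iff)
  moreover have "inj_on ?r ?A"
  proof (rule inj_onI)
    fix a a' assume aa: "a \<in> ?A" "a' \<in> ?A" and eq: "?r a = ?r a'"
    show "a = a'"
    proof (rule poly_mapping_eqI)
      fix x
      show "Poly_Mapping.lookup a x = Poly_Mapping.lookup a' x"
      proof (cases "x \<in> Poly_Mapping.keys \<mu>")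
        case True
        then show ?thesis using fun_cong[OF eq, of x] by simp
      next
        case False
        then have "Poly_Mapping.lookup \<mu> x = 0" by (simp add: in_keys_iff)
        then show ?thesis using le[OF aa(1), of x] le[OF aa(2), of x] by simp
      qed
    qed
  qed
  ultimately show ?thesis
    by (meson finite_imageD finite_subset)
qed

lemma finite_splittings: "finite {(a, b). a + b = (\<mu> :: 'v \<Rightarrow>\<^sub>0 nat)}"
proof -
  let ?A = "{a. \<exists>b. a + b = \<mu>}"
  have "{(a, b). a + b = \<mu>} \<subseteq> ?A \<times> ?A"
    by auto (metis add.commute)
  then show ?thesis
    using finite_below_exponent[of \<mu>] by (meson finite_SigmaI finite_subset)
qed

instantiation series :: (type) comm_ring_1
begin

lift_definition zero_series :: "'a series" is "\<lambda>_. 0" .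
lift_definition one_series :: "'a series" is "\<lambda>\<mu>. if \<mu> = 0 then 1 else 0" .
lift_definition plus_series :: "'a series \<Rightarrow> 'a series \<Rightarrow> 'a series" is "\<lambda>f g \<mu>. f \<mu> + g \<mu>" .
lift_definition minus_series :: "'a series \<Rightarrow> 'a series \<Rightarrow> 'a series" is "\<lambda>f g \<mu>. f \<mu> - g \<mu>" .
lift_definition uminus_series :: "'a series \<Rightarrow> 'a series" is "\<lambda>f \<mu>. - f \<mu>" .
lift_definition times_series :: "'a series \<Rightarrow> 'a series \<Rightarrow> 'a series"
  is "\<lambda>f g \<mu>. \<Sum>(a, b)\<in>{(a, b). a + b = \<mu>}. f a * g b" .

instance
proof
  fix f g h :: "'a series"
  show "f * g * h = f * (g * h)"
  proof (transfer, rule ext)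
    fix f g h :: "('a \<Rightarrow>\<^sub>0 nat) \<Rightarrow> int" and \<mu>
    let ?S = "\<lambda>\<mu> :: 'a \<Rightarrow>\<^sub>0 nat. {(a, b). a + b = \<mu>}"
    have "(\<Sum>(p, c)\<in>?S \<mu>. (\<Sum>(a, b)\<in>?S p. f a * g b) * h c)
        = (\<Sum>x\<in>?S \<mu>. \<Sum>y\<in>?S (fst x). f (fst y) * g (snd y) * h (snd x))"
      by (simp add: sum_distrib_right case_prod_unfold)
    also have "\<dots> = (\<Sum>(x, y)\<in>Sigma (?S \<mu>) (\<lambda>x. ?S (fst x)). f (fst y) * g (snd y) * h (snd x))"
      by (rule sum.Sigma) (auto simp: finite_splittings)
    also have "\<dots> = (\<Sum>(x, y)\<in>Sigma (?S \<mu>) (\<lambda>x. ?S (snd x)). f (fst x) * (g (fst y) * h (snd y)))"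
      by (rule sum.reindex_bij_witness
          [where i = "\<lambda>((a, q), (b, c)). ((a + b, c), (a, b))"
             and j = "\<lambda>((p, c), (a, b)). ((a, b + c), (b, c))"])
        (auto simp: add.assoc mult.assoc)
    also have "\<dots> = (\<Sum>x\<in>?S \<mu>. \<Sum>y\<in>?S (snd x). f (fst x) * (g (fst y) * h (snd y)))"
      by (rule sum.Sigma [symmetric]) (auto simp: finite_splittings)
    also have "\<dots> = (\<Sum>(a, q)\<in>?S \<mu>. f a * (\<Sum>(b, c)\<in>?S q. g b * h c))"
      by (simp add: sum_distrib_left case_prod_unfold)
    finally show "(\<Sum>(p, c)\<in>?S \<mu>. (\<Sum>(a, b)\<in>?S p. f a * g b) * h c)
        = (\<Sum>(a, q)\<in>?S \<mu>. f a * (\<Sum>(b, c)\<in>?S q. g b * h c))" .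
  qed
  show "f * g = g * f"
  proof (transfer, rule ext)
    fix f g :: "('a \<Rightarrow>\<^sub>0 nat) \<Rightarrow> int" and \<mu>
    show "(\<Sum>(a, b)\<in>{(a, b). a + b = \<mu>}. f a * g b) = (\<Sum>(a, b)\<in>{(a, b). a + b = \<mu>}. g a * f b)"
      by (rule sum.reindex_bij_witness[where i = prod.swap and j = prod.swap])
        (auto simp: add.commute mult.commute)
  qed
  show "1 * f = f"
  proof (transfer, rule ext)
    fix f :: "('a \<Rightarrow>\<^sub>0 nat) \<Rightarrow> int" and \<mu>
    have "(\<Sum>(a, b)\<in>{(a, b). a + b = \<mu>}. (if a = 0 then 1 else 0) * f b)
        = (\<Sum>(a, b)\<in>{(0 :: 'a \<Rightarrow>\<^sub>0 nat, \<mu>)}. (if a = 0 then 1 else 0) * f b)"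
      by (rule sum.mono_neutral_right) (auto simp: finite_splittings split: if_splits)
    then show "(\<Sum>(a, b)\<in>{(a, b). a + b = \<mu>}. (if a = 0 then 1 else 0) * f b) = f \<mu>"
      by simp
  qed
  show "(f + g) * h = f * h + g * h"
    by (transfer, rule ext) (simp add: algebra_simps sum.distrib case_prod_unfold)
  show "(0 :: 'a series) \<noteq> 1"
    by transfer (metis zero_neq_one)
qed (transfer; simp add: algebra_simps)+

end

global_interpretation series: module "\<lambda>(k :: int) (f :: 'v series). of_int k * f"
  by unfold_locales (simp_all add: algebra_simps)


section \<open>The alphabet and the weight lattice\<close>

text \<open>Letters, and likewise the indices of simple roots, are rational numbers. Within \<open>letters m\<close>
  a letter is even iff it is an integer and odd iff it is not.\<close>

definition letters :: "nat \<Rightarrow> rat set" where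
  "letters m = {- of_nat k |k. 1 \<le> k \<and> k \<le> m} \<union> {of_nat k / 2 |k. 1 \<le> k}"

definition parity_sign :: "rat \<Rightarrow> int" where
  "parity_sign b = (if b \<in> \<int> then 1 else - 1)"

abbreviation eps :: "rat \<Rightarrow> rat \<Rightarrow>\<^sub>0 'c::comm_semiring_1" where
  "eps b \<equiv> Poly_Mapping.single b 1"

definition form :: "(rat \<Rightarrow>\<^sub>0 int) \<Rightarrow> (rat \<Rightarrow>\<^sub>0 int) \<Rightarrow> int" where
  "form \<mu> \<nu> = (\<Sum>b\<in>Poly_Mapping.keys \<mu>.
     parity_sign b * Poly_Mapping.lookup \<mu> b * Poly_Mapping.lookup \<nu> b)"

definition indices :: "nat \<Rightarrow> rat set" where
  "indices m = {of_int i |i. - int m + 1 \<le> i \<and> i \<le> - 1} \<union> (if m \<ge> 1 then {0} else {})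
     \<union> {of_nat k / 2 |k. 1 \<le> k}"

definition simple_root :: "rat \<Rightarrow> rat \<Rightarrow>\<^sub>0 int" where
  "simple_root i = (if i < 0 then eps (i - 1) - eps i
     else if i = 0 then eps (- 1) - eps (1 / 2)
     else eps i - eps (i + 1 / 2))"

type_synonym word = "rat list"

definition words :: "nat \<Rightarrow> word set" where
  "words m = lists (letters m)"

text \<open>At type \<open>rat \<Rightarrow>\<^sub>0 int\<close> this is the weight in the lattice \<open>P\<close>; at type \<open>rat \<Rightarrow>\<^sub>0 nat\<close> it is the
  same element read as the exponent of a monomial.\<close>

definition wt :: "word \<Rightarrow> (rat \<Rightarrow>\<^sub>0 'c::comm_semiring_1)" where
  "wt w = (\<Sum>b\<leftarrow>w. eps b)"


section \<open>Crystal operators on words\<close>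

text \<open>The formal symbol \<open>\<zero>\<close> is \<open>None\<close>. The target (source) of an arrow is unique if it exists, and
  for \<open>i \<in> indices m\<close> both ends of the arrow lie in \<open>letters m\<close>.\<close>

definition f_letter :: "rat \<Rightarrow> rat \<Rightarrow> rat option" where
  "f_letter i b = (if \<exists>b'. simple_root i = eps b - eps b'
     then Some (THE b'. simple_root i = eps b - eps b') else None)"

definition e_letter :: "rat \<Rightarrow> rat \<Rightarrow> rat option" where
  "e_letter i b' = (if \<exists>b. simple_root i = eps b - eps b'
     then Some (THE b. simple_root i = eps b - eps b') else None)"

definition epsilon_letter :: "rat \<Rightarrow> rat \<Rightarrow> int" where
  "epsilon_letter i b = (if e_letter i b \<noteq> None then 1 else 0)"

definition phi_letter :: "rat \<Rightarrow> rat \<Rightarrow> int" where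
  "phi_letter i b = (if f_letter i b \<noteq> None then 1 else 0)"

text \<open>For \<open>i \<ge> 0\<close>: whether the operators indexed by \<open>i\<close> act on the left factor of \<open>u \<otimes> v\<close>.\<close>

definition acts_left :: "rat \<Rightarrow> word \<Rightarrow> word \<Rightarrow> bool" where
  "acts_left i u v = (if i \<in> \<int> then form (simple_root i) (wt u) \<noteq> 0
     else form (simple_root i) (wt v) = 0)"

text \<open>The word \<open>b # c # w\<close> is viewed as \<open>b \<otimes> (c # w)\<close>; the tensor product rule is associative, so
  the bracketing does not matter.\<close>

fun epsilon :: "rat \<Rightarrow> word \<Rightarrow> int" where
  "epsilon i [] = 0"
| "epsilon i [b] = epsilon_letter i b"
| "epsilon i (b # c # w) =
    (if i < 0 then max (epsilon_letter i b) (epsilon i (c # w) - form (simple_root i) (wt [b]))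
     else if acts_left i [b] (c # w) then epsilon_letter i b
     else epsilon i (c # w))"

fun phi :: "rat \<Rightarrow> word \<Rightarrow> int" where
  "phi i [] = 0"
| "phi i [b] = phi_letter i b"
| "phi i (b # c # w) =
    (if i < 0 then max (phi_letter i b + form (simple_root i) (wt (c # w))) (phi i (c # w))
     else if acts_left i [b] (c # w) then phi_letter i b
     else phi i (c # w))"

fun e_op :: "rat \<Rightarrow> word \<Rightarrow> word option" where
  "e_op i [] = None"
| "e_op i [b] = map_option (\<lambda>b'. [b']) (e_letter i b)"
| "e_op i (b # c # w) =
    (if (if i < 0 then phi_letter i b \<ge> epsilon i (c # w) else acts_left i [b] (c # w))
     then map_option (\<lambda>b'. b' # c # w) (e_letter i b)
     else map_option (\<lambda>w'. b # w') (e_op i (c # w)))"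

fun f_op :: "rat \<Rightarrow> word \<Rightarrow> word option" where
  "f_op i [] = None"
| "f_op i [b] = map_option (\<lambda>b'. [b']) (f_letter i b)"
| "f_op i (b # c # w) =
    (if (if i < 0 then phi_letter i b > epsilon i (c # w) else acts_left i [b] (c # w))
     then map_option (\<lambda>b'. b' # c # w) (f_letter i b)
     else map_option (\<lambda>w'. b # w') (f_op i (c # w)))"


section \<open>Connected components, their characters, and the ring\<close>

definition arrows :: "nat \<Rightarrow> (word \<times> word) set" where
  "arrows m = {(w, w'). w \<in> words m \<and> w' \<in> words m \<and> (\<exists>i\<in>indices m. f_op i w = Some w')}"

definition component :: "nat \<Rightarrow> word \<Rightarrow> word set" where
  "component m w = {w'. (w, w') \<in> (arrows m \<union> (arrows m)\<inverse>)\<^sup>*}"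

text \<open>\<open>character A x = \<Sum>a\<in>A. z ^ x a\<close>, meaningful when each exponent is attained finitely often.\<close>

definition character :: "'a set \<Rightarrow> ('a \<Rightarrow> rat \<Rightarrow>\<^sub>0 nat) \<Rightarrow> rat series" where
  "character A x = Series (\<lambda>\<mu>. int (card {a \<in> A. x a = \<mu>}))"

definition ch_component :: "nat \<Rightarrow> word \<Rightarrow> rat series" where
  "ch_component m w = character (component m w) wt"

definition R_carrier :: "nat \<Rightarrow> rat series set" where
  "R_carrier m = series.span (ch_component m ` words m)"

definition R_ring :: "nat \<Rightarrow> rat series ring" where
  "R_ring m = \<lparr>carrier = R_carrier m, mult = (*), one = 1, zero = 0, add = (+)\<rparr>"


section \<open>Diagrams and tableaux\<close>

text \<open>Partitions of length at most \<open>m\<close> are padded with zeros to lists of length exactly \<open>m\<close>.\<close>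

definition shapes :: "nat \<Rightarrow> (nat list \<times> nat list) set" where
  "shapes m = {(l, a). length l = m \<and> sorted_wrt (\<ge>) l \<and> (\<forall>x\<in>set a. 0 < x)
     \<and> (a \<noteq> [] \<longrightarrow> m = 0 \<or> l ! (m - 1) \<noteq> 0)}"

text \<open>Nodes are pairs (row, column), both counted from \<open>0\<close>, with rows numbered downwards.\<close>

definition body :: "nat list \<Rightarrow> (nat \<times> nat) set" where
  "body l = {(i, j). i < length l \<and> j < l ! i}"

definition ribbon_start :: "nat list \<Rightarrow> nat \<Rightarrow> nat" where
  "ribbon_start a k = (\<Sum>i<k. a ! i - 1)"

definition ribbon :: "nat \<Rightarrow> nat list \<Rightarrow> (nat \<times> nat) set" where
  "ribbon m a = {(m + k, j) |k j. k < length a \<and> ribbon_start a k \<le> j \<and> j < ribbon_start a k + a ! k}"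

definition diagram :: "nat list \<Rightarrow> nat list \<Rightarrow> (nat \<times> nat) set" where
  "diagram l a = body l \<union> ribbon (length l) a"

definition tableaux :: "nat \<Rightarrow> nat list \<Rightarrow> nat list \<Rightarrow> (nat \<times> nat \<Rightarrow> rat) set" where
  "tableaux m l a = {T \<in> diagram l a \<rightarrow>\<^sub>E letters m.
     (\<forall>i j j'. (i, j) \<in> diagram l a \<and> (i, j') \<in> diagram l a \<and> j < j' \<longrightarrow>
        T (i, j) \<le> T (i, j') \<and> (T (i, j) \<notin> \<int> \<longrightarrow> T (i, j) < T (i, j'))) \<and>
     (\<forall>i i' j. (i, j) \<in> diagram l a \<and> (i', j) \<in> diagram l a \<and> i < i' \<longrightarrow>
        T (i, j) \<le> T (i', j) \<and> (T (i, j) \<in> \<int> \<longrightarrow> T (i, j) < T (i', j))) \<and>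
     (a \<noteq> [] \<longrightarrow> (let b = T (m, 0) in
        (b \<in> \<int> \<and> b > 0 \<longrightarrow> (\<forall>p\<in>body l. T p < b)) \<and>
        (b \<notin> \<int> \<longrightarrow> (\<forall>p\<in>body l. T p \<le> b))))}"

definition content :: "(nat \<times> nat) set \<Rightarrow> (nat \<times> nat \<Rightarrow> rat) \<Rightarrow> (rat \<Rightarrow>\<^sub>0 nat)" where
  "content D T = (\<Sum>p\<in>D. eps (T p))"

definition ch_tableaux :: "nat \<Rightarrow> nat list \<times> nat list \<Rightarrow> rat series" where
  "ch_tableaux m = (\<lambda>(l, a). character (tableaux m l a) (content (diagram l a)))"


section \<open>Well-definedness of the characters\<close>

lemma finite_diagram: "finite (diagram l a)"
proof -
  have "body l = Sigma {..<length l} (\<lambda>i. {..<l ! i})"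
    by (auto simp: body_def)
  moreover have "ribbon m a = (\<lambda>(k, j). (m + k, j)) `
      Sigma {..<length a} (\<lambda>k. {ribbon_start a k..<ribbon_start a k + a ! k})" for m
    by (force simp: ribbon_def image_iff)
  ultimately show ?thesis
    by (simp add: diagram_def)
qed

lemma keys_plus_nat:
  "Poly_Mapping.keys (a + b) = Poly_Mapping.keys a \<union> Poly_Mapping.keys (b :: 'v \<Rightarrow>\<^sub>0 nat)"
  by (auto simp: in_keys_iff lookup_add)

lemma keys_content: "finite D \<Longrightarrow> Poly_Mapping.keys (content D T) = T ` D"
proof (induction D rule: finite_induct)
  case empty
  then show ?case by (simp add: content_def)
next
  case (insert p D)
  then show ?case by (simp add: content_def keys_plus_nat)
qed

lemma finite_tableaux_of_content:
  "finite {T \<in> tableaux m l a. content (diagram l a) T = \<mu>}"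
proof (rule finite_subset)
  show "{T \<in> tableaux m l a. content (diagram l a) T = \<mu>}
      \<subseteq> (\<Pi>\<^sub>E p\<in>diagram l a. Poly_Mapping.keys \<mu>)"
  proof
    fix T assume "T \<in> {T \<in> tableaux m l a. content (diagram l a) T = \<mu>}"
    then have "T \<in> extensional (diagram l a)" and "Poly_Mapping.keys \<mu> = T ` diagram l a"
      using keys_content[OF finite_diagram, of l a T] by (auto simp: tableaux_def PiE_def)
    then show "T \<in> (\<Pi>\<^sub>E p\<in>diagram l a. Poly_Mapping.keys \<mu>)"
      by (simp add: PiE_iff)
  qed
  show "finite (\<Pi>\<^sub>E p\<in>diagram l a. Poly_Mapping.keys \<mu>)"
    by (intro finite_PiE finite_diagram) auto
qed

lemma finite_words_of_weight: "finite {w. wt w = (\<mu> :: rat \<Rightarrow>\<^sub>0 nat)}"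
proof (rule finite_subset)
  have keys: "Poly_Mapping.keys (wt w :: rat \<Rightarrow>\<^sub>0 nat) = set w" for w
    by (induction w) (auto simp: wt_def keys_plus_nat)
  have lookup: "Poly_Mapping.lookup (wt w :: rat \<Rightarrow>\<^sub>0 nat) b = count_list w b" for w b
    by (induction w) (auto simp: wt_def lookup_add lookup_single)
  have len: "(\<Sum>b\<in>Poly_Mapping.keys (wt w :: rat \<Rightarrow>\<^sub>0 nat). Poly_Mapping.lookup (wt w) b)
      = length w" for w
    by (simp add: keys lookup sum_count_set)
  show "{w. wt w = \<mu>} \<subseteq> {w. set w \<subseteq> Poly_Mapping.keys \<mu>
      \<and> length w = (\<Sum>b\<in>Poly_Mapping.keys \<mu>. Poly_Mapping.lookup \<mu> b)}"
    using keys len by auto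
  show "finite {w. set w \<subseteq> Poly_Mapping.keys \<mu>
      \<and> length w = (\<Sum>b\<in>Poly_Mapping.keys \<mu>. Poly_Mapping.lookup \<mu> b)}"
    by (rule finite_lists_length_eq) simp
qed

end

(*
  Order the positions of a word by their letters, equal even letters from right to left and equal odd
  letters from left to right. The operators with index >= 0 do not change this order; those with index
  < 0 act on the subword of negative letters by the usual gl_m bracketing rule.

  Every component contains a highest weight word w. Its negative letters form a Yamanouchi word u of
  some content l, and its positive letters a word r whose components behave like fundamental
  quasisymmetric functions: only the relative positions of order-consecutive letters of r matter, and
  they give the composition. If r is nonempty, the first -1 precedes the smallest letter of r. This
  property of the order survives along the component, so moving all positions of u in front of those
  of r is an isomorphism of crystals. Knuth moves are isomorphisms as well and connect all Yamanouchi
  words of content l, so u may be replaced by the row reading of the tableau whose rows are constant.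
  The fillings of the diagram (l, a), read row by row from right to left, are closed under all
  operators and contain only one highest weight word, hence they form the component of u @ r.

  The highest weight word of this component determines (l, a) by its content and is its unique word of
  least height, which gives linear independence. A product of two components is the set of all
  concatenations, which is closed under all operators and thus a finite union of components.
*)

theory Submission
  imports Defs "HOL-Library.Multiset"
begin

section \<open>The crystal graph in terms of words\<close>

text \<open>The tie rule in the order of positions is forced. Put \<open>b = nxt a\<close> with
  \<open>b\<close> positive; then \<open>a\<close> and \<open>b\<close> have opposite parity. If
  \<open>a\<close> is even, the operator for this pair acts on the leftmost letter among
  \<open>a\<close> and \<open>b\<close>. The leftmost \<open>a\<close> is the last of the letters
  \<open>a\<close>, which are ordered from right to left; once turned into \<open>b\<close> it is
  the first of the letters \<open>b\<close>, which are ordered from left to right. So its place in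
  the order stays the same. For odd \<open>a\<close> left and right are exchanged. The conditions on
  a tableau can be stated through this order alone, hence only operators with negative index need an
  argument about brackets.

  The positive part of a highest weight word may have its positions in any order. Therefore the
  reading of the ribbon is not fixed: it is given by an arbitrary permutation \<open>q\<close>,
  whose ascents determine the composition.

  The alphabet is unbounded above, so components are infinite in general. Finiteness always comes
  from highest weight words: those of a given length use a bounded part of the alphabet.\<close>

definition nxt :: "rat \<Rightarrow> rat" where
  "nxt a = (if a < -1 then a + 1 else if a = -1 then 1 / 2 else a + 1 / 2)"

lemma letters_cases:
  assumes "b \<in> letters m"
  obtains (neg) k where "1 \<le> k" "k \<le> m" "b = - of_nat k" "b \<in> \<int>" "b < 0"
  | (pos) k where "1 \<le> k" "b = of_nat k / 2" "b > 0"
  using assms by (force simp: letters_def)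

lemma half_nat_Ints: "(of_nat k / 2 :: rat) \<in> \<int> \<longleftrightarrow> even k"
proof
  assume "(of_nat k / 2 :: rat) \<in> \<int>"
  then obtain z where "(of_nat k / 2 :: rat) = of_int z" by (auto elim: Ints_cases)
  then have "(of_nat k :: rat) = of_int (2 * z)" by simp
  then have "int k = 2 * z" by (metis of_int_eq_iff of_int_of_nat_eq)
  then show "even k" by presburger
next
  assume "even k"
  then show "(of_nat k / 2 :: rat) \<in> \<int>" by (auto elim!: evenE)
qed

lemma letters_neg_Ints: "b \<in> letters m \<Longrightarrow> b < 0 \<Longrightarrow> b \<in> \<int>"
  by (erule letters_cases) auto

lemma letters_nonzero: "b \<in> letters m \<Longrightarrow> b \<noteq> 0"
  by (erule letters_cases) auto

lemma nxt_letters: "a \<in> letters m \<Longrightarrow> nxt a \<in> letters m"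
proof (erule letters_cases)
  fix k assume k: "1 \<le> k" "k \<le> m" "a = - of_nat k"
  show "nxt a \<in> letters m"
  proof (cases "k = 1")
    case True
    then show ?thesis using k by (auto simp: nxt_def letters_def intro!: exI[of _ 1])
  next
    case False
    then have "nxt a = - of_nat (k - 1)" "1 \<le> k - 1" "k - 1 \<le> m"
      using k by (auto simp: nxt_def of_nat_diff)
    then show ?thesis unfolding letters_def by blast
  qed
next
  fix k assume k: "1 \<le> k" "a = of_nat k / 2"
  then have "nxt a = of_nat (Suc k) / 2" by (simp add: nxt_def field_simps)
  then show "nxt a \<in> letters m" unfolding letters_def by (auto intro!: exI[of _ "Suc k"])
qed

lemma nxt_greater: "a < nxt a"
  by (simp add: nxt_def)

lemma nxt_le:
  assumes "a \<in> letters m" "c \<in> letters m" "a < c"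
  shows "nxt a \<le> c"
  using assms(1)
proof (cases rule: letters_cases)
  case (neg k)
  from assms(2) show ?thesis
  proof (cases rule: letters_cases)
    case (neg j)
    then have "j < k" using assms(3) \<open>a = - of_nat k\<close> by simp
    then have "Suc j \<le> k" by simp
    then have "(of_nat (Suc j) :: rat) \<le> of_nat k" by (simp only: of_nat_le_iff)
    then show ?thesis using neg \<open>a = - of_nat k\<close> \<open>a < 0\<close>
      by (auto simp: nxt_def)
  next
    case (pos j)
    then have "(1::rat) \<le> of_nat j" by simp
    then show ?thesis using pos neg by (auto simp: nxt_def)
  qed
next
  case (pos k)
  from assms(2) show ?thesis
  proof (cases rule: letters_cases)
    case (neg j)
    then show ?thesis using pos assms by auto
  next
    case (pos j)
    then have "Suc k \<le> j" using assms(3) \<open>a = of_nat k / 2\<close> by simp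
    then have "(of_nat (Suc k) :: rat) \<le> of_nat j" by (simp only: of_nat_le_iff)
    then show ?thesis using pos \<open>a = of_nat k / 2\<close> by (auto simp: nxt_def field_simps)
  qed
qed

text \<open>From \<open>-1\<close> upwards the parities alternate; only two negative neighbours
  share their parity. The sign of \<open>nxt a\<close> therefore separates the bracketing rule from
  the two one-sided rules in all later case distinctions.\<close>

lemma nxt_pos_parity: "a \<in> letters m \<Longrightarrow> 0 < nxt a \<Longrightarrow> nxt a \<in> \<int> \<longleftrightarrow> a \<notin> \<int>"
proof (erule letters_cases)
  fix k assume k: "1 \<le> k" "k \<le> m" "a = - of_nat k" "0 < nxt a"
  then have "k = 1" by (auto simp: nxt_def split: if_splits)
  then show ?thesis using k half_nat_Ints[of 1] by (simp add: nxt_def)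
next
  fix k assume k: "1 \<le> k" "a = of_nat k / 2"
  then have "nxt a = of_nat (Suc k) / 2" by (simp add: nxt_def field_simps)
  then show ?thesis using half_nat_Ints[of k] half_nat_Ints[of "Suc k"] unfolding k(2) by (metis even_Suc)
qed

lemma pred_exists:
  assumes "b \<in> letters m" "b \<noteq> (if m = 0 then 1 / 2 else - of_nat m)"
  obtains a where "a \<in> letters m" "nxt a = b"
  using assms(1)
proof (cases rule: letters_cases)
  case (neg k)
  then have "k < m" using assms by (cases "k = m") auto
  then have "- of_nat (Suc k) \<in> letters m" unfolding letters_def by (auto intro!: exI[of _ "Suc k"])
  moreover have "nxt (- of_nat (Suc k)) = b" using neg by (simp add: nxt_def)
  ultimately show ?thesis using that by blast
next
  case (pos k)
  show ?thesis
  proof (cases "k = 1")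
    case True
    then have "m \<noteq> 0" using pos assms(2) by (metis of_nat_1)
    then have "-1 \<in> letters m" unfolding letters_def by (auto intro!: exI[of _ 1])
    moreover have "nxt (-1) = b" using True pos by (simp add: nxt_def)
    ultimately show ?thesis using that by blast
  next
    case False
    then have "of_nat (k - 1) / 2 \<in> letters m" using pos unfolding letters_def by (auto intro!: exI[of _ "k - 1"])
    moreover have "nxt (of_nat (k - 1) / 2) = b" using False pos
      by (auto simp: nxt_def of_nat_diff field_simps)
    ultimately show ?thesis using that by blast
  qed
qed

lemma letters_least: "b \<in> letters m \<Longrightarrow> (if m = 0 then 1 / 2 else - of_nat m) \<le> b"
  by (erule letters_cases) (auto simp: field_simps)

text \<open>Simple roots are relabelled by the letter that enters with a plus sign. The shift for
  negative letters comes from the convention \<open>eps (i - 1) - eps i\<close>; it also sends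
  \<open>-1\<close> to the index \<open>0\<close>.\<close>

definition root_index :: "rat \<Rightarrow> rat" where
  "root_index a = (if a < 0 then a + 1 else a)"

lemma indices_eq: "indices m = root_index ` letters m"
proof (intro equalityI subsetI)
  fix i assume "i \<in> indices m"
  then consider (a) z :: int where "i = of_int z" "- int m + 1 \<le> z" "z \<le> -1" | (b) "1 \<le> m" "i = 0"
    | (c) k :: nat where "1 \<le> k" "i = of_nat k / 2"
    by (auto simp: indices_def split: if_splits)
  then show "i \<in> root_index ` letters m"
  proof cases
    case a
    then have "- of_nat (nat (1 - z)) \<in> letters m" unfolding letters_def by (auto intro!: exI[of _ "nat (1 - z)"])
    moreover have "root_index (- of_nat (nat (1 - z))) = i" using a by (simp add: root_index_def)
    ultimately show ?thesis by (metis imageI)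
  next
    case b
    then have "-1 \<in> letters m" unfolding letters_def by (auto intro!: exI[of _ 1])
    then show ?thesis using b by (force simp: root_index_def image_iff)
  next
    case c
    then have "i \<in> letters m" unfolding letters_def by auto
    then show ?thesis using c by (force simp: root_index_def image_iff)
  qed
next
  fix i assume "i \<in> root_index ` letters m"
  then obtain a where a: "a \<in> letters m" "i = root_index a" by auto
  from a(1) show "i \<in> indices m"
  proof (cases rule: letters_cases)
    case (neg k)
    show ?thesis
    proof (cases "k = 1")
      case True
      then show ?thesis using neg a by (auto simp: root_index_def indices_def)
    next
      case False
      then have "i = of_int (1 - int k)" "- int m + 1 \<le> 1 - int k" "1 - int k \<le> -1"
        using neg a by (auto simp: root_index_def)
      then show ?thesis unfolding indices_def by blast
    qed
  next
    case (pos k)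
    then show ?thesis using a by (auto simp: root_index_def indices_def)
  qed
qed

lemma root_index_props:
  assumes "a \<in> letters m"
  shows "simple_root (root_index a) = eps a - eps (nxt a)"
    and "root_index a < 0 \<longleftrightarrow> nxt a < 0"
    and "root_index a \<in> \<int> \<longleftrightarrow> a \<in> \<int>"
proof -
  show "simple_root (root_index a) = eps a - eps (nxt a)"
    using assms
  proof (cases rule: letters_cases)
    case (neg k)
    then have "k = 1 \<or> a < -1" by (cases "k = 1") auto
    then show ?thesis using neg by (auto simp: simple_root_def root_index_def nxt_def)
  next
    case (pos k)
    then show ?thesis by (auto simp: simple_root_def root_index_def nxt_def)
  qed
  show "root_index a < 0 \<longleftrightarrow> nxt a < 0"
    using assms
  proof (cases rule: letters_cases)
    case (neg k)
    then have "k = 1 \<or> a < -1" by (cases "k = 1") auto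
    then show ?thesis using neg by (auto simp: root_index_def nxt_def)
  next
    case (pos k)
    then show ?thesis by (auto simp: root_index_def nxt_def)
  qed
  show "root_index a \<in> \<int> \<longleftrightarrow> a \<in> \<int>"
    using assms by (auto simp: root_index_def dest: letters_neg_Ints)
qed

lemma eps_diff_eq:
  assumes "a \<noteq> b" "(eps a - eps b :: rat \<Rightarrow>\<^sub>0 int) = eps c - eps d"
  shows "c = a \<and> d = b"
proof -
  have e: "((1::int) when a = x) - (1 when b = x) = (1 when c = x) - (1 when d = x)" for x
    using arg_cong[OF assms(2), of "\<lambda>f. Poly_Mapping.lookup f x"]
    by (simp only: lookup_minus lookup_single)
  from e[of a] e[of b] assms(1) show ?thesis by (auto simp: when_def split: if_splits)
qed

lemma f_letter_root:
  assumes "a \<in> letters m"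
  shows "f_letter (root_index a) c = (if c = a then Some (nxt a) else None)"
proof -
  have ne: "a \<noteq> nxt a" using nxt_greater[of a] by simp
  have "simple_root (root_index a) = eps c - eps d \<longleftrightarrow> c = a \<and> d = nxt a" for d
    using root_index_props(1)[OF assms] eps_diff_eq[OF ne, of c d] by auto
  then show ?thesis unfolding f_letter_def by auto
qed

lemma e_letter_root:
  assumes "a \<in> letters m"
  shows "e_letter (root_index a) c = (if c = nxt a then Some a else None)"
proof -
  have ne: "a \<noteq> nxt a" using nxt_greater[of a] by simp
  have "simple_root (root_index a) = eps d - eps c \<longleftrightarrow> c = nxt a \<and> d = a" for d
    using root_index_props(1)[OF assms] eps_diff_eq[OF ne, of d c] by auto
  then show ?thesis unfolding e_letter_def by auto
qed

lemma lookup_wt: "Poly_Mapping.lookup (wt w :: rat \<Rightarrow>\<^sub>0 'c::comm_semiring_1) b = of_nat (count_list w b)"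
  by (induction w) (auto simp: wt_def lookup_add lookup_single when_def)

lemma form_eps_diff:
  assumes "a \<noteq> b"
  shows "form (eps a - eps b) \<nu> = parity_sign a * Poly_Mapping.lookup \<nu> a - parity_sign b * Poly_Mapping.lookup \<nu> b"
proof -
  have k: "Poly_Mapping.keys (eps a - eps b :: rat \<Rightarrow>\<^sub>0 int) = {a, b}"
    using assms by (auto simp: in_keys_iff lookup_minus lookup_single when_def split: if_splits)
  show ?thesis unfolding form_def k using assms by (simp add: lookup_minus lookup_single when_def)
qed

text \<open>For letters of opposite parity the signs of the form cancel the minus sign of the root,
  so the pairing counts both letters together and vanishes only if neither occurs. For two negative
  letters it is the usual difference.\<close>

lemma form_root_wt:
  assumes "a \<in> letters m"
  shows "form (simple_root (root_index a)) (wt w) =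
    (if nxt a < 0 then int (count_list w a) - int (count_list w (nxt a))
     else parity_sign a * (int (count_list w a) + int (count_list w (nxt a))))"
proof -
  have ne: "a \<noteq> nxt a" using nxt_greater[of a] by simp
  have p: "parity_sign (nxt a) = (if nxt a < 0 then parity_sign a else - parity_sign a)"
  proof (cases "nxt a < 0")
    case True
    then have "a < 0" using nxt_greater[of a] by simp
    then show ?thesis using True letters_neg_Ints[OF assms] letters_neg_Ints[OF nxt_letters[OF assms]]
      by (simp add: parity_sign_def)
  next
    case False
    then show ?thesis using nxt_pos_parity[OF assms] letters_nonzero[OF nxt_letters[OF assms]]
      by (auto simp: parity_sign_def)
  qed
  have "nxt a < 0 \<Longrightarrow> parity_sign a = 1"
    using letters_neg_Ints[OF assms] nxt_greater[of a] by (simp add: parity_sign_def)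
  then show ?thesis
    by (simp add: root_index_props(1)[OF assms] form_eps_diff[OF ne] lookup_wt p algebra_simps)
qed

text \<open>For a word over a pair of letters \<open>a\<close> (opening bracket) and \<open>b\<close> (closing bracket), \<open>ep\<close> and
  \<open>ph\<close> count the unmatched closing and opening brackets.\<close>

fun excess :: "rat \<Rightarrow> rat \<Rightarrow> word \<Rightarrow> int" where
  "excess a b [] = 0"
| "excess a b (c # w) = (if c = b then 1 else 0) - (if c = a then 1 else 0) + excess a b w"

fun ep :: "rat \<Rightarrow> rat \<Rightarrow> word \<Rightarrow> int" where
  "ep a b [] = 0"
| "ep a b (c # w) = max 0 ((if c = b then 1 else 0) - (if c = a then 1 else 0) + ep a b w)"

fun ph :: "rat \<Rightarrow> rat \<Rightarrow> word \<Rightarrow> int" where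
  "ph a b [] = 0"
| "ph a b (c # w) = max (ph a b w) (- excess a b (c # w))"

lemma excess_append: "excess a b (u @ v) = excess a b u + excess a b v"
  by (induction u) auto

lemma excess_count: "a \<noteq> b \<Longrightarrow> excess a b w = int (count_list w b) - int (count_list w a)"
  by (induction w) auto

lemma ep_nonneg: "0 \<le> ep a b w"
  by (cases w) auto

lemma ph_nonneg: "0 \<le> ph a b w"
  by (induction w) auto

text \<open>\<open>ep\<close> is the largest excess of a prefix and \<open>ph\<close> the largest
  negated excess of a suffix, the empty word included. The two rules for concatenations distinguish
  in which factor the extremal cut lies.\<close>

lemma ep_append: "ep a b (u @ v) = max (ep a b u) (ep a b v + excess a b u)"
  by (induction u) (auto simp: ep_nonneg max_def)

lemma ph_append: "ph a b (u @ v) = max (ph a b v) (ph a b u - excess a b v)"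
proof (induction u)
  case Nil
  have "- excess a b v \<le> ph a b v" by (cases v) auto
  then show ?case by simp
next
  case (Cons c u)
  then show ?case by (simp add: excess_append)
qed

lemma ep_ph: "ep a b w = ph a b w + excess a b w"
  by (induction w) auto

text \<open>The condition concerns only the surroundings of the changed letter and not which of
  \<open>a\<close> and \<open>nxt a\<close> it is, so the same lemmas serve arrows followed in
  either direction. For negative letters it says that no opening bracket is left over before the
  letter and no closing one after it. Otherwise the letter is the leftmost (\<open>a\<close> even)
  or the rightmost (\<open>a\<close> odd) among \<open>a\<close> and \<open>nxt a\<close>.\<close>

definition admissible :: "rat \<Rightarrow> word \<Rightarrow> word \<Rightarrow> bool" where
  "admissible a u v = (if nxt a < 0 then ph a (nxt a) u = 0 \<and> ep a (nxt a) v = 0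
     else if a \<in> \<int> then a \<notin> set u \<and> nxt a \<notin> set u
     else a \<notin> set v \<and> nxt a \<notin> set v)"

lemma epsilon_eq_ep:
  assumes "a \<in> letters m" "nxt a < 0"
  shows "epsilon (root_index a) w = ep a (nxt a) w"
proof -
  have ne: "a \<noteq> nxt a" using nxt_greater[of a] by simp
  have "root_index a < 0" using root_index_props(2)[OF assms(1)] assms by simp
  then show ?thesis
  proof (induction "root_index a" w rule: epsilon.induct)
    case (3 b c w)
    then show ?case using assms ne
      by (auto simp: form_root_wt[OF assms(1)] epsilon_letter_def e_letter_root[OF assms(1)] ep_nonneg max_def
         split: if_splits)
  qed (auto simp: epsilon_letter_def e_letter_root[OF assms(1)] ne ne[symmetric])
qed

lemma acts_left_iff:
  assumes "a \<in> letters m" "\<not> nxt a < 0"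
  shows "acts_left (root_index a) [c] v \<longleftrightarrow>
    (if a \<in> \<int> then c = a \<or> c = nxt a else a \<notin> set v \<and> nxt a \<notin> set v)"
proof -
  have "count_list v x = 0 \<longleftrightarrow> x \<notin> set v" for x by (metis count_list_0_iff)
  moreover have "int x + int y = 0 \<longleftrightarrow> x = 0 \<and> y = 0" for x y by auto
  moreover have "parity_sign a \<noteq> 0" by (simp add: parity_sign_def)
  ultimately show ?thesis
    using assms root_index_props(3)[OF assms(1)]
    by (auto simp: acts_left_def form_root_wt[OF assms(1)] simp del: of_nat_add)
qed

text \<open>Induction along the recursion of \<open>f_op\<close>: the test made at the first letter
  is compared with what this letter does to the admissibility of later positions.\<close>

lemma f_op_iff:
  assumes a: "a \<in> letters m"
  shows "f_op (root_index a) x = Some y \<longleftrightarrow>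
    (\<exists>u v. x = u @ a # v \<and> y = u @ nxt a # v \<and> admissible a u v)"
proof (induction x arbitrary: y)
  case Nil
  then show ?case by simp
next
  case (Cons c w)
  have ne: "a \<noteq> nxt a" using nxt_greater[of a] by simp
  define L where "L \<longleftrightarrow> c = a \<and> admissible a [] w"
  have head: "(\<exists>u v. c # w = u @ a # v \<and> y = u @ nxt a # v \<and> admissible a u v) \<longleftrightarrow>
     (L \<and> y = nxt a # w) \<or> (\<exists>u v. w = u @ a # v \<and> y = c # u @ nxt a # v \<and> admissible a (c # u) v)"
    (is "?lhs \<longleftrightarrow> ?A \<or> ?B")
  proof
    assume ?lhs
    then obtain u v where uv: "c # w = u @ a # v" "y = u @ nxt a # v" "admissible a u v" by auto
    then show "?A \<or> ?B" by (cases u) (auto simp: L_def)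
  next
    assume "?A \<or> ?B"
    then show ?lhs
    proof
      assume ?A
      then show ?lhs unfolding L_def by (intro exI[of _ "[]"] exI[of _ w]) auto
    next
      assume ?B
      then obtain u v where "w = u @ a # v \<and> y = c # u @ nxt a # v \<and> admissible a (c # u) v" by auto
      then show ?lhs by (intro exI[of _ "c # u"] exI[of _ v]) auto
    qed
  qed
  show ?case
  proof (cases w)
    case Nil
    then show ?thesis unfolding head L_def using nxt_greater[of a]
      by (auto simp: f_letter_root[OF a] admissible_def)
  next
    case (Cons d w')
    define left where "left \<longleftrightarrow> (if root_index a < 0 then phi_letter (root_index a) c > epsilon (root_index a) w
      else acts_left (root_index a) [c] w)"
    have f: "f_op (root_index a) (c # w) = (if left then map_option (\<lambda>b'. b' # w) (f_letter (root_index a) c)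
       else map_option (\<lambda>w'. c # w') (f_op (root_index a) w))"
      unfolding left_def Cons by simp
    have lneg: "left \<longleftrightarrow> c = a \<and> ep a (nxt a) w = 0" if "nxt a < 0"
      using that ep_nonneg[of a "nxt a" w] root_index_props(2)[OF a]
      by (auto simp: left_def phi_letter_def f_letter_root[OF a] epsilon_eq_ep[OF a])
    have lpos: "left \<longleftrightarrow> (if a \<in> \<int> then c = a \<or> c = nxt a else a \<notin> set w \<and> nxt a \<notin> set w)" if "\<not> nxt a < 0"
      using that root_index_props(2)[OF a] acts_left_iff[OF a that] by (auto simp: left_def)
    \<comment> \<open>In the bracket case \<open>ph a (nxt a) u = 0\<close> and
      \<open>ep a (nxt a) v = 0\<close> give that \<open>ep\<close> of \<open>w\<close> is the
      excess of \<open>u\<close>. A leading \<open>a\<close> finds a partner in \<open>u\<close> iff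
      this number is positive, which is exactly when the rule passes over it.\<close>
    have adm: "admissible a (c # u) v \<longleftrightarrow> \<not> left \<and> admissible a u v" if "w = u @ a # v" for u v
    proof (cases "nxt a < 0")
      case True
      have "ep a (nxt a) w = max (ep a (nxt a) u) (excess a (nxt a) u)" if "ep a (nxt a) v = 0"
        using that ne \<open>w = u @ a # v\<close> by (simp add: ep_append)
      then have "ph a (nxt a) u = 0 \<Longrightarrow> ep a (nxt a) v = 0 \<Longrightarrow> ep a (nxt a) w = excess a (nxt a) u"
        using ep_ph[of a "nxt a" u] by simp
      then show ?thesis unfolding admissible_def lneg[OF True]
        using True ne ep_nonneg[of a "nxt a" w] ph_nonneg[of a "nxt a" u] ep_nonneg[of a "nxt a" u]
          ep_ph[of a "nxt a" u] by (auto simp: max_def split: if_splits)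
    next
      case False
      show ?thesis unfolding admissible_def lpos[OF False] using False that by auto
    qed
    have Lleft: "L \<longleftrightarrow> c = a \<and> left"
      unfolding L_def admissible_def using lneg lpos by auto
    show ?thesis
    proof (cases left)
      case True
      then show ?thesis unfolding head f using adm Lleft by (auto simp: f_letter_root[OF a])
    next
      case False
      have "(\<exists>u v. w = u @ a # v \<and> y = c # u @ nxt a # v \<and> admissible a (c # u) v) \<longleftrightarrow>
          (\<exists>y'. y = c # y' \<and> f_op (root_index a) w = Some y')"
        unfolding Cons.IH using adm False by blast
      then show ?thesis unfolding head f using Lleft False by auto
    qed
  qed
qed

definition step :: "nat \<Rightarrow> word \<Rightarrow> word \<Rightarrow> bool" where
  "step m x y \<longleftrightarrow> (\<exists>a\<in>letters m. \<exists>u v. x = u @ a # v \<and> y = u @ nxt a # v \<and> admissible a u v)"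

lemma arrows_eq: "arrows m = {(x, y). x \<in> words m \<and> step m x y}"
proof -
  have "(\<exists>i\<in>indices m. f_op i x = Some y) \<longleftrightarrow> step m x y" for x y
    unfolding indices_eq step_def by (simp add: f_op_iff)
  moreover have "y \<in> words m" if "x \<in> words m" "step m x y" for x y
    using that unfolding step_def words_def by (auto dest: nxt_letters)
  ultimately show ?thesis unfolding arrows_def by blast
qed

section \<open>Components, highest weight words and the ring\<close>

lemma words_append: "u @ v \<in> words m \<longleftrightarrow> u \<in> words m \<and> v \<in> words m"
  by (auto simp: words_def)

lemma words_Cons: "a # v \<in> words m \<longleftrightarrow> a \<in> letters m \<and> v \<in> words m"
  by (auto simp: words_def)

lemma step_words: "step m x y \<Longrightarrow> x \<in> words m \<longleftrightarrow> y \<in> words m"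
  unfolding step_def by (auto simp: words_append words_Cons dest: nxt_letters)

lemma step_length: "step m x y \<Longrightarrow> length x = length y"
  unfolding step_def by auto

lemma component_self: "w \<in> component m w"
  by (simp add: component_def)

lemma component_eq: "x \<in> component m w \<Longrightarrow> component m x = component m w"
proof -
  let ?R = "(arrows m \<union> (arrows m)\<inverse>)\<^sup>*"
  assume "x \<in> component m w"
  then have wx: "(w, x) \<in> ?R" by (simp add: component_def)
  have "sym ?R" by (intro sym_rtrancl) (auto intro: symI)
  then have "(x, w) \<in> ?R" using wx by (meson symD)
  then show ?thesis using wx unfolding component_def by (auto intro: rtrancl_trans)
qed

lemma component_step:
  assumes "x \<in> component m w" "x \<in> words m" "step m x y \<or> step m y x"
  shows "y \<in> component m w"
  using assms step_words[of m x y] step_words[of m y x] unfolding component_def arrows_eq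
  by (auto intro: rtrancl_into_rtrancl)

lemma component_induct [consumes 2, case_names base step]:
  assumes "x \<in> component m w" "w \<in> words m"
    and "P w"
    and "\<And>x y. x \<in> component m w \<Longrightarrow> x \<in> words m \<Longrightarrow> y \<in> words m \<Longrightarrow> P x
      \<Longrightarrow> step m x y \<or> step m y x \<Longrightarrow> P y"
  shows "P x"
proof -
  have "(w, x) \<in> (arrows m \<union> (arrows m)\<inverse>)\<^sup>*" using assms(1) by (simp add: component_def)
  then have "x \<in> words m \<and> x \<in> component m w \<and> P x"
  proof (induction rule: rtrancl_induct)
    case base
    then show ?case using assms by (simp add: component_self)
  next
    case (step y z)
    then have s: "step m y z \<or> step m z y" by (auto simp: arrows_eq)
    have z: "z \<in> words m" using s step step_words by blast
    have "z \<in> component m w" using component_step[of y m w z] s step by blast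
    then show ?case using assms(4)[of y z] s z step by blast
  qed
  then show ?thesis by blast
qed

lemma component_words: "w \<in> words m \<Longrightarrow> x \<in> component m w \<Longrightarrow> x \<in> words m"
  by (erule component_induct) auto

lemma component_length: "w \<in> words m \<Longrightarrow> x \<in> component m w \<Longrightarrow> length x = length w"
  by (erule component_induct) (auto dest: step_length)

lemma wt_eq_iff: "(wt x :: rat \<Rightarrow>\<^sub>0 nat) = wt y \<longleftrightarrow> mset x = mset y"
proof
  assume h: "(wt x :: rat \<Rightarrow>\<^sub>0 nat) = wt y"
  have "count_list x b = count_list y b" for b
    using arg_cong[OF h, of "\<lambda>f. Poly_Mapping.lookup f b"] by (simp add: lookup_wt)
  then show "mset x = mset y" by (simp add: multiset_eq_iff count_mset)
next
  assume h: "mset x = mset y"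
  have "count_list x b = count_list y b" for b
    by (metis h count_mset)
  then show "(wt x :: rat \<Rightarrow>\<^sub>0 nat) = wt y" by (intro poly_mapping_eqI) (simp add: lookup_wt)
qed

lemma wt_append: "wt (x @ y) = wt x + wt y"
  by (simp add: wt_def)

definition is_hw :: "nat \<Rightarrow> word \<Rightarrow> bool" where
  "is_hw m w \<longleftrightarrow> (\<forall>x. \<not> step m x w)"

text \<open>Neighbouring letters are at least one half apart, so after doubling every arrow raises
  the height. Adding \<open>2 * of_nat m\<close> makes the contribution of each letter nonnegative,
  and \<open>nat\<close> truncates nothing.\<close>

definition height :: "nat \<Rightarrow> word \<Rightarrow> nat" where
  "height m w = sum_list (map (\<lambda>b. nat \<lfloor>2 * b + 2 * of_nat m\<rfloor>) w)"

lemma height_mset: "mset x = mset y \<Longrightarrow> height m x = height m y"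
proof -
  assume h: "mset x = mset y"
  have "height m x = sum_mset (image_mset (\<lambda>b. nat \<lfloor>2 * b + 2 * of_nat m\<rfloor>) (mset x))" for x
    unfolding height_def by (simp add: sum_mset_sum_list flip: mset_map)
  then show ?thesis using h by simp
qed

lemma step_height: "step m x y \<Longrightarrow> height m x < height m y"
proof -
  assume "step m x y"
  then obtain a u v where a: "a \<in> letters m" "x = u @ a # v" "y = u @ nxt a # v"
    unfolding step_def by auto
  have "(if m = 0 then 1 / 2 else - rat_of_nat m) \<le> a" using letters_least[OF a(1)] .
  then have ge: "0 \<le> 2 * a + 2 * of_nat m" by (auto split: if_splits)
  have "2 * a + 2 * of_nat m + 1 \<le> 2 * nxt a + 2 * of_nat m"
    unfolding nxt_def by (auto simp: field_simps)
  then have "\<lfloor>2 * a + 2 * of_nat m + 1\<rfloor> \<le> \<lfloor>2 * nxt a + 2 * of_nat m\<rfloor>" by (rule floor_mono)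
  then have "\<lfloor>2 * a + 2 * of_nat m\<rfloor> + 1 \<le> \<lfloor>2 * nxt a + 2 * of_nat m\<rfloor>" by simp
  moreover have "0 \<le> \<lfloor>2 * a + 2 * of_nat m\<rfloor>" using ge by (simp only: zero_le_floor)
  ultimately show ?thesis using a by (simp add: height_def)
qed

lemma hw_exists:
  assumes "w \<in> words m"
  shows "\<exists>h\<in>component m w. is_hw m h"
proof -
  define h where "h = arg_min (height m) (\<lambda>x. x \<in> component m w)"
  have h: "h \<in> component m w" unfolding h_def by (rule arg_min_natI) (rule component_self)
  have "is_hw m h"
    unfolding is_hw_def
  proof safe
    fix x assume x: "step m x h"
    then have "x \<in> component m w" using component_step[OF h, of x] component_words[OF assms h] by blast
    then have "height m h \<le> height m x" unfolding h_def by (rule arg_min_nat_le)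
    then show False using step_height[OF x] by simp
  qed
  then show ?thesis using h by blast
qed

text \<open>A closed set is a union of components, and each component contains a highest weight
  word; uniqueness leaves room for one component only.\<close>

lemma component_of_unique_hw:
  assumes tableau_words: "tableau_words \<subseteq> words m" "\<And>x y. x \<in> tableau_words \<Longrightarrow> step m x y \<or> step m y x \<Longrightarrow> y \<in> tableau_words"
    and hw: "\<And>x y. x \<in> tableau_words \<Longrightarrow> is_hw m x \<Longrightarrow> y \<in> tableau_words \<Longrightarrow> is_hw m y \<Longrightarrow> x = y"
    and w: "w \<in> tableau_words"
  shows "component m w = tableau_words"
proof -
  have sub: "component m x \<subseteq> tableau_words" if "x \<in> tableau_words" for x
  proof
    fix y assume "y \<in> component m x"
    then show "y \<in> tableau_words" by (rule component_induct) (use tableau_words that in auto)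
  qed
  have "y \<in> component m w" if y: "y \<in> tableau_words" for y
  proof -
    obtain h where h: "h \<in> component m y" "is_hw m h" using hw_exists[of y m] tableau_words y by blast
    obtain h' where h': "h' \<in> component m w" "is_hw m h'" using hw_exists[of w m] tableau_words w by blast
    have "h = h'" using hw[OF _ h(2) _ h'(2)] sub h h' w y by blast
    then show ?thesis using component_eq[OF h(1)] component_eq[OF h'(1)] component_self[of y m] by simp
  qed
  then show ?thesis using sub[OF w] by blast
qed

section \<open>Characters under bijections that respect the arrows\<close>

lemma coeff_character: "coeff (character A x) \<mu> = int (card {a \<in> A. x a = \<mu>})"
  by (simp add: character_def Series_inverse)

lemma character_reindex:
  assumes "inj_on g A" "\<And>a. a \<in> A \<Longrightarrow> y (g a) = x a"
  shows "character (g ` A) y = character A x"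
proof (rule series_eqI)
  fix \<mu>
  have "{b \<in> g ` A. y b = \<mu>} = g ` {a \<in> A. x a = \<mu>}" using assms(2) by auto
  moreover have "inj_on g {a \<in> A. x a = \<mu>}" using assms(1) by (auto simp: inj_on_def)
  ultimately show "coeff (character (g ` A) y) \<mu> = coeff (character A x) \<mu>"
    by (simp add: coeff_character card_image)
qed

text \<open>\<open>D\<close> may be defined on a closed set larger than the component. The
  hypotheses \<open>bwd1\<close> and \<open>bwd2\<close> say that all arrows at \<open>D x\<close>
  come from arrows at \<open>x\<close>, so the image of the component is a whole component. This is
  applied to Knuth moves and to the separation of negative from positive letters.\<close>

lemma ch_component_transfer:
  assumes S: "w \<in> words m" "w \<in> S" "D w \<in> words m"
    and closed: "\<And>x y. x \<in> S \<Longrightarrow> x \<in> words m \<Longrightarrow> step m x y \<or> step m y x \<Longrightarrow> y \<in> S"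
    and fwd: "\<And>x y. x \<in> S \<Longrightarrow> x \<in> words m \<Longrightarrow> step m x y \<Longrightarrow> step m (D x) (D y)"
    and bwd1: "\<And>x z. x \<in> S \<Longrightarrow> x \<in> words m \<Longrightarrow> step m (D x) z \<Longrightarrow> \<exists>y. z = D y \<and> step m x y"
    and bwd2: "\<And>x z. x \<in> S \<Longrightarrow> x \<in> words m \<Longrightarrow> step m z (D x) \<Longrightarrow> \<exists>y. z = D y \<and> step m y x"
    and inj: "inj_on D S"
    and mset: "\<And>x. x \<in> S \<Longrightarrow> mset (D x) = mset x"
  shows "ch_component m (D w) = ch_component m w"
proof -
  have sub: "x \<in> S \<and> D x \<in> component m (D w)" if "x \<in> component m w" for x
    using that S(1)
  proof (induction rule: component_induct)
    case base
    then show ?case using S by (simp add: component_self)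
  next
    case (step x y)
    have y: "y \<in> S" using closed step by blast
    moreover have "step m (D x) (D y) \<or> step m (D y) (D x)" using step fwd y by blast
    moreover have "D x \<in> words m" using component_words[OF S(3)] step by blast
    ultimately show ?case using component_step[of "D x" m "D w" "D y"] step by blast
  qed
  have "z \<in> D ` component m w" if "z \<in> component m (D w)" for z
    using that S(3)
  proof (induction rule: component_induct)
    case base
    then show ?case by (simp add: component_self)
  next
    case (step z z')
    then obtain x where x: "x \<in> component m w" "z = D x" by auto
    have xw: "x \<in> S" "x \<in> words m" using sub x component_words[OF S(1)] by auto
    then obtain y where "z' = D y" "step m x y \<or> step m y x"
      using bwd1 bwd2 step x by metis
    then show ?case using component_step[OF x(1) xw(2)] by blast
  qed
  then have "component m (D w) = D ` component m w" using sub by blast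
  then show ?thesis unfolding ch_component_def
    using sub mset by (auto simp: wt_eq_iff intro!: character_reindex inj_on_subset[OF inj])
qed

section \<open>Arrows between concatenated words\<close>

lemma admissible_append:
  "admissible a u (v @ y) \<Longrightarrow> admissible a u v" "admissible a (x @ u) v \<Longrightarrow> admissible a u v"
  using ep_nonneg[of a "nxt a" v] ph_nonneg[of a "nxt a" u]
  by (auto simp: admissible_def ep_append ph_append max_def split: if_splits)

text \<open>Cutting off letters at the far ends of the surroundings creates neither unmatched
  brackets nor competing letters, so a position admissible in the concatenation is admissible in its
  factor. The converse fails; thus the concatenations of two components form a closed set, which may
  consist of several components.\<close>

lemma step_appendD:
  assumes "step m (x @ y) z"
  shows "(\<exists>x'. z = x' @ y \<and> step m x x') \<or> (\<exists>y'. z = x @ y' \<and> step m y y')"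
proof -
  obtain a u v where a: "a \<in> letters m" "x @ y = u @ a # v" "z = u @ nxt a # v" "admissible a u v"
    using assms unfolding step_def by auto
  from a(2) consider (l) t where "x = u @ a # t" "v = t @ y" | (r) t where "u = x @ t" "y = t @ a # v"
    by (auto simp: append_eq_append_conv2 Cons_eq_append_conv append_eq_Cons_conv)
  then show ?thesis
  proof cases
    case l
    then have "step m x (u @ nxt a # t)" using a unfolding step_def by (metis admissible_append(1))
    then show ?thesis using l a by auto
  next
    case r
    then have "step m y (t @ nxt a # v)" using a unfolding step_def by (metis admissible_append(2))
    then show ?thesis using r a by auto
  qed
qed

lemma step_appendD':
  assumes "step m z (x @ y)"
  shows "(\<exists>x'. z = x' @ y \<and> step m x' x) \<or> (\<exists>y'. z = x @ y' \<and> step m y' y)"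
proof -
  obtain a u v where a: "a \<in> letters m" "x @ y = u @ nxt a # v" "z = u @ a # v" "admissible a u v"
    using assms unfolding step_def by auto
  from a(2) consider (l) t where "x = u @ nxt a # t" "v = t @ y" | (r) t where "u = x @ t" "y = t @ nxt a # v"
    by (auto simp: append_eq_append_conv2 Cons_eq_append_conv append_eq_Cons_conv)
  then show ?thesis
  proof cases
    case l
    then have "step m (u @ a # t) x" using a unfolding step_def by (metis admissible_append(1))
    then show ?thesis using l a by auto
  next
    case r
    then have "step m (t @ a # v) y" using a unfolding step_def by (metis admissible_append(2))
    then show ?thesis using r a by auto
  qed
qed

text \<open>The position found is that of the rightmost unmatched closing bracket. It is the one
  that can be turned back into \<open>a\<close>.\<close>

lemma ep_pos_split:
  assumes "a \<noteq> b" "0 < ep a b w"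
  shows "\<exists>u v. w = u @ b # v \<and> ph a b u = 0 \<and> ep a b v = 0 \<and> ep a b w = excess a b u + 1"
  using assms(2)
proof (induction w)
  case Nil
  then show ?case by simp
next
  case (Cons c w)
  show ?case
  proof (cases "0 < ep a b w")
    case True
    then obtain u v where uv: "w = u @ b # v" "ph a b u = 0" "ep a b v = 0" "ep a b w = excess a b u + 1"
      using Cons.IH by blast
    show ?thesis
      using Cons.prems uv assms(1) ep_ph[of a b u] ep_nonneg[of a b u]
      by (intro exI[of _ "c # u"] exI[of _ v]) (auto simp: max_def split: if_splits)
  next
    case False
    then have "ep a b w = 0" using ep_nonneg[of a b w] by simp
    then show ?thesis using Cons.prems assms(1)
      by (intro exI[of _ "[]"] exI[of _ w]) (auto split: if_splits)
  qed
qed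

section \<open>Which letters occur in highest weight words\<close>

lemma hw_ep:
  assumes "is_hw m w" "a \<in> letters m" "nxt a < 0"
  shows "ep a (nxt a) w = 0"
proof (rule ccontr)
  assume "ep a (nxt a) w \<noteq> 0"
  then have "0 < ep a (nxt a) w" using ep_nonneg[of a "nxt a" w] by simp
  then obtain u v where "w = u @ nxt a # v" "ph a (nxt a) u = 0" "ep a (nxt a) v = 0"
    using ep_pos_split[of a "nxt a" w] nxt_greater[of a] by auto
  then have "step m (u @ a # v) w" using assms unfolding step_def admissible_def by auto
  then show False using assms(1) by (simp add: is_hw_def)
qed

lemma hw_even:
  assumes "is_hw m (u @ nxt a # v)" "a \<in> letters m" "0 < nxt a" "a \<in> \<int>"
  shows "a \<in> set u \<or> nxt a \<in> set u"
  using assms unfolding is_hw_def step_def admissible_def by fastforce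

lemma hw_odd:
  assumes "is_hw m (u @ nxt a # v)" "a \<in> letters m" "0 < nxt a" "a \<notin> \<int>"
  shows "a \<in> set v \<or> nxt a \<in> set v"
  using assms unfolding is_hw_def step_def admissible_def by fastforce

lemma ep_prefix_zero: "ep a b (u @ v) = 0 \<Longrightarrow> ep a b u = 0"
  using ep_nonneg[of a b u] by (simp add: ep_append max_def split: if_splits)

text \<open>Without an \<open>a\<close> in front, the prefix ending in this \<open>nxt a\<close>
  would have positive excess.\<close>

lemma hw_pred_before:
  assumes "is_hw m (u @ nxt a # v)" "a \<in> letters m" "nxt a < 0"
  shows "a \<in> set u"
proof (rule ccontr)
  assume n: "a \<notin> set u"
  have "a \<noteq> nxt a" using nxt_greater[of a] by simp
  have "ep a (nxt a) (u @ [nxt a]) = 0"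
    using hw_ep[OF assms] ep_prefix_zero[of a "nxt a" "u @ [nxt a]" v] by simp
  moreover have "0 \<le> excess a (nxt a) u" using n \<open>a \<noteq> nxt a\<close> by (simp add: excess_count count_list_0_iff)
  ultimately show False using \<open>a \<noteq> nxt a\<close> by (simp add: ep_append max_def split: if_splits)
qed

text \<open>The one-sided rules offer \<open>a\<close> or another \<open>nxt a\<close>. Looking at
  the first occurrence of \<open>nxt a\<close> in the even case, and at the last one in the odd
  case, rules out the second alternative.\<close>

lemma hw_pred:
  assumes "is_hw m w" "a \<in> letters m" "nxt a \<in> set w"
  shows "a \<in> set w"
proof (cases "nxt a < 0")
  case True
  then show ?thesis using assms hw_pred_before by (metis UnCI set_append split_list)
next
  case False
  then have "0 < nxt a" using letters_nonzero[OF nxt_letters[OF assms(2)]] by simp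
  obtain u v where f: "w = u @ nxt a # v" "nxt a \<notin> set u"
    using split_list_first[OF assms(3)] by blast
  obtain u' v' where l: "w = u' @ nxt a # v'" "nxt a \<notin> set v'"
    using split_list_last[OF assms(3)] by blast
  show ?thesis
  proof (cases "a \<in> \<int>")
    case True
    have "a \<in> set u"
      using hw_even[OF assms(1)[unfolded f(1)] assms(2) \<open>0 < nxt a\<close> True] f(2) by blast
    then show ?thesis using f(1) by simp
  next
    case False
    have "a \<in> set v'"
      using hw_odd[OF assms(1)[unfolded l(1)] assms(2) \<open>0 < nxt a\<close> False] l(2) by blast
    then show ?thesis using l(1) by simp
  qed
qed

text \<open>The positive letters that occur form an initial segment of the positive letters, and a
  word of length \<open>n\<close> has room for at most \<open>n\<close> of them.\<close>

lemma finite_hw: "finite {w \<in> words m. is_hw m w \<and> length w = n}"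
proof -
  \<comment> \<open>Descending from \<open>of_nat k / 2\<close> by \<open>hw_pred\<close> down to
    \<open>1 / 2\<close> yields \<open>k\<close> different letters of the word.\<close>
  have bound: "k \<le> card (set w)" if w: "w \<in> words m" "is_hw m w" "(of_nat k / 2 :: rat) \<in> set w" "1 \<le> k" for k w
  proof -
    have "(of_nat (k - j) / 2 :: rat) \<in> set w" if "j < k" for j
      using that
    proof (induction j)
      case 0
      then show ?case using w by simp
    next
      case (Suc j)
      then have l: "(of_nat (k - Suc j) / 2 :: rat) \<in> letters m" unfolding letters_def by (auto simp del: of_nat_diff intro!: exI[of _ "k - Suc j"])
      have n: "nxt (of_nat (k - Suc j) / 2) = of_nat (k - j) / 2"
        using Suc.prems by (auto simp: nxt_def of_nat_diff field_simps)
      show ?case using hw_pred[OF w(2) l, unfolded n] Suc.IH Suc_lessD[OF Suc.prems] by blast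
    qed
    then have "(\<lambda>j. of_nat (k - j) / 2) ` {..<k} \<subseteq> set w" by auto
    moreover have "inj_on (\<lambda>j. of_nat (k - j) / 2 :: rat) {..<k}" by (auto simp: inj_on_def)
    ultimately show ?thesis by (metis card_image card_lessThan card_mono finite_set)
  qed
  let ?A = "(\<lambda>k. - of_nat k) ` {..m} \<union> (\<lambda>k. of_nat k / 2 :: rat) ` {..n}"
  have "{w \<in> words m. is_hw m w \<and> length w = n} \<subseteq> {w. set w \<subseteq> ?A \<and> length w = n}"
  proof safe
    fix w b assume w: "w \<in> words m" "is_hw m w" "n = length w" "b \<in> set w"
      "b \<notin> (\<lambda>k. of_nat k / 2) ` {..length w}"
    have "b \<in> letters m" using w by (auto simp: words_def)
    then show "b \<in> (\<lambda>k. - of_nat k) ` {..m}"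
    proof (cases rule: letters_cases)
      case (pos k)
      then have "k \<le> card (set w)" using bound w by blast
      then have "k \<le> length w" using card_length le_trans by blast
      then show ?thesis using w pos by auto
    qed auto
  qed
  moreover have "finite {w. set w \<subseteq> ?A \<and> length w = n}" by (rule finite_lists_length_eq) simp
  ultimately show ?thesis by (rule finite_subset)
qed

section \<open>Closed sets of words, products and the ring\<close>

lemma coeff_sum: "coeff (sum f A) \<mu> = (\<Sum>a\<in>A. coeff (f a) \<mu>)"
  by (induction A rule: infinite_finite_induct) (auto simp: zero_series.rep_eq plus_series.rep_eq)

text \<open>The span contains finite sums only, whereas \<open>Z\<close> may be infinite. As all
  words of \<open>Z\<close> have the same length, only finitely many highest weight words are
  available, and each component inside \<open>Z\<close> contains one of them.\<close>

lemma character_closed_in_R: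
  assumes Z: "Z \<subseteq> words m" "\<And>z. z \<in> Z \<Longrightarrow> length z = n"
    and closed: "\<And>x y. x \<in> Z \<Longrightarrow> step m x y \<or> step m y x \<Longrightarrow> y \<in> Z"
  shows "character Z wt \<in> R_carrier m"
proof -
  have sub: "component m x \<subseteq> Z" if "x \<in> Z" for x
  proof
    fix y assume "y \<in> component m x"
    then show "y \<in> Z" by (rule component_induct) (use that Z closed in auto)
  qed
  define K where "K = component m ` Z"
  have "K \<subseteq> component m ` {w \<in> words m. is_hw m w \<and> length w = n}"
  proof
    fix C assume "C \<in> K"
    then obtain z where z: "z \<in> Z" "C = component m z" by (auto simp: K_def)
    obtain h where "h \<in> component m z" "is_hw m h" using hw_exists z Z by blast
    then show "C \<in> component m ` {w \<in> words m. is_hw m w \<and> length w = n}"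
      using z sub Z component_eq[of h m z] by (intro image_eqI[of _ _ h]) auto
  qed
  then have fin: "finite K" using finite_hw finite_surj by metis
  have disj: "C \<inter> C' = {}" if C: "C \<in> K" "C' \<in> K" "C \<noteq> C'" for C C'
  proof -
    obtain x y where xy: "C = component m x" "C' = component m y" using C by (auto simp: K_def)
    have False if "z \<in> C" "z \<in> C'" for z
      using that C(3) xy component_eq[of z m x] component_eq[of z m y] by simp
    then show ?thesis by blast
  qed
  have un: "Z = \<Union> K" unfolding K_def using sub component_self by fast
  have "character Z wt = (\<Sum>C\<in>K. character C wt)"
  proof (rule series_eqI)
    fix \<mu> :: "rat \<Rightarrow>\<^sub>0 nat"
    have "{z \<in> Z. wt z = \<mu>} = (\<Union>C\<in>K. {z \<in> C. wt z = \<mu>})" using un by auto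
    moreover have "card (\<Union>C\<in>K. {z \<in> C. wt z = \<mu>}) = (\<Sum>C\<in>K. card {z \<in> C. wt z = \<mu>})"
    proof (rule card_UN_disjoint[OF fin])
      show "\<forall>C\<in>K. finite {z \<in> C. wt z = \<mu>}"
        using finite_words_of_weight[of \<mu>] by (auto intro: finite_subset[rotated])
      show "\<forall>C\<in>K. \<forall>C'\<in>K. C \<noteq> C' \<longrightarrow> {z \<in> C. wt z = \<mu>} \<inter> {z \<in> C'. wt z = \<mu>} = {}"
        using disj by fast
    qed
    ultimately show "coeff (character Z wt) \<mu> = coeff (\<Sum>C\<in>K. character C wt) \<mu>"
      by (simp add: coeff_character coeff_sum)
  qed
  moreover have "character C wt \<in> R_carrier m" if "C \<in> K" for C
    using that Z unfolding R_carrier_def K_def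
    by (auto simp: ch_component_def[symmetric] intro!: series.span_base imageI)
  ultimately show ?thesis unfolding R_carrier_def by (simp add: series.span_sum del: mult_of_int_commute)
qed

text \<open>All words of a component have the same length, so a concatenation determines its two
  factors and the product of the characters counts concatenations without repetition.\<close>

lemma ch_component_mult:
  assumes "u \<in> words m" "v \<in> words m"
  shows "ch_component m u * ch_component m v \<in> R_carrier m"
proof -
  let ?U = "component m u" and ?V = "component m v"
  let ?P = "\<lambda>(x, y). x @ y"
  define Z where "Z = ?P ` (?U \<times> ?V)"
  have "character Z wt \<in> R_carrier m"
  proof (rule character_closed_in_R[of Z m "length u + length v"])
    show "Z \<subseteq> words m" using component_words assms by (auto simp: Z_def words_append)
    show "length z = length u + length v" if "z \<in> Z" for z
      using that component_length assms by (auto simp: Z_def)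
    show "z' \<in> Z" if z: "z \<in> Z" "step m z z' \<or> step m z' z" for z z'
    proof -
      obtain x y where xy: "z = x @ y" "x \<in> ?U" "y \<in> ?V" using z by (auto simp: Z_def)
      have w: "x \<in> words m" "y \<in> words m" using xy component_words assms by auto
      have "(\<exists>x'. z' = x' @ y \<and> (step m x x' \<or> step m x' x)) \<or> (\<exists>y'. z' = x @ y' \<and> (step m y y' \<or> step m y' y))"
        using z(2) step_appendD step_appendD' unfolding xy(1) by blast
      then show ?thesis using component_step[OF xy(2) w(1)] component_step[OF xy(3) w(2)] xy
        unfolding Z_def by auto
    qed
  qed
  moreover have "character Z wt = ch_component m u * ch_component m v"
  proof (rule series_eqI)
    fix \<mu> :: "rat \<Rightarrow>\<^sub>0 nat"
    let ?A = "\<lambda>a. {x \<in> ?U. wt x = (a :: rat \<Rightarrow>\<^sub>0 nat)}" and ?B = "\<lambda>b. {y \<in> ?V. wt y = (b :: rat \<Rightarrow>\<^sub>0 nat)}"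
    let ?S = "{(a, b). a + b = \<mu>}"
    have fin: "finite (?A a)" "finite (?B a)" for a
      using finite_words_of_weight[of a] by (auto intro: finite_subset[rotated])
    have inj: "inj_on ?P (?U \<times> ?V)"
    proof (rule inj_onI, clarify)
      fix x y x' y'
      assume h: "x \<in> ?U" "y \<in> ?V" "x' \<in> ?U" "y' \<in> ?V" "x @ y = x' @ y'"
      then have "length x = length x'" using component_length[OF assms(1)] by metis
      then show "x = x' \<and> y = y'" using h(5) by simp
    qed
    have "{z \<in> Z. wt z = \<mu>} = ?P ` (\<Union>(a, b)\<in>?S. ?A a \<times> ?B b)"
      unfolding Z_def by (auto simp: wt_append image_iff)
    moreover have "inj_on ?P (\<Union>(a, b)\<in>?S. ?A a \<times> ?B b)"
      using inj by (rule inj_on_subset) auto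
    ultimately have "card {z \<in> Z. wt z = \<mu>} = card (\<Union>p\<in>?S. ?A (fst p) \<times> ?B (snd p))"
      using card_image[of ?P] by (simp only: case_prod_unfold)
    also have "\<dots> = (\<Sum>p\<in>?S. card (?A (fst p) \<times> ?B (snd p)))"
    proof (rule card_UN_disjoint[OF finite_splittings])
      show "\<forall>p\<in>?S. finite (?A (fst p) \<times> ?B (snd p))" using fin by blast
      show "\<forall>p\<in>?S. \<forall>q\<in>?S. p \<noteq> q \<longrightarrow>
          (?A (fst p) \<times> ?B (snd p)) \<inter> (?A (fst q) \<times> ?B (snd q)) = {}"
        by fastforce
    qed
    finally have c: "card {z \<in> Z. wt z = \<mu>} = (\<Sum>p\<in>?S. card (?A (fst p)) * card (?B (snd p)))"
      by (simp only: card_cartesian_product)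
    show "coeff (character Z wt) \<mu> = coeff (ch_component m u * ch_component m v) \<mu>"
      by (simp add: coeff_character times_series.rep_eq ch_component_def c case_prod_unfold)
  qed
  ultimately show ?thesis by simp
qed

lemma R_carrier_mult:
  assumes "f \<in> R_carrier m" "g \<in> R_carrier m"
  shows "f * g \<in> R_carrier m"
proof -
  have one: "f * ch_component m v \<in> R_carrier m" if v: "v \<in> words m" "f \<in> R_carrier m" for f v
    using v(2) unfolding R_carrier_def
  proof (induction rule: series.span_induct_alt)
    case base
    then show ?case by (simp add: series.span_zero)
  next
    case (step c x y)
    then have "x * ch_component m v \<in> R_carrier m" using ch_component_mult v by auto
    then have "of_int c * (x * ch_component m v) \<in> R_carrier m"
      unfolding R_carrier_def by (rule series.span_scale)
    then show ?case using step.IH unfolding R_carrier_def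
      by (simp add: distrib_right mult.assoc series.span_add)
  qed
  show ?thesis
    using assms(2) unfolding R_carrier_def
  proof (induction rule: series.span_induct_alt)
    case base
    then show ?case by (simp add: series.span_zero)
  next
    case (step c x y)
    then have "f * x \<in> R_carrier m" using one assms(1) by auto
    then have "of_int c * (f * x) \<in> R_carrier m"
      unfolding R_carrier_def by (rule series.span_scale)
    then show ?case using step.IH unfolding R_carrier_def
      by (simp add: distrib_left mult.left_commute series.span_add)
  qed
qed

lemma one_in_R: "1 \<in> R_carrier m"
proof -
  have nil: "[] \<in> words m" by (simp add: words_def)
  have "component m [] = {[]}"
    using component_length[OF nil] component_self[of "[]" m] by auto
  moreover have "{a. a = [] \<and> wt a = (\<mu> :: rat \<Rightarrow>\<^sub>0 nat)} = (if \<mu> = 0 then {[]} else {})" for \<mu>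
    by (auto simp: wt_def)
  ultimately have "ch_component m [] = 1"
    by (intro series_eqI) (auto simp: ch_component_def coeff_character one_series.rep_eq)
  then show ?thesis unfolding R_carrier_def using nil by (metis imageI series.span_base)
qed

lemma cring_R: "cring (R_ring m)"
proof (rule cringI)
  have neg: "- x \<in> R_carrier m" if "x \<in> R_carrier m" for x
    using series.span_scale[of x "ch_component m ` words m" "-1"] that by (simp add: R_carrier_def)
  show "abelian_group (R_ring m)"
  proof (rule abelian_groupI)
    show "\<exists>y\<in>carrier (R_ring m). y \<oplus>\<^bsub>R_ring m\<^esub> x = \<zero>\<^bsub>R_ring m\<^esub>" if "x \<in> carrier (R_ring m)" for x
      using neg[of x] that by (auto simp: R_ring_def intro!: bexI[of _ "- x"])
  qed (auto simp: R_ring_def R_carrier_def add.assoc add.commute intro!: series.span_add series.span_zero)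
  show "Group.comm_monoid (R_ring m)"
    by (rule comm_monoidI) (auto simp: R_ring_def R_carrier_mult one_in_R algebra_simps)
qed (auto simp: R_ring_def algebra_simps)

section \<open>Knuth moves\<close>

text \<open>If \<open>x\<close> stands to the left of \<open>y\<close> in a word, then \<open>asc x y\<close> says that the position of \<open>x\<close>
  comes first when positions are ordered by letters, equal even letters from right to left and equal
  odd letters from left to right.\<close>

definition asc :: "rat \<Rightarrow> rat \<Rightarrow> bool" where
  "asc x y \<longleftrightarrow> x < y \<or> (x = y \<and> x \<notin> \<int>)"

lemma asc_outside:
  assumes "a \<in> letters m" "c \<in> letters m" "c \<noteq> a" "c \<noteq> nxt a"
  shows "asc c (nxt a) \<longleftrightarrow> asc c a" "asc (nxt a) c \<longleftrightarrow> asc a c"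
  using assms nxt_le[OF assms(1,2)] nxt_greater[of a] by (cases "a < c"; force simp: asc_def)+

text \<open>No letter lies strictly between \<open>a\<close> and \<open>nxt a\<close>, and the odd
  letter \<open>nxt a\<close> ascends to an equal letter on its right just as \<open>a\<close>
  ascends to it. As left entries of a pair the two letters are interchangeable; for odd
  \<open>a\<close> this holds for right entries.\<close>

lemma asc_even:
  assumes "a \<in> letters m" "c \<in> letters m" "0 < nxt a" "a \<in> \<int>"
  shows "asc (nxt a) c \<longleftrightarrow> asc a c"
  using assms nxt_le[OF assms(1,2)] nxt_greater[of a] nxt_pos_parity[OF assms(1,3)] by (auto simp: asc_def)

lemma asc_odd:
  assumes "a \<in> letters m" "c \<in> letters m" "0 < nxt a" "a \<notin> \<int>"
  shows "asc c (nxt a) \<longleftrightarrow> asc c a"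
proof (cases "a < c")
  case True
  then have "nxt a \<le> c" using nxt_le[OF assms(1,2)] by simp
  then show ?thesis using True assms nxt_pos_parity[OF assms(1,3)] by (simp add: asc_def)
next
  case False
  then have "c \<le> a" by simp
  then have "asc c (nxt a)" "asc c a" using assms nxt_greater[of a] by (auto simp: asc_def)
  then show ?thesis by simp
qed

text \<open>For even \<open>a\<close>, admissibility says that neither \<open>a\<close> nor
  \<open>nxt a\<close> occurs to the left, where \<open>asc_outside\<close> applies, and
  \<open>asc_even\<close> takes care of the letters to the right. For odd \<open>a\<close> the sides
  are exchanged.\<close>

lemma asc_step:
  assumes a: "a \<in> letters m" "0 < nxt a" and x: "u @ a # v \<in> words m"
    and adm: "admissible a u v" and pq: "p < q" "q < length (u @ a # v)"
  shows "asc ((u @ nxt a # v) ! p) ((u @ nxt a # v) ! q) \<longleftrightarrow> asc ((u @ a # v) ! p) ((u @ a # v) ! q)"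
proof -
  have u: "u ! p \<in> letters m \<and> u ! p \<in> set u" if "p < length u" for p using x that by (auto simp: words_def)
  have v: "v ! p \<in> letters m \<and> v ! p \<in> set v" if "p < length v" for p using x that by (auto simp: words_def)
  consider "p \<noteq> length u" "q \<noteq> length u" | "p = length u" | "q = length u" by blast
  then show ?thesis
  proof cases
    case 1
    then show ?thesis by (auto simp: nth_append nth_Cons split: nat.splits)
  next
    case 2
    then obtain k where k: "q = length u + Suc k" using pq by (metis less_imp_Suc_add add_Suc_right)
    then have "k < length v" using pq by simp
    then have vk: "v ! k \<in> letters m" "v ! k \<in> set v" using v by auto
    have "asc (nxt a) (v ! k) \<longleftrightarrow> asc a (v ! k)"
    proof (cases "a \<in> \<int>")
      case True
      then show ?thesis using asc_even[OF a(1) vk(1) a(2)] by simp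
    next
      case False
      then have "v ! k \<noteq> a" "v ! k \<noteq> nxt a" using adm a(2) vk(2) by (auto simp: admissible_def)
      then show ?thesis using asc_outside[OF a(1) vk(1)] by simp
    qed
    then show ?thesis using 2 k by (simp add: nth_append)
  next
    case 3
    then have "p < length u" using pq by simp
    then have up: "u ! p \<in> letters m" "u ! p \<in> set u" using u by auto
    have "asc (u ! p) (nxt a) \<longleftrightarrow> asc (u ! p) a"
    proof (cases "a \<in> \<int>")
      case False
      then show ?thesis using asc_odd[OF a(1) up(1) a(2)] by simp
    next
      case True
      then have "u ! p \<noteq> a" "u ! p \<noteq> nxt a" using adm a(2) up(2) by (auto simp: admissible_def)
      then show ?thesis using asc_outside[OF a(1) up(1)] by simp
    qed
    then show ?thesis using 3 \<open>p < length u\<close> by (simp add: nth_append)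
  qed
qed

text \<open>The Knuth involution on the first three letters: unless they are monotone for \<open>asc\<close>, it exchanges
  the two neighbours between which the third letter lies in the order of positions.\<close>

fun kn :: "word \<Rightarrow> word" where
  "kn (x # y # z # w) = (if asc x y = asc y z then x # y # z # w
     else if asc x y = asc x z then y # x # z # w else x # z # y # w)"
| "kn w = w"

definition knuth :: "nat \<Rightarrow> word \<Rightarrow> word" where
  "knuth j w = take j w @ kn (drop j w)"

lemma asc_flip: "x \<noteq> y \<Longrightarrow> asc y x \<longleftrightarrow> \<not> asc x y"
  by (auto simp: asc_def)

lemma kn_kn: "kn (kn w) = w"
proof (cases w rule: kn.cases)
  case (1 x y z v)
  consider "asc x y = asc y z" | "asc x y \<noteq> asc y z" "asc x y = asc x z" "x \<noteq> y"
    | "asc x y \<noteq> asc y z" "asc x y \<noteq> asc x z" "y \<noteq> z"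
    by blast
  then show ?thesis
    by cases (simp_all add: 1 asc_flip[of x y] asc_flip[of y z])
qed auto

lemma kn_short: "length w < 3 \<Longrightarrow> kn w = w"
  by (cases w rule: kn.cases) auto

lemma mset_kn: "mset (kn w) = mset w"
  by (cases w rule: kn.cases) auto

lemma knuth_knuth: "knuth j (knuth j w) = w"
proof (cases "length w \<le> j")
  case True
  then show ?thesis by (simp add: knuth_def)
next
  case False
  then show ?thesis by (simp add: knuth_def kn_kn min_def)
qed

lemma mset_knuth: "mset (knuth j w) = mset w"
proof -
  have "mset (knuth j w) = mset (take j w @ drop j w)"
    by (simp only: knuth_def mset_append mset_kn)
  then show ?thesis by simp
qed

lemma kn_append: "length t = 3 \<Longrightarrow> kn (t @ w) = kn t @ w"
  by (auto simp: length_Suc_conv numeral_3_eq_3)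

definition step3 :: "rat \<Rightarrow> word \<Rightarrow> word \<Rightarrow> word \<Rightarrow> word \<Rightarrow> bool" where
  "step3 a pre s s' post \<longleftrightarrow> (\<exists>s1 s2. s = s1 @ a # s2 \<and> s' = s1 @ nxt a # s2 \<and> admissible a (pre @ s1) (s2 @ post))"

text \<open>Only an exchange of \<open>a\<close> with \<open>nxt a\<close> could matter. In that
  case the third letter lies between them in the order of positions, so it is one of these two
  letters itself, and the number of unmatched closing brackets comes out the same. The proof checks
  the four classes of letters relative to \<open>a\<close> and \<open>nxt a\<close>.\<close>

lemma kn_ep:
  assumes a: "a \<in> letters m" and t: "x \<in> letters m" "y \<in> letters m" "z \<in> letters m" and "nxt a < 0"
  shows "ep a (nxt a) (kn [x, y, z]) = ep a (nxt a) [x, y, z]"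
proof -
  have lt: "a < nxt a" by (rule nxt_greater)
  have i: "a \<in> \<int>" "nxt a \<in> \<int>" using letters_neg_Ints[OF a] letters_neg_Ints[OF nxt_letters[OF a]] lt assms(5) by auto
  have c: "c < a \<or> c = a \<or> c = nxt a \<or> nxt a < c" if "c \<in> letters m" for c
    using nxt_le[OF a that] by force
  from c[OF t(1)] c[OF t(2)] c[OF t(3)] show ?thesis
    using i lt by (elim disjE) (auto simp: asc_def)
qed

text \<open>The words outside the window enter only through the two numbers
  \<open>ph a (nxt a) pre\<close> and \<open>ep a (nxt a) post\<close>. This reduces the
  compatibility of Knuth moves with arrows to a question about three letters.\<close>

lemma admissible_neg_iff:
  assumes "nxt a < 0"
  shows "admissible a (pre @ s1) (s2 @ post) \<longleftrightarrow>
    ph a (nxt a) s1 = 0 \<and> ph a (nxt a) pre \<le> excess a (nxt a) s1 \<and>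
    ep a (nxt a) s2 = 0 \<and> ep a (nxt a) post \<le> - excess a (nxt a) s2"
  using assms ph_nonneg[of a "nxt a" s1] ep_nonneg[of a "nxt a" s2]
  by (auto simp: admissible_def ep_append ph_append max_def split: if_splits)

text \<open>\<open>A\<close> stands for admissibility in fixed surroundings. It stays abstract so
  that the three possible positions of the changed letter can be listed once and for all.\<close>

definition ext3 :: "rat \<Rightarrow> (word \<Rightarrow> word \<Rightarrow> bool) \<Rightarrow> word \<Rightarrow> word \<Rightarrow> bool" where
  "ext3 a A s s' \<longleftrightarrow> (\<exists>s1 s2. s = s1 @ a # s2 \<and> s' = s1 @ nxt a # s2 \<and> A s1 s2)"

lemma ext3_three:
  "ext3 a A [x, y, z] s' \<longleftrightarrow>
    (x = a \<and> s' = [nxt a, y, z] \<and> A [] [y, z]) \<or>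
    (y = a \<and> s' = [x, nxt a, z] \<and> A [x] [z]) \<or>
    (z = a \<and> s' = [x, y, nxt a] \<and> A [x, y] [])"
  (is "?L \<longleftrightarrow> ?R")
proof
  assume ?L
  then show ?R by (auto simp: ext3_def Cons_eq_append_conv)
next
  assume ?R
  then show ?L
  proof (elim disjE)
    assume "x = a \<and> s' = [nxt a, y, z] \<and> A [] [y, z]"
    then show ?L unfolding ext3_def by (intro exI[of _ "[]"] exI[of _ "[y, z]"]) simp
  next
    assume "y = a \<and> s' = [x, nxt a, z] \<and> A [x] [z]"
    then show ?L unfolding ext3_def by (intro exI[of _ "[x]"] exI[of _ "[z]"]) simp
  next
    assume "z = a \<and> s' = [x, y, nxt a] \<and> A [x, y] []"
    then show ?L unfolding ext3_def by (intro exI[of _ "[x, y]"] exI[of _ "[]"]) simp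
  qed
qed

text \<open>A finite check: each of the three letters is \<open>a\<close>, is \<open>nxt a\<close>,
  or compares with both in the same way, coming before both or after both. The surroundings are
  summarised by the numbers \<open>P\<close> and \<open>E\<close>, or by the truth value
  \<open>P\<close> for the one-sided rules.\<close>

lemma kn_ext3:
  assumes a: "a \<in> letters m" and t: "x \<in> letters m" "y \<in> letters m" "z \<in> letters m"
    and s: "ext3 a A [x, y, z] s'"
    and A: "(nxt a < 0 \<and> (\<exists>P E. 0 \<le> P \<and> 0 \<le> E \<and>
          A = (\<lambda>s1 s2. ph a (nxt a) s1 = 0 \<and> P \<le> excess a (nxt a) s1 \<and> ep a (nxt a) s2 = 0 \<and> E \<le> - excess a (nxt a) s2)))
      \<or> (0 < nxt a \<and> a \<in> \<int> \<and> (\<exists>P. A = (\<lambda>s1 s2. P \<and> a \<notin> set s1 \<and> nxt a \<notin> set s1)))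
      \<or> (0 < nxt a \<and> a \<notin> \<int> \<and> (\<exists>P. A = (\<lambda>s1 s2. P \<and> a \<notin> set s2 \<and> nxt a \<notin> set s2)))"
  shows "ext3 a A (kn [x, y, z]) (kn s')"
proof -
  define b where "b = nxt a"
  have lt: "a < b" unfolding b_def by (rule nxt_greater)
  then have ne: "a \<noteq> b" "b \<noteq> a" by auto
  have ab: "asc a b" "\<not> asc b a" using lt by (auto simp: asc_def)
  have c: "c = a \<or> c = b
      \<or> c \<noteq> a \<and> c \<noteq> b \<and> asc c b \<and> asc c a \<and> \<not> asc a c \<and> \<not> asc b c
      \<or> c \<noteq> a \<and> c \<noteq> b \<and> \<not> asc c b \<and> \<not> asc c a \<and> asc a c \<and> asc b c"
    if "c \<in> letters m" for c
    using asc_outside[OF a that] unfolding b_def asc_def by auto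
  note cs = c[OF t(1)] c[OF t(2)] c[OF t(3)]
  note s = s[unfolded ext3_three, folded b_def]
  from A show ?thesis
  proof (elim disjE)
    assume "nxt a < 0 \<and> (\<exists>P E. 0 \<le> P \<and> 0 \<le> E \<and>
          A = (\<lambda>s1 s2. ph a (nxt a) s1 = 0 \<and> P \<le> excess a (nxt a) s1 \<and> ep a (nxt a) s2 = 0 \<and> E \<le> - excess a (nxt a) s2))"
    then obtain P E where h: "nxt a < 0" "0 \<le> P" "0 \<le> E" "A = (\<lambda>s1 s2. ph a b s1 = 0 \<and> P \<le> excess a b s1 \<and> ep a b s2 = 0 \<and> E \<le> - excess a b s2)"
      unfolding b_def by blast
    have i: "\<not> asc a a" "\<not> asc b b"
      using letters_neg_Ints[OF a] letters_neg_Ints[OF nxt_letters[OF a]] lt h by (auto simp: asc_def b_def)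
    from s cs show ?thesis
      unfolding h(4)
      by (elim disjE) (simp_all add: ne ab i ext3_three b_def[symmetric] h(2,3))
  next
    assume "0 < nxt a \<and> a \<in> \<int> \<and> (\<exists>P. A = (\<lambda>s1 s2. P \<and> a \<notin> set s1 \<and> nxt a \<notin> set s1))"
    then obtain P where h: "0 < nxt a" "a \<in> \<int>" "A = (\<lambda>s1 s2. P \<and> a \<notin> set s1 \<and> b \<notin> set s1)"
      unfolding b_def by blast
    have i: "\<not> asc a a" "asc b b" using nxt_pos_parity[OF a h(1)] h(2) by (auto simp: asc_def b_def)
    from s cs show ?thesis
      unfolding h(3)
      by (elim disjE) (simp_all add: ne ab i ext3_three b_def[symmetric])
  next
    assume "0 < nxt a \<and> a \<notin> \<int> \<and> (\<exists>P. A = (\<lambda>s1 s2. P \<and> a \<notin> set s2 \<and> nxt a \<notin> set s2))"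
    then obtain P where h: "0 < nxt a" "a \<notin> \<int>" "A = (\<lambda>s1 s2. P \<and> a \<notin> set s2 \<and> b \<notin> set s2)"
      unfolding b_def by blast
    have i: "asc a a" "\<not> asc b b" using nxt_pos_parity[OF a h(1)] h(2) by (auto simp: asc_def b_def)
    from s cs show ?thesis
      unfolding h(3)
      by (elim disjE) (simp_all add: ne ab i ext3_three b_def[symmetric])
  qed
qed

lemma kn_step3:
  assumes a: "a \<in> letters m" and t: "x \<in> letters m" "y \<in> letters m" "z \<in> letters m"
    and s: "step3 a pre [x, y, z] s' post"
  shows "step3 a pre (kn [x, y, z]) (kn s') post"
proof -
  define A where "A = (\<lambda>s1 s2. admissible a (pre @ s1) (s2 @ post))"
  have e: "step3 a pre s s' post \<longleftrightarrow> ext3 a A s s'" for s s'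
    by (simp add: step3_def ext3_def A_def)
  have z: "nxt a \<noteq> 0" using letters_nonzero[OF nxt_letters[OF a]] .
  consider "nxt a < 0" | "0 < nxt a" "a \<in> \<int>" | "0 < nxt a" "a \<notin> \<int>" using z by fastforce
  then have "(nxt a < 0 \<and> (\<exists>P E. 0 \<le> P \<and> 0 \<le> E \<and>
          A = (\<lambda>s1 s2. ph a (nxt a) s1 = 0 \<and> P \<le> excess a (nxt a) s1 \<and> ep a (nxt a) s2 = 0 \<and> E \<le> - excess a (nxt a) s2)))
      \<or> (0 < nxt a \<and> a \<in> \<int> \<and> (\<exists>P. A = (\<lambda>s1 s2. P \<and> a \<notin> set s1 \<and> nxt a \<notin> set s1)))
      \<or> (0 < nxt a \<and> a \<notin> \<int> \<and> (\<exists>P. A = (\<lambda>s1 s2. P \<and> a \<notin> set s2 \<and> nxt a \<notin> set s2)))"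
  proof cases
    case 1
    then show ?thesis unfolding A_def admissible_neg_iff[OF 1]
      by (intro disjI1 conjI exI[of _ "ph a (nxt a) pre"] exI[of _ "ep a (nxt a) post"])
        (simp_all add: ph_nonneg ep_nonneg)
  next
    case 2
    then show ?thesis unfolding A_def
      by (intro disjI2 disjI1 conjI exI[of _ "a \<notin> set pre \<and> nxt a \<notin> set pre"])
        (auto simp: admissible_def fun_eq_iff)
  next
    case 3
    then show ?thesis unfolding A_def
      by (intro disjI2 conjI exI[of _ "a \<notin> set post \<and> nxt a \<notin> set post"])
        (auto simp: admissible_def fun_eq_iff)
  qed
  then show ?thesis using kn_ext3[OF a t] s unfolding e by blast
qed

lemma knuth_append:
  assumes "length t = 3" "length pre = j"
  shows "knuth j (pre @ t @ post) = pre @ kn t @ post"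
  unfolding knuth_def using assms(2) by (simp add: kn_append[OF assms(1)])

lemma step_knuth:
  assumes "step m x y" "x \<in> words m"
  shows "step m (knuth j x) (knuth j y)"
proof (cases "length x < j + 3")
  case True
  then have "length (drop j x) < 3" "length (drop j y) < 3" using step_length[OF assms(1)] by auto
  then have "kn (drop j x) = drop j x" "kn (drop j y) = drop j y"
    by (simp_all only: kn_short)
  then show ?thesis using assms(1) by (simp add: knuth_def)
next
  case False
  define pre t post where "pre = take j x" and "t = take 3 (drop j x)" and "post = drop 3 (drop j x)"
  have lpre: "length pre = j" and lt: "length t = 3" and x: "x = pre @ t @ post"
    using False unfolding pre_def t_def post_def by (simp, simp, metis append_take_drop_id)
  obtain t1 t2 t3 where t: "t = [t1, t2, t3]" using lt by (auto simp: length_Suc_conv numeral_3_eq_3)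
  have w: "t1 \<in> letters m" "t2 \<in> letters m" "t3 \<in> letters m" using assms(2) unfolding x t by (simp_all add: words_def)
  have kx: "knuth j x = pre @ kn t @ post" unfolding x by (rule knuth_append[OF lt lpre])
  obtain a u v where a: "a \<in> letters m" "x = u @ a # v" "y = u @ nxt a # v" "admissible a u v"
    using assms unfolding step_def by auto
  \<comment> \<open>If the changed letter lies outside the window, the window affects admissibility
    only through its excess, its unmatched brackets and its set of letters. The Knuth move preserves
    all of these.\<close>
  have ex: "excess a (nxt a) (kn t) = excess a (nxt a) t"
    using nxt_greater[of a] mset_kn[of t] by (simp add: excess_count flip: count_mset)
  have ept: "ep a (nxt a) (kn t) = ep a (nxt a) t" if "nxt a < 0"
    unfolding t using kn_ep[OF a(1) w that] .
  have pht: "ph a (nxt a) (kn t) = ph a (nxt a) t" if "nxt a < 0"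
    using ept[OF that] ex ep_ph[of a "nxt a" "kn t"] ep_ph[of a "nxt a" t] by simp
  have st: "set (kn t) = set t" by (rule mset_eq_setD[OF mset_kn])
  from a(2)[unfolded x] consider (pre) v1 where "pre = u @ a # v1" "v = v1 @ t @ post"
    | (mid) s1 s2 where "t = s1 @ a # s2" "u = pre @ s1" "v = s2 @ post"
    | (post) u1 where "post = u1 @ a # v" "u = pre @ t @ u1"
    by (auto simp: append_eq_append_conv2 Cons_eq_append_conv append_eq_Cons_conv)
  then show ?thesis
  proof cases
    case pre
    then have y: "y = (u @ nxt a # v1) @ t @ post" using a(3) by simp
    have "length (u @ nxt a # v1) = j" using lpre pre(1) by simp
    from knuth_append[OF lt this] have "knuth j y = (u @ nxt a # v1) @ kn t @ post" unfolding y .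
    moreover have "admissible a u (v1 @ kn t @ post)"
      using a(4) unfolding pre admissible_def by (auto simp: ep_append ept ex st)
    ultimately show ?thesis unfolding kx step_def pre(1) using a(1)
      by (intro bexI[of _ a] exI[of _ u] exI[of _ "v1 @ kn t @ post"]) simp_all
  next
    case post
    then have y: "y = pre @ t @ u1 @ nxt a # v" using a(3) by simp
    have "knuth j y = pre @ kn t @ u1 @ nxt a # v" unfolding y by (rule knuth_append[OF lt lpre])
    moreover have "admissible a (pre @ kn t @ u1) v"
      using a(4) unfolding post admissible_def by (auto simp: ph_append pht ex st excess_append)
    ultimately show ?thesis unfolding kx step_def using post(1) a(1)
      by (intro bexI[of _ a] exI[of _ "pre @ kn t @ u1"] exI[of _ v]) simp_all
  next
    case mid
    define t' where "t' = s1 @ nxt a # s2"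
    have lt': "length t' = 3" using lt unfolding mid(1) t'_def by simp
    have y: "y = pre @ t' @ post" using a(3) mid by (simp add: t'_def)
    have ky: "knuth j y = pre @ kn t' @ post" unfolding y by (rule knuth_append[OF lt' lpre])
    have "step3 a pre t t' post" unfolding step3_def t'_def using mid(1) a(4)[unfolded mid(2,3)] by blast
    then have "step3 a pre (kn t) (kn t') post" unfolding t using kn_step3[OF a(1) w] by blast
    then obtain r1 r2 where "kn t = r1 @ a # r2" "kn t' = r1 @ nxt a # r2" "admissible a (pre @ r1) (r2 @ post)"
      unfolding step3_def by blast
    then show ?thesis unfolding kx ky step_def using a(1)
      by (intro bexI[of _ a] exI[of _ "pre @ r1"] exI[of _ "r2 @ post"]) simp_all
  qed
qed

lemma ch_component_knuth:
  assumes "w \<in> words m"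
  shows "ch_component m (knuth j w) = ch_component m w"
proof (rule ch_component_transfer[where S = "words m"])
  have kw: "knuth j x \<in> words m" if "x \<in> words m" for x
    using that mset_knuth[of j x] unfolding words_def by (metis in_lists_conv_set mset_eq_setD)
  show "knuth j w \<in> words m" using kw assms .
  show "\<And>x y. x \<in> words m \<Longrightarrow> step m x y \<or> step m y x \<Longrightarrow> y \<in> words m"
    using step_words by blast
  show "\<exists>y. z = knuth j y \<and> step m x y" if "x \<in> words m" "step m (knuth j x) z" for x z
    using step_knuth[OF that(2) kw[OF that(1)], of j] knuth_knuth by metis
  show "\<exists>y. z = knuth j y \<and> step m y x" if "x \<in> words m" "step m z (knuth j x)" for x z
  proof -
    have "z \<in> words m" using step_words that kw by blast
    then show ?thesis using step_knuth[OF that(2), of j] knuth_knuth by metis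
  qed
  show "inj_on (knuth j) (words m)" by (metis inj_onI knuth_knuth)
qed (use assms step_knuth mset_knuth in auto)

section \<open>Yamanouchi words\<close>

text \<open>Negative letters are numbered from \<open>0\<close> upwards starting with
  \<open>-m\<close>, so that their numbers match the rows of the Young diagram.\<close>

definition neg_letter :: "nat \<Rightarrow> nat \<Rightarrow> rat" where
  "neg_letter m s = of_nat s - of_nat m"

lemma neg_letter_letters: "s < m \<Longrightarrow> neg_letter m s \<in> letters m"
  unfolding letters_def neg_letter_def
  by (intro UnI1 CollectI exI[of _ "m - s"]) (auto simp: of_nat_diff)

lemma neg_letter_neg: "s < m \<Longrightarrow> neg_letter m s < 0"
  by (simp add: neg_letter_def)

lemma neg_letter_Ints: "neg_letter m s \<in> \<int>"
  by (simp add: neg_letter_def)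

lemma neg_letter_eq: "neg_letter m s = neg_letter m t \<longleftrightarrow> s = t"
  by (simp add: neg_letter_def)

lemma neg_letter_less: "neg_letter m s < neg_letter m t \<longleftrightarrow> s < t"
  by (simp add: neg_letter_def)

lemma nxt_neg_letter: "Suc s < m \<Longrightarrow> nxt (neg_letter m s) = neg_letter m (Suc s)"
proof -
  assume "Suc s < m"
  then have "(of_nat (s + 2) :: rat) \<le> of_nat m" by (simp only: of_nat_le_iff)
  then consider "(of_nat s :: rat) + 1 < of_nat m" by (auto simp: of_nat_add)
  then show ?thesis by cases (simp add: nxt_def neg_letter_def)
qed

lemma neg_letters_ex: "b \<in> letters m \<Longrightarrow> b < 0 \<Longrightarrow> \<exists>s<m. b = neg_letter m s"
proof (erule letters_cases)
  fix k assume "1 \<le> k" "k \<le> m" "b = - of_nat k"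
  then show ?thesis by (intro exI[of _ "m - k"]) (auto simp: neg_letter_def of_nat_diff)
qed auto

definition antitone :: "(nat \<Rightarrow> nat) \<Rightarrow> bool" where
  "antitone f \<longleftrightarrow> (\<forall>s. f (Suc s) \<le> f s)"

lemma antitoneD: "antitone f \<Longrightarrow> s \<le> t \<Longrightarrow> f t \<le> f s"
  unfolding antitone_def using lift_Suc_antimono_le[of f s t] by blast

definition yam :: "nat list \<Rightarrow> bool" where
  "yam v \<longleftrightarrow> (\<forall>k. antitone (count_list (take k v)))"

lemma yam_Nil: "yam []"
  by (simp add: yam_def antitone_def)

lemma yam_snoc: "yam (v @ [c]) \<longleftrightarrow> yam v \<and> antitone (count_list (v @ [c]))"
proof
  assume y: "yam (v @ [c])"
  have "antitone (count_list (take k v))" for k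
    using y[unfolded yam_def, rule_format, of "min k (length v)"] by (simp add: min_def split: if_splits)
  moreover have "antitone (count_list (v @ [c]))"
    using y[unfolded yam_def, rule_format, of "Suc (length v)"] by simp
  ultimately show "yam v \<and> antitone (count_list (v @ [c]))" by (simp add: yam_def)
next
  assume y: "yam v \<and> antitone (count_list (v @ [c]))"
  have "antitone (count_list (take k (v @ [c])))" for k
  proof (cases "k \<le> length v")
    case True
    then show ?thesis using y by (simp add: yam_def)
  next
    case False
    then have "take k (v @ [c]) = v @ [c]" by simp
    then show ?thesis using y by metis
  qed
  then show "yam (v @ [c])" by (simp add: yam_def)
qed

lemma yam_antitone: "yam v \<Longrightarrow> antitone (count_list v)"
  unfolding yam_def by (metis take_all_iff order_refl)

definition row_word :: "nat \<Rightarrow> (nat \<Rightarrow> nat) \<Rightarrow> nat list" where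
  "row_word m f = concat (map (\<lambda>s. replicate (f s) s) [0..<m])"

lemma count_list_replicate: "count_list (replicate n y) x = (if x = y then n else 0)"
  by (induction n) auto

lemma count_row_word: "count_list (row_word m f) s = (if s < m then f s else 0)"
  by (induction m) (auto simp: row_word_def count_list_replicate)

lemma set_row_word: "set (row_word m f) \<subseteq> {..<m}"
  by (auto simp: row_word_def split: if_splits)

lemma yam_row_word: "antitone f \<Longrightarrow> yam (row_word m f)"
proof (induction m)
  case 0
  then show ?case by (simp add: row_word_def yam_Nil)
next
  case (Suc m)
  have "yam (row_word m f @ replicate j m)" if "j \<le> f m" for j
    using that
  proof (induction j)
    case 0
    then show ?case using Suc by simp
  next
    case (Suc j)
    have c: "count_list (row_word m f @ replicate (Suc j) m) s = (if s < m then f s else if s = m then Suc j else 0)" for s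
      by (simp add: count_row_word count_list_replicate del: replicate_Suc)
    have "antitone (count_list (row_word m f @ replicate (Suc j) m))"
      unfolding antitone_def c
    proof
      fix s
      have "f (Suc s) \<le> f s" using \<open>antitone f\<close> by (simp add: antitone_def)
      moreover have "Suc j \<le> f s" if "Suc s = m" using Suc.prems calculation that by simp
      ultimately show "(if Suc s < m then f (Suc s) else if Suc s = m then Suc j else 0)
          \<le> (if s < m then f s else if s = m then Suc j else 0)" by auto
    qed
    moreover have "row_word m f @ replicate (Suc j) m = (row_word m f @ replicate j m) @ [m]"
      by (simp add: replicate_append_same)
    ultimately show ?case using Suc yam_snoc[of "row_word m f @ replicate j m" m] by simp
  qed
  then show ?case by (simp add: row_word_def)
qed

text \<open>In the order of positions the leading \<open>y\<close> comes after \<open>c\<close> and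
  before \<open>d\<close>, also if \<open>c = y\<close>, since equal even letters are ordered from
  right to left. This is what lets a Knuth move exchange \<open>c\<close> and
  \<open>d\<close>.\<close>

lemma ch_component_swap:
  assumes "c \<le> y" "y < d" "d < m" "set v \<subseteq> {..<m}" "r \<in> words m"
  shows "ch_component m (map (neg_letter m) (v @ [y, c, d]) @ r) = ch_component m (map (neg_letter m) (v @ [y, d, c]) @ r)"
proof -
  let ?L = "neg_letter m"
  have k: "kn [?L y, ?L c, ?L d] = [?L y, ?L d, ?L c]"
    using assms by (simp add: asc_def neg_letter_less neg_letter_eq neg_letter_Ints)
  have "knuth (length v) (map ?L v @ [?L y, ?L c, ?L d] @ r) = map ?L v @ kn [?L y, ?L c, ?L d] @ r"
    by (rule knuth_append) simp_all
  then have "knuth (length v) (map ?L (v @ [y, c, d]) @ r) = map ?L (v @ [y, d, c]) @ r"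
    unfolding k by simp
  moreover have "map ?L (v @ [y, c, d]) @ r \<in> words m"
    using assms neg_letter_letters[of _ m] by (auto simp: words_def subset_iff)
  ultimately show ?thesis using ch_component_knuth by metis
qed

lemma mset_eq_count_list: "mset u = mset v \<longleftrightarrow> (\<forall>x. count_list u x = count_list v x)"
  by (simp add: multiset_eq_iff count_mset)

text \<open>Induction on the length. Words with the same last letter are covered by the induction hypothesis.
  For last letters \<open>c < d\<close>, removing both from the content leaves a partition with a removable box in
  some row \<open>y\<close> with \<open>c \<le> y < d\<close>; both words are then linked through words ending in \<open>y, d, c\<close> and
  \<open>y, c, d\<close>, which differ by a Knuth move.\<close>

lemma ch_component_yam:
  assumes "yam v" "yam v'" "mset v = mset v'" "set v \<subseteq> {..<m}" "r \<in> words m"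
  shows "ch_component m (map (neg_letter m) v @ r) = ch_component m (map (neg_letter m) v' @ r)"
  using assms
proof (induction "length v" arbitrary: v v' r)
  case 0
  then show ?case by simp
next
  case (Suc n)
  let ?L = "neg_letter m"
  \<comment> \<open>A common last letter is absorbed into the suffix, which is why the induction
    keeps \<open>r\<close> arbitrary.\<close>
  have last: "ch_component m (map ?L (u @ [c]) @ r) = ch_component m (map ?L (u' @ [c]) @ r)"
    if "length u = n" "yam (u @ [c])" "yam (u' @ [c])" "mset u = mset u'" "set u \<subseteq> {..<m}" "c < m" for u u' c
  proof -
    have "?L c # r \<in> words m" using Suc.prems(5) neg_letter_letters[OF that(6)] by (simp add: words_Cons)
    then show ?thesis using Suc.hyps(1)[of u u' "?L c # r"] that by (simp add: yam_snoc)
  qed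
  have main: "ch_component m (map ?L (u @ [c]) @ r) = ch_component m (map ?L (u' @ [d]) @ r)"
    if h: "length u = n" "length u' = n" "yam (u @ [c])" "yam (u' @ [d])" "mset (u @ [c]) = mset (u' @ [d])"
      "set u \<subseteq> {..<m}" "set u' \<subseteq> {..<m}" "d < m" "c < d" for u u' c d
  proof -
    define l where "l = count_list (u @ [c])"
    have l': "l = count_list (u' @ [d])" unfolding l_def by (rule ext) (use h(5) mset_eq_count_list in metis)
    have al: "antitone l" unfolding l_def using h(3) yam_antitone by blast
    have cu: "count_list u s = l s - (if s = c then 1 else 0)" for s by (auto simp: l_def)
    have cu': "count_list u' s = l s - (if s = d then 1 else 0)" for s by (auto simp: l')
    have "0 < l c" unfolding l_def by simp
    moreover have "0 < l d" unfolding l' by simp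
    ultimately have pos: "0 < l c" "0 < l d" .
    have ac: "antitone (\<lambda>s. l s - (if s = c then 1 else 0))"
      using h(3) yam_antitone[of u] unfolding yam_snoc by (simp add: antitone_def cu)
    have ad: "antitone (\<lambda>s. l s - (if s = d then 1 else 0))"
      using h(4) yam_antitone[of u'] unfolding yam_snoc by (simp add: antitone_def cu')
    define f where "f s = l s - (if s = c \<or> s = d then 1 else 0)" for s
    have af: "antitone f"
      unfolding antitone_def
    proof
      fix s show "f (Suc s) \<le> f s"
        using al[unfolded antitone_def, rule_format, of s] ac[unfolded antitone_def, rule_format, of s]
          ad[unfolded antitone_def, rule_format, of s] h(9) pos
        by (auto simp: f_def split: if_splits)
    qed
    \<comment> \<open>Otherwise \<open>f c \<le> f d\<close>, that is
      \<open>l c - 1 \<le> l d - 1\<close>. But a box can be removed from row \<open>c\<close>, so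
      \<open>l d \<le> l (Suc c) \<le> l c - 1\<close>.\<close>
    have "\<exists>y. c \<le> y \<and> y < d \<and> f (Suc y) < f y"
    proof (rule ccontr)
      assume n: "\<nexists>y. c \<le> y \<and> y < d \<and> f (Suc y) < f y"
      have "f c \<le> f (c + k)" if "c + k \<le> d" for k
        using that
      proof (induction k)
        case (Suc k)
        then show ?case using n by (metis Suc_leD Suc_le_lessD add_Suc_right le_add1 linorder_not_less order_trans)
      qed simp
      from this[of "d - c"] have "f c \<le> f d" using h(9) by simp
      moreover have "l (Suc c) \<le> l c - 1" using ac[unfolded antitone_def, rule_format, of c] by simp
      moreover have "l d \<le> l (Suc c)" using antitoneD[OF al, of "Suc c" d] h(9) by simp
      ultimately show False using pos h(9) by (simp add: f_def)
    qed
    then obtain y where y: "c \<le> y" "y < d" "f (Suc y) < f y" by blast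
    define g where "g s = f s - (if s = y then 1 else 0)" for s
    have ag: "antitone g"
      unfolding antitone_def
    proof
      fix s show "g (Suc s) \<le> g s"
        using af[unfolded antitone_def, rule_format, of s] y(3) by (auto simp: g_def)
    qed
    \<comment> \<open>Any Yamanouchi word of content \<open>g\<close> would serve as a common
      beginning; the row word is an explicit one.\<close>
    define v0 where "v0 = row_word m g"
    have supp: "l s = 0" if "\<not> s < m" for s
    proof -
      have "s \<notin> set (u @ [c])" using h that by auto
      then show ?thesis unfolding l_def by (metis count_list_0_iff)
    qed
    have c0: "count_list v0 s = g s" for s
      unfolding v0_def count_row_word using supp[of s] by (auto simp: g_def f_def)
    have s0: "set v0 \<subseteq> {..<m}" unfolding v0_def by (rule set_row_word)
    have y0: "yam v0" unfolding v0_def using ag by (rule yam_row_word)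
    have fy: "0 < f y" using y by simp
    have c1: "count_list (v0 @ [y]) s = f s" for s using fy by (auto simp: c0 g_def)
    have c2: "count_list (v0 @ [y, c]) s = l s - (if s = d then 1 else 0)" for s
      using c1[of s] pos h(9) by (auto simp: f_def)
    have c3: "count_list (v0 @ [y, d]) s = l s - (if s = c then 1 else 0)" for s
      using c1[of s] pos h(9) by (auto simp: f_def)
    have c4: "count_list (v0 @ [y, c, d]) s = l s" "count_list (v0 @ [y, d, c]) s = l s" for s
      using c2[of s] c3[of s] pos h(9) by auto
    have f: "count_list (v0 @ [y]) = f" "count_list (v0 @ [y, c]) = (\<lambda>s. l s - (if s = d then 1 else 0))"
      "count_list (v0 @ [y, d]) = (\<lambda>s. l s - (if s = c then 1 else 0))"
      "count_list (v0 @ [y, c, d]) = l" "count_list (v0 @ [y, d, c]) = l"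
      using c1 c2 c3 c4 by (auto simp only: fun_eq_iff)
    have y1: "yam (v0 @ [y])" unfolding yam_snoc f using y0 af by blast
    have "yam (v0 @ [y, c])" using yam_snoc[of "v0 @ [y]" c, unfolded append_assoc append.simps f] y1 ad by blast
    then have ya: "yam ((v0 @ [y, c]) @ [d])"
      using yam_snoc[of "v0 @ [y, c]" d, unfolded append_assoc append.simps f] al by simp
    have "yam (v0 @ [y, d])" using yam_snoc[of "v0 @ [y]" d, unfolded append_assoc append.simps f] y1 ac by blast
    then have yb: "yam ((v0 @ [y, d]) @ [c])"
      using yam_snoc[of "v0 @ [y, d]" c, unfolded append_assoc append.simps f] al by simp
    have "mset u = mset (v0 @ [y, d])" unfolding mset_eq_count_list by (simp only: c3 cu) simp
    then have "ch_component m (map ?L (u @ [c]) @ r) = ch_component m (map ?L ((v0 @ [y, d]) @ [c]) @ r)"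
      using last[of u c "v0 @ [y, d]"] h yb by simp
    also have "\<dots> = ch_component m (map ?L ((v0 @ [y, c]) @ [d]) @ r)"
      using ch_component_swap[OF y(1,2) h(8) s0 Suc.prems(5)] by simp
    also have "\<dots> = ch_component m (map ?L (u' @ [d]) @ r)"
    proof -
      have "mset u' = mset (v0 @ [y, c])" unfolding mset_eq_count_list by (simp only: c2 cu') simp
      then show ?thesis using last[of u' d "v0 @ [y, c]"] h ya by simp
    qed
    finally show ?thesis .
  qed
  obtain u c where v: "v = u @ [c]" "length u = n" using Suc.hyps(2) by (cases v rule: rev_cases) auto
  have "length v' = Suc n" using Suc.prems(3) Suc.hyps(2) by (metis mset_eq_length)
  then obtain u' d where v': "v' = u' @ [d]" "length u' = n" by (cases v' rule: rev_cases) auto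
  have s: "set v' \<subseteq> {..<m}" using Suc.prems(3,4) by (metis mset_eq_setD)
  show ?case
  proof (cases c d rule: linorder_cases)
    case less
    then show ?thesis using main[of u u' c d] v v' Suc.prems s by auto
  next
    case greater
    then show ?thesis using main[of u' u d c] v v' Suc.prems s by auto
  next
    case equal
    then show ?thesis using last[of u c u'] v v' Suc.prems by auto
  qed
qed

section \<open>Reading words of tableaux\<close>

lemma asc_int_less: "c \<in> \<int> \<Longrightarrow> c \<le> x \<Longrightarrow> asc x y \<Longrightarrow> c < y"
  unfolding asc_def by (metis le_less le_less_trans)

lemma hw_neg_nth:
  assumes "is_hw m x" "a \<in> letters m" "nxt a < 0" "k < length x" "x ! k = nxt a"
  shows "\<exists>p<k. x ! p = a"
proof -
  have "is_hw m (take k x @ nxt a # drop (Suc k) x)"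
    using assms id_take_nth_drop[of k x] by simp
  then have "a \<in> set (take k x)" using hw_pred_before assms by blast
  then show ?thesis using assms(4) by (auto simp: in_set_conv_nth)
qed

text \<open>\<open>hw_even\<close> may return another \<open>nxt a\<close> instead of
  \<open>a\<close>. It lies strictly further left, so the search ends at an \<open>a\<close>. The
  odd case is the mirror image.\<close>

lemma hw_even_nth:
  assumes "is_hw m x" "a \<in> letters m" "0 < nxt a" "a \<in> \<int>" "k < length x" "x ! k = nxt a"
  shows "\<exists>p<k. x ! p = a"
  using assms(5,6)
proof (induction k rule: less_induct)
  case (less k)
  have "is_hw m (take k x @ nxt a # drop (Suc k) x)"
    using assms less.prems id_take_nth_drop[of k x] by simp
  then have "a \<in> set (take k x) \<or> nxt a \<in> set (take k x)" using hw_even assms by blast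
  then obtain p where "p < k" "x ! p = a \<or> x ! p = nxt a" using less.prems by (auto simp: in_set_conv_nth)
  then show ?case using less.IH[of p] less.prems by (metis less_trans)
qed

lemma hw_odd_nth:
  assumes "is_hw m x" "a \<in> letters m" "0 < nxt a" "a \<notin> \<int>" "k < length x" "x ! k = nxt a"
  shows "\<exists>p. k < p \<and> p < length x \<and> x ! p = a"
  using assms(5,6)
proof (induction "length x - k" arbitrary: k rule: less_induct)
  case less
  have "is_hw m (take k x @ nxt a # drop (Suc k) x)"
    using assms less.prems id_take_nth_drop[of k x] by simp
  then have "a \<in> set (drop (Suc k) x) \<or> nxt a \<in> set (drop (Suc k) x)" using hw_odd assms by blast
  then obtain i where "i < length x - Suc k" "x ! (Suc k + i) = a \<or> x ! (Suc k + i) = nxt a"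
    using less.prems by (auto simp: in_set_conv_nth)
  moreover define p where "p = Suc k + i"
  ultimately have p: "k < p" "p < length x" "x ! p = a \<or> x ! p = nxt a" by auto
  then show ?case using less.hyps[of p] less.prems by (metis diff_less_mono2 less_trans)
qed

lemma nxt_pos_cases: "y \<in> letters m \<Longrightarrow> 0 < nxt y \<Longrightarrow> 0 < y \<or> nxt y = 1 / 2"
  by (erule letters_cases) (auto simp: nxt_def split: if_splits)

lemma pos_letter_ge: "b \<in> letters m \<Longrightarrow> 0 < b \<Longrightarrow> 1 / 2 \<le> b"
  by (erule letters_cases) auto

text \<open>The letter \<open>1 / 2\<close> is exempt because its predecessor is \<open>-1\<close>,
  or does not exist if \<open>m = 0\<close>.\<close>

lemma hw_pos_pred:
  assumes "is_hw m x" "x \<in> words m" "b \<in> set x" "0 < b" "b \<noteq> 1 / 2"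
  shows "\<exists>y. y \<in> letters m \<and> 0 < y \<and> nxt y = b \<and> y \<in> set x"
proof -
  have b: "b \<in> letters m" using assms by (auto simp: words_def)
  have "b \<noteq> (if m = 0 then 1 / 2 else - of_nat m)" using assms by auto
  then obtain y where y: "y \<in> letters m" "nxt y = b" using pred_exists[OF b] by blast
  then have "0 < y" using nxt_pos_cases[of y m] assms by auto
  then show ?thesis using y hw_pred[OF assms(1)] assms(3) by blast
qed

section \<open>The reading order on the nodes of the body\<close>

definition row_nodes :: "nat list \<Rightarrow> nat \<Rightarrow> (nat \<times> nat) list" where
  "row_nodes l s = map (Pair s) (rev [0..<l ! s])"

definition rows_between :: "nat list \<Rightarrow> nat \<Rightarrow> nat \<Rightarrow> (nat \<times> nat) list" where
  "rows_between l s t = concat (map (row_nodes l) [s..<t])"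

definition reading :: "nat list \<Rightarrow> (nat \<times> nat) list" where
  "reading l = rows_between l 0 (length l)"

definition before :: "nat \<times> nat \<Rightarrow> nat \<times> nat \<Rightarrow> bool" where
  "before P Q \<longleftrightarrow> fst P < fst Q \<or> fst P = fst Q \<and> snd Q < snd P"

lemma set_row_nodes: "set (row_nodes l s) = {s} \<times> {..<l ! s}"
  by (auto simp: row_nodes_def)

lemma set_rows_between: "set (rows_between l s t) = {(i, j). s \<le> i \<and> i < t \<and> j < l ! i}"
  by (auto simp: rows_between_def set_row_nodes)

lemma set_reading: "set (reading l) = body l"
  by (auto simp: reading_def set_rows_between body_def)

lemma sorted_row_nodes: "sorted_wrt before (row_nodes l s)"
  by (auto simp: row_nodes_def sorted_wrt_map sorted_wrt_rev before_def
      intro: sorted_wrt_mono_rel[OF _ strict_sorted_list_of_set] sorted_wrt_mono_rel[where P = "(<)"])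

lemma sorted_rows_between: "sorted_wrt before (rows_between l 0 t)"
proof (induction t)
  case 0
  then show ?case by (simp add: rows_between_def)
next
  case (Suc t)
  have "rows_between l 0 (Suc t) = rows_between l 0 t @ row_nodes l t" by (simp add: rows_between_def)
  moreover have "\<forall>P\<in>set (rows_between l 0 t). \<forall>Q\<in>set (row_nodes l t). before P Q"
    by (auto simp: set_rows_between set_row_nodes before_def)
  ultimately show ?case using Suc sorted_row_nodes[of l t] by (simp add: sorted_wrt_append)
qed

lemma sorted_reading: "sorted_wrt before (reading l)"
  unfolding reading_def by (rule sorted_rows_between)

lemma distinct_reading: "distinct (reading l)"
proof -
  have "reading l ! i \<noteq> reading l ! j" if "i < j" "j < length (reading l)" for i j
    using sorted_wrt_nth_less[OF sorted_reading that] by (auto simp: before_def)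
  then show ?thesis unfolding distinct_conv_nth by (metis linorder_neqE_nat)
qed

lemma before_positions:
  assumes "P \<in> body l" "Q \<in> body l" "before P Q"
  obtains p q where "p < q" "q < length (reading l)" "reading l ! p = P" "reading l ! q = Q"
proof -
  obtain p where p: "p < length (reading l)" "reading l ! p = P"
    using assms(1) unfolding set_reading[symmetric] by (auto simp: in_set_conv_nth)
  obtain q where q: "q < length (reading l)" "reading l ! q = Q"
    using assms(2) unfolding set_reading[symmetric] by (auto simp: in_set_conv_nth)
  have "\<not> before Q P" "P \<noteq> Q" using assms(3) by (auto simp: before_def)
  then have "p < q" using sorted_wrt_nth_less[OF sorted_reading, of q p] p q
    by (metis linorder_neqE_nat)
  then show ?thesis using that p q by blast
qed

lemma reading_split:
  assumes "(s, j) \<in> body l"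
  shows "reading l = (rows_between l 0 s @ map (Pair s) (rev [Suc j..<l ! s])) @ (s, j) #
    map (Pair s) (rev [0..<j]) @ rows_between l (Suc s) (length l)"
proof -
  have b: "s < length l" "j < l ! s" using assms by (auto simp: body_def)
  have "[0..<length l] = [0..<s] @ s # [Suc s..<length l]"
    using b(1) by (metis le_add1 less_imp_le plus_nat.add_0 upt_add_eq_append upt_conv_Cons le_add_diff_inverse)
  then have "reading l = rows_between l 0 s @ row_nodes l s @ rows_between l (Suc s) (length l)"
    unfolding reading_def rows_between_def by simp
  moreover have "[0..<l ! s] = [0..<j] @ j # [Suc j..<l ! s]"
    using b(2) by (metis le_add1 less_imp_le plus_nat.add_0 upt_add_eq_append upt_conv_Cons le_add_diff_inverse)
  then have "row_nodes l s = map (Pair s) (rev [Suc j..<l ! s]) @ (s, j) # map (Pair s) (rev [0..<j])"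
    by (simp add: row_nodes_def)
  ultimately show ?thesis by simp
qed

lemma distinct_split_unique:
  assumes "distinct (xs @ x # ys)" "xs @ x # ys = xs' @ x # ys'"
  shows "xs = xs' \<and> ys = ys'"
proof -
  have "x \<notin> set xs" "x \<notin> set ys" using assms(1) by auto
  then show ?thesis using append_Cons_eq_iff[of x xs ys xs' ys'] assms(2) by blast
qed

lemma map_distinct_ex: "distinct R \<Longrightarrow> length u = length R \<Longrightarrow> \<exists>T. map T R = u"
proof -
  assume "distinct R" "length u = length R"
  then have "map (\<lambda>x. the (map_of (zip R u) x)) R = u"
    by (intro nth_equalityI) (auto simp: map_of_zip_nth)
  then show ?thesis by blast
qed

lemma excess_map_rev_upt:
  "excess a b (map g (rev [p..<q])) = (\<Sum>c\<in>{p..<q}. (if g c = b then 1 else 0) - (if g c = a then 1 else 0))"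
proof (induction q)
  case 0
  then show ?case by simp
next
  case (Suc q)
  then show ?case by (auto simp: atLeastLessThanSuc)
qed

lemma ep_ge_excess: "excess a b u \<le> ep a b (u @ v)"
  using ep_nonneg[of a b v] by (simp add: ep_append)

lemma ph_ge_excess: "- excess a b v \<le> ph a b (u @ v)"
  using ph_nonneg[of a b u] by (simp add: ph_append)

text \<open>\<open>rk r\<close> is the order of the positions of \<open>r\<close> described at \<open>asc\<close>.\<close>

definition rk :: "word \<Rightarrow> nat \<Rightarrow> nat \<Rightarrow> bool" where
  "rk r p q \<longleftrightarrow> r ! p < r ! q \<or> r ! p = r ! q \<and> (if r ! p \<in> \<int> then q < p else p < q)"

lemma rk_iff_asc:
  assumes "p \<noteq> q"
  shows "rk r p q \<longleftrightarrow> (if p < q then asc (r ! p) (r ! q) else \<not> asc (r ! q) (r ! p))"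
  using assms by (auto simp: rk_def asc_def)

text \<open>Rows are read from right to left, so of two nodes in a row the right one stands first in
  the word. Both tableau conditions, with their different treatment of even and odd entries, then
  say which position comes first in the order: the left node before the right one, and the upper
  node before the lower one.\<close>

definition body_tab :: "nat \<Rightarrow> nat list \<Rightarrow> (nat \<times> nat \<Rightarrow> rat) \<Rightarrow> bool" where
  "body_tab m l T \<longleftrightarrow> (\<forall>P\<in>body l. T P \<in> letters m)
    \<and> (\<forall>s j j'. (s, j') \<in> body l \<longrightarrow> j < j' \<longrightarrow> \<not> asc (T (s, j')) (T (s, j)))
    \<and> (\<forall>i i' j. (i', j) \<in> body l \<longrightarrow> i < i' \<longrightarrow> asc (T (i, j)) (T (i', j)))"

text \<open>The list \<open>q\<close> gives the positions of the ribbon entries in the reading word, following the ribbon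
  from the joint on. Its ascents are the downward steps of the ribbon.\<close>

locale arrangement =
  fixes m :: nat and l q :: "nat list"
  assumes length_l: "length l = m" and sorted_l: "sorted_wrt (\<ge>) l"
    and distinct_q: "distinct q" and set_q: "set q = {..<length q}"
    and full: "q \<noteq> [] \<Longrightarrow> m = 0 \<or> l ! (m - 1) \<noteq> 0"
begin

text \<open>Sortedness of \<open>q\<close> for \<open>rk r\<close> expresses the row and column
  conditions on the ribbon, and the last clause is the joint condition. Like
  \<open>body_tab\<close>, both speak only of the order of positions.\<close>

definition tableau_words :: "word set" where
  "tableau_words = {map T (reading l) @ r |T r. body_tab m l T \<and> r \<in> words m \<and> length r = length q
    \<and> sorted_wrt (rk r) q \<and> (q \<noteq> [] \<longrightarrow> (\<forall>P\<in>body l. asc (T P) (r ! hd q)))}"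

lemma body_left: "(s, j') \<in> body l \<Longrightarrow> j \<le> j' \<Longrightarrow> (s, j) \<in> body l"
  by (auto simp: body_def)

lemma body_up: "(i', j) \<in> body l \<Longrightarrow> i \<le> i' \<Longrightarrow> (i, j) \<in> body l"
proof -
  assume h: "(i', j) \<in> body l" "i \<le> i'"
  then have "l ! i' \<le> l ! i" using sorted_wrt_nth_less[OF sorted_l, of i i'] by (cases "i = i'") (auto simp: body_def)
  then show ?thesis using h by (auto simp: body_def)
qed

text \<open>Columns increase strictly at even entries, in particular at all negative ones, and no
  letter is below \<open>-m\<close>.\<close>

lemma col_lower:
  assumes "body_tab m l T" "(s, j) \<in> body l"
  shows "neg_letter m s \<le> T (s, j)"
  using assms(2)
proof (induction s)
  case 0
  then have "m \<noteq> 0" "T (0, j) \<in> letters m" using assms(1) length_l by (auto simp: body_def body_tab_def)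
  then show ?case using letters_least[of "T (0, j)" m] by (simp add: neg_letter_def)
next
  case (Suc s)
  have b: "(s, j) \<in> body l" using body_up[OF Suc.prems, of s] by simp
  have lt: "T (s, j) \<in> letters m" "T (Suc s, j) \<in> letters m" using b Suc.prems assms(1) by (auto simp: body_tab_def)
  have sm: "Suc s < m" using Suc.prems length_l by (auto simp: body_def)
  have a: "asc (T (s, j)) (T (Suc s, j))" using assms(1) Suc.prems unfolding body_tab_def by blast
  have "neg_letter m s < T (Suc s, j)"
    by (rule asc_int_less[OF neg_letter_Ints Suc.IH[OF b] a])
  then show ?case using nxt_le[OF neg_letter_letters lt(2), of s] sm by (simp add: nxt_neg_letter)
qed

lemma r_ge_hd:
  assumes "sorted_wrt (rk r) q" "length r = length q" "p < length r"
  shows "r ! hd q \<le> r ! p"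
proof -
  obtain q0 q' where q: "q = q0 # q'" using assms by (cases q) auto
  have "p \<in> set q" using set_q assms by simp
  then show ?thesis using assms(1) unfolding q by (auto simp: rk_def)
qed

text \<open>A nonempty ribbon requires a nonempty last row of the body, whose first entry is at
  least \<open>-1\<close>. The joint entry comes after it in the order and therefore exceeds
  \<open>-1\<close>, and the joint carries the least entry of the ribbon.\<close>

lemma r_pos:
  assumes "body_tab m l T" "r \<in> words m" "length r = length q" "sorted_wrt (rk r) q"
    and "q \<noteq> [] \<longrightarrow> (\<forall>P\<in>body l. asc (T P) (r ! hd q))" and b: "b \<in> set r"
  shows "0 < b"
proof -
  have bl: "b \<in> letters m" using assms by (auto simp: words_def)
  have ne: "q \<noteq> []" using assms by auto
  obtain p where p: "p < length r" "b = r ! p" using b by (auto simp: in_set_conv_nth)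
  show ?thesis
  proof (cases "m = 0")
    case True
    then show ?thesis using letters_least[OF bl] by simp
  next
    case False
    then have bd: "(m - 1, 0) \<in> body l" using full[OF ne] length_l by (auto simp: body_def)
    have "neg_letter m (m - 1) \<le> T (m - 1, 0)" by (rule col_lower[OF assms(1) bd])
    moreover have "asc (T (m - 1, 0)) (r ! hd q)" using assms(5) bd ne by blast
    ultimately have "neg_letter m (m - 1) < r ! hd q" by (rule asc_int_less[OF neg_letter_Ints])
    moreover have "r ! hd q \<le> b" using r_ge_hd[OF assms(4,3) p(1)] p(2) by simp
    ultimately have "neg_letter m (m - 1) < b" by simp
    then have "-1 < b" using False by (simp add: neg_letter_def of_nat_diff)
    from bl this show ?thesis by (cases rule: letters_cases) auto
  qed
qed

lemma tableau_words_subset: "tableau_words \<subseteq> words m"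
  by (auto simp: tableau_words_def body_tab_def words_def simp flip: set_reading)

text \<open>All conditions in \<open>tableau_words\<close> refer to the order of positions. Together
  with \<open>asc_step\<close> this handles every operator of nonnegative index.\<close>

lemma tableau_words_asc_closed:
  assumes x: "x \<in> tableau_words" and y: "y \<in> words m" "length y = length x"
    and asc: "\<And>p p'. p < p' \<Longrightarrow> p' < length x \<Longrightarrow> asc (y ! p) (y ! p') \<longleftrightarrow> asc (x ! p) (x ! p')"
  shows "y \<in> tableau_words"
proof -
  let ?R = "reading l"
  obtain T r where T: "x = map T ?R @ r" "body_tab m l T" "r \<in> words m" "length r = length q"
    "sorted_wrt (rk r) q" "q \<noteq> [] \<longrightarrow> (\<forall>P\<in>body l. asc (T P) (r ! hd q))"
    using x unfolding tableau_words_def by blast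
  define r' where "r' = drop (length ?R) y"
  obtain T' where T': "map T' ?R = take (length ?R) y"
    using map_distinct_ex[OF distinct_reading, of "take (length ?R) y" l] y T(1) by auto
  have yy: "y = map T' ?R @ r'" unfolding r'_def T' by simp
  have lr: "length r' = length q" using y T unfolding r'_def by simp
  have TT: "asc (T' P) (T' Q) \<longleftrightarrow> asc (T P) (T Q)" if PQ: "P \<in> body l" "Q \<in> body l" "before P Q" for P Q
  proof -
    obtain p p' where p: "p < p'" "p' < length ?R" "?R ! p = P" "?R ! p' = Q"
      using before_positions[OF PQ] by blast
    then show ?thesis using asc[of p p'] unfolding yy T(1) by (simp add: nth_append)
  qed
  have rr: "rk r' p p' \<longleftrightarrow> rk r p p'" if "p \<noteq> p'" "p < length q" "p' < length q" for p p'
  proof -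
    have "asc (r' ! p) (r' ! p') \<longleftrightarrow> asc (r ! p) (r ! p')" if "p < p'" "p' < length q" for p p'
      using asc[of "length ?R + p" "length ?R + p'"] that T(4) unfolding yy T(1) by (simp add: nth_append)
    then show ?thesis using that by (auto simp: rk_iff_asc)
  qed
  have "body_tab m l T'"
    unfolding body_tab_def
  proof (intro conjI allI impI ballI)
    fix P assume "P \<in> body l"
    then have "T' P \<in> set y" unfolding yy by (simp add: set_reading)
    then show "T' P \<in> letters m" using y by (auto simp: words_def)
  next
    fix s j j' assume h: "(s, j') \<in> body l" "j < j'"
    then show "\<not> asc (T' (s, j')) (T' (s, j))"
      using TT[of "(s, j')" "(s, j)"] T(2) body_left[of s j' j] unfolding body_tab_def by (auto simp: before_def)
  next
    fix i i' j assume h: "(i', j) \<in> body l" "i < i'"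
    then show "asc (T' (i, j)) (T' (i', j))"
      using TT[of "(i, j)" "(i', j)"] T(2) body_up[of i' j i] unfolding body_tab_def by (auto simp: before_def)
  qed
  moreover have "r' \<in> words m" using y unfolding yy by (simp add: words_append)
  moreover have "sorted_wrt (rk r') q"
    using T(5) unfolding sorted_wrt_iff_nth_less
  proof (intro allI impI)
    fix i j assume h: "\<forall>i j. i < j \<longrightarrow> j < length q \<longrightarrow> rk r (q ! i) (q ! j)" "i < j" "j < length q"
    have "q ! i \<noteq> q ! j" using distinct_q h nth_eq_iff_index_eq by (metis less_trans nat_neq_iff)
    moreover have "q ! i < length q" "q ! j < length q" using set_q h by (metis lessThan_iff less_trans nth_mem)+
    ultimately show "rk r' (q ! i) (q ! j)" using rr h by blast
  qed
  moreover have "asc (T' P) (r' ! hd q)" if P: "P \<in> body l" "q \<noteq> []" for P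
  proof -
    obtain p where p: "p < length ?R" "?R ! p = P" using P unfolding set_reading[symmetric] by (auto simp: in_set_conv_nth)
    have "hd q < length q" using set_q P by (metis hd_in_set lessThan_iff)
    then have "asc (T' P) (r' ! hd q) \<longleftrightarrow> asc (T P) (r ! hd q)"
      using asc[of p "length ?R + hd q"] p T(4) unfolding yy T(1) by (simp add: nth_append)
    then show ?thesis using T(6) P by blast
  qed
  ultimately show ?thesis unfolding tableau_words_def yy using lr by blast
qed

lemma body_tab_upd:
  assumes T: "body_tab m l T" and N: "(s, j) \<in> body l" and d: "d \<in> letters m"
    and right: "\<And>j'. j < j' \<Longrightarrow> (s, j') \<in> body l \<Longrightarrow> \<not> asc (T (s, j')) d"
    and left: "\<And>j'. j' < j \<Longrightarrow> \<not> asc d (T (s, j'))"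
    and up: "\<And>i. i < s \<Longrightarrow> asc (T (i, j)) d"
    and down: "\<And>i. s < i \<Longrightarrow> (i, j) \<in> body l \<Longrightarrow> asc d (T (i, j))"
  shows "body_tab m l (T((s, j) := d))"
  using T d right left up down unfolding body_tab_def by (auto simp: fun_upd_def)

text \<open>If the entry below were \<open>nxt a\<close> already, then the entries \<open>nxt a\<close> of the next row up to this
  column would outnumber the entries \<open>a\<close> read before them, so the \<open>a\<close> at hand would be matched.\<close>

lemma move_up_tab:
  assumes T: "body_tab m l T" and N: "(s, j) \<in> body l" and a: "a \<in> letters m" "nxt a < 0" "T (s, j) = a"
    and R: "reading l = L1 @ (s, j) # L2"
    and ph: "ph a (nxt a) (map T L1) = 0" and ep: "ep a (nxt a) (map T L2 @ r) = 0"
  shows "body_tab m l (T((s, j) := nxt a))"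
proof (rule body_tab_upd[OF T N nxt_letters[OF a(1)]])
  define b where "b = nxt a"
  have lt: "a < b" unfolding b_def by (rule nxt_greater)
  have I: "a \<in> \<int>" "b \<in> \<int>" using letters_neg_Ints a nxt_letters[OF a(1)] lt unfolding b_def by auto
  note T' = T[unfolded body_tab_def]
  have lett: "T P \<in> letters m" if "P \<in> body l" for P using T' that by blast
  have row: "T (s', c) \<le> T (s', c')" if "(s', c') \<in> body l" "c \<le> c'" for s' c c'
    using T' that by (cases "c = c'") (auto simp: asc_def not_less)
  have col: "asc (T (i, c)) (T (i', c))" if "(i', c) \<in> body l" "i < i'" for i i' c
    using T' that by blast
  have L: "L1 = rows_between l 0 s @ map (Pair s) (rev [Suc j..<l ! s])"
    "L2 = map (Pair s) (rev [0..<j]) @ rows_between l (Suc s) (length l)"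
    using distinct_split_unique[OF distinct_reading[of l, unfolded R] R[symmetric, unfolded reading_split[OF N]]]
    by auto
  show "\<not> asc (T (s, j')) (nxt a)" if h: "j < j'" "(s, j') \<in> body l" for j'
  proof
    assume as: "asc (T (s, j')) (nxt a)"
    have "a \<le> T (s, j')" using row[of s j' j] h a(3) by simp
    moreover have "T (s, j') < b" using as I by (auto simp: asc_def b_def)
    ultimately have "T (s, j') = a" using nxt_le[OF a(1) lett[OF h(2)]] unfolding b_def by force
    moreover have b1: "(s, Suc j) \<in> body l" using body_left[of s j' "Suc j"] h by simp
    ultimately have "T (s, Suc j) = a" using row[of s "Suc j" j] row[of s j' "Suc j"] h a(3) by force
    moreover have "[Suc j..<l ! s] = Suc j # [Suc (Suc j)..<l ! s]" using b1 by (intro upt_conv_Cons) (simp add: body_def)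
    then obtain W where "map T L1 = W @ [T (s, Suc j)]" unfolding L by auto
    ultimately show False using ph lt ph_ge_excess[of a b "[a]" W] by (simp add: b_def[symmetric])
  qed
  show "\<not> asc (nxt a) (T (s, j'))" if "j' < j" for j'
    using row[OF N, of j'] that a(3) lt by (auto simp: asc_def b_def)
  show "asc (T (i, j)) (nxt a)" if "i < s" for i
    using col[OF N that] a(3) I lt by (auto simp: asc_def b_def)
  show "asc (nxt a) (T (i, j))" if h: "s < i" "(i, j) \<in> body l" for i
  proof (rule ccontr)
    assume n: "\<not> asc (nxt a) (T (i, j))"
    have gt: "b \<le> T (i', j)" if "s < i'" "(i', j) \<in> body l" for i'
      using col[OF that(2,1)] a(3) I nxt_le[OF a(1) lett[OF that(2)]] by (auto simp: asc_def b_def)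
    have ib: "T (i, j) = b" using gt[OF h] n by (auto simp: asc_def b_def)
    have bS: "(Suc s, j) \<in> body l" using body_up[OF h(2), of "Suc s"] h by simp
    have Sb: "T (Suc s, j) = b"
      using gt[OF _ bS] col[OF h(2), of "Suc s"] ib h I by (cases "i = Suc s") (auto simp: asc_def)
    \<comment> \<open>The run of \<open>nxt a\<close> in the row below starts at \<open>j0\<close>.
      To the left of it row \<open>s\<close> contains no \<open>a\<close>, because an
      \<open>a\<close> there would force an entry of at least \<open>nxt a\<close> below it.\<close>
    define j0 where "j0 = (LEAST c. T (Suc s, c) = b)"
    have j0: "T (Suc s, j0) = b" "j0 \<le> j" unfolding j0_def using Sb by (auto intro: LeastI Least_le)
    have j0_min: "T (Suc s, c) \<noteq> b" if "c < j0" for c using not_less_Least[of c] that unfolding j0_def by blast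
    have lS: "j < l ! Suc s" "Suc s < length l" using bS by (auto simp: body_def)
    have "[Suc s..<length l] = Suc s # [Suc (Suc s)..<length l]" using lS by (intro upt_conv_Cons)
    moreover have "[0..<l ! Suc s] = [0..<j0] @ [j0..<l ! Suc s]"
      using j0 lS by (metis le_add_diff_inverse less_imp_le order_trans plus_nat.add_0 upt_add_eq_append zero_le)
    ultimately obtain W where W: "map T L2 @ r = (map (\<lambda>c. T (s, c)) (rev [0..<j]) @ map (\<lambda>c. T (Suc s, c)) (rev [j0..<l ! Suc s])) @ W"
      unfolding L rows_between_def row_nodes_def by (auto simp: o_def)
    have na: "T (s, c) \<noteq> a" if "c < j0" for c
    proof
      assume "T (s, c) = a"
      moreover have bc: "(Suc s, c) \<in> body l" using body_left[OF bS, of c] that j0 by simp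
      ultimately have "a < T (Suc s, c)" using col[OF bc, of s] I by (auto simp: asc_def)
      then have "b \<le> T (Suc s, c)" using nxt_le[OF a(1) lett[OF bc]] by (simp add: b_def)
      moreover have "T (Suc s, c) \<le> b" using row[of "Suc s" j0 c] j0 that body_left[OF bS, of j0] by simp
      ultimately show False using j0_min[OF that] by simp
    qed
    have "excess a b (map (\<lambda>c. T (s, c)) (rev [0..<j])) \<ge> (\<Sum>c\<in>{0..<j}. if c < j0 then 0 else -1)"
      unfolding excess_map_rev_upt using na by (intro sum_mono) auto
    also have "(\<Sum>c\<in>{0..<j}. if c < j0 then 0 else -1) = - int (j - j0)"
    proof -
      have "{0..<j} \<inter> - {c. c < j0} = {j0..<j}" by auto
      then show ?thesis by (simp add: sum.If_cases)
    qed
    finally have e1: "excess a b (map (\<lambda>c. T (s, c)) (rev [0..<j])) \<ge> - int (j - j0)" .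
    have "excess a b (map (\<lambda>c. T (Suc s, c)) (rev [j0..<l ! Suc s])) \<ge> (\<Sum>c\<in>{j0..<l ! Suc s}. if c \<le> j then 1 else 0)"
      unfolding excess_map_rev_upt
    proof (intro sum_mono)
      fix c assume c: "c \<in> {j0..<l ! Suc s}"
      then have bc: "(Suc s, c) \<in> body l" using lS by (auto simp: body_def)
      have "b \<le> T (Suc s, c)" using row[OF bc, of j0] c j0 by simp
      moreover have "T (Suc s, c) \<le> b" if "c \<le> j" using row[OF bS that] Sb by simp
      ultimately show "(if c \<le> j then 1 else 0) \<le> (if T (Suc s, c) = b then 1 else 0) - (if T (Suc s, c) = a then 1 else (0::int))"
        using lt by auto
    qed
    also have "(\<Sum>c\<in>{j0..<l ! Suc s}. if c \<le> j then 1 else 0) = int (Suc j - j0)"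
    proof -
      have "{j0..<l ! Suc s} \<inter> {c. c \<le> j} = {j0..<Suc j}" using lS by auto
      then show ?thesis by (simp add: sum.If_cases)
    qed
    finally have e2: "excess a b (map (\<lambda>c. T (Suc s, c)) (rev [j0..<l ! Suc s])) \<ge> int (Suc j - j0)" .
    have "excess a b (map (\<lambda>c. T (s, c)) (rev [0..<j]) @ map (\<lambda>c. T (Suc s, c)) (rev [j0..<l ! Suc s])) > 0"
      using e1 e2 j0(2) by (simp add: excess_append)
    then show False using ep ep_ge_excess[of a b _ W] unfolding W b_def[symmetric] by (metis linorder_not_less)
  qed
qed

text \<open>If the left neighbour were \<open>nxt a\<close> too, it would be the next letter read
  and an unmatched closing bracket. If the entry above were \<open>a\<close>, the letters
  \<open>a\<close> of the row above from this column on would outnumber the letters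
  \<open>nxt a\<close> read after them and before this node, leaving an unmatched opening
  bracket.\<close>

lemma move_down_tab:
  assumes T: "body_tab m l T" and N: "(s, j) \<in> body l" and a: "a \<in> letters m" "nxt a < 0" "T (s, j) = nxt a"
    and R: "reading l = L1 @ (s, j) # L2"
    and ph: "ph a (nxt a) (map T L1) = 0" and ep: "ep a (nxt a) (map T L2 @ r) = 0"
  shows "body_tab m l (T((s, j) := a))"
proof (rule body_tab_upd[OF T N a(1)])
  define b where "b = nxt a"
  have lt: "a < b" unfolding b_def by (rule nxt_greater)
  have I: "a \<in> \<int>" "b \<in> \<int>" using letters_neg_Ints a nxt_letters[OF a(1)] lt unfolding b_def by auto
  note T' = T[unfolded body_tab_def]
  have Tb: "T (s, j) = b" using a by (simp add: b_def)
  have lett: "T P \<in> letters m" if "P \<in> body l" for P using T' that by blast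
  have row: "T (s', c) \<le> T (s', c')" if "(s', c') \<in> body l" "c \<le> c'" for s' c c'
    using T' that by (cases "c = c'") (auto simp: asc_def not_less)
  have col: "asc (T (i, c)) (T (i', c))" if "(i', c) \<in> body l" "i < i'" for i i' c
    using T' that by blast
  have le_a: "T P \<le> a" if "P \<in> body l" "T P < b" for P
    using nxt_le[OF a(1) lett[OF that(1)]] that(2) by (force simp: b_def)
  have L: "L1 = rows_between l 0 s @ map (Pair s) (rev [Suc j..<l ! s])"
    "L2 = map (Pair s) (rev [0..<j]) @ rows_between l (Suc s) (length l)"
    using distinct_split_unique[OF distinct_reading[of l, unfolded R] R[symmetric, unfolded reading_split[OF N]]]
    by auto
  show "\<not> asc (T (s, j')) a" if "j < j'" "(s, j') \<in> body l" for j'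
    using row[of s j' j] that Tb lt by (auto simp: asc_def)
  show "\<not> asc a (T (s, j'))" if h: "j' < j" for j'
  proof
    assume as: "asc a (T (s, j'))"
    have bj: "(s, j') \<in> body l" using body_left[OF N] h by simp
    have "a < T (s, j')" using as I by (auto simp: asc_def)
    then have "b \<le> T (s, j')" using nxt_le[OF a(1) lett[OF bj]] by (simp add: b_def)
    moreover have "T (s, j') \<le> T (s, j - 1)" "T (s, j - 1) \<le> b"
      using row[OF N, of "j - 1"] row[of s "j - 1" j'] body_left[OF N, of "j - 1"] h Tb by auto
    ultimately have "T (s, j - 1) = b" by simp
    moreover have "[0..<j] = [0..<j - 1] @ [j - 1]" using h by (metis Suc_pred' gr_implies_not0 neq0_conv upt_Suc_append zero_le)
    then obtain W where "map T L2 @ r = T (s, j - 1) # W" unfolding L by auto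
    ultimately show False using ep lt ep_nonneg[of a b W] by (simp add: b_def[symmetric])
  qed
  show "asc a (T (i, j))" if "s < i" "(i, j) \<in> body l" for i
    using col[OF that(2,1)] Tb I lt by (auto simp: asc_def)
  show "asc (T (i, j)) a" if h: "i < s" for i
  proof (rule ccontr)
    assume n: "\<not> asc (T (i, j)) a"
    have bU: "(i', j) \<in> body l" if "i' < s" for i' using body_up[OF N, of i'] that by simp
    have le: "T (i', j) \<le> a" if "i' < s" for i'
      using le_a[OF bU[OF that]] col[OF N that] Tb I by (auto simp: asc_def)
    have ia: "T (i, j) = a" using le[OF h] n by (auto simp: asc_def)
    obtain s' where s': "s = Suc s'" using h by (cases s) auto
    have Sa: "T (s', j) = a"
      using le[of s'] col[OF bU[of s'], of i] ia h I s' by (cases "i = s'") (auto simp: asc_def)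
    \<comment> \<open>The run of \<open>a\<close> in the row above ends at column \<open>j1\<close>.
      By the column condition each \<open>nxt a\<close> to the right of column \<open>j\<close> in
      row \<open>s\<close> has an \<open>a\<close> above it, so it lies in a column up to
      \<open>j1\<close>.\<close>
    define M where "M = {c. c < l ! s' \<and> T (s', c) = a}"
    define j1 where "j1 = Max M"
    have fM: "finite M" "j \<in> M" using Sa bU[of s'] s' by (auto simp: M_def body_def)
    have j1: "j1 \<in> M" "j \<le> j1" unfolding j1_def using fM by (auto intro: Max_in)
    have j1_max: "c \<le> j1" if "c < l ! s'" "T (s', c) = a" for c
      unfolding j1_def using that fM by (intro Max_ge) (auto simp: M_def)
    have ls: "j < l ! s" "s < length l" using N by (auto simp: body_def)
    have b1: "(s', j1) \<in> body l" "T (s', j1) = a" using j1 ls s' by (auto simp: M_def body_def)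
    have "rows_between l 0 s = rows_between l 0 s' @ row_nodes l s'" unfolding s' rows_between_def by simp
    moreover have "[0..<l ! s'] = [0..<Suc j1] @ [Suc j1..<l ! s']"
      using upt_add_eq_append[of 0 "Suc j1" "l ! s' - Suc j1"] b1(1) by (simp add: body_def del: upt_Suc)
    ultimately obtain W where W: "map T L1 = W @ (map (\<lambda>c. T (s', c)) (rev [0..<Suc j1]) @ map (\<lambda>c. T (s, c)) (rev [Suc j..<l ! s]))"
      unfolding L row_nodes_def by (auto simp: o_def simp del: upt_Suc)
    have nb: "c \<le> j1" if c: "c < l ! s" "T (s, c) = b" for c
    proof (cases "c \<le> j")
      case False
      have bc: "(s, c) \<in> body l" using c ls by (simp add: body_def)
      have bc': "(s', c) \<in> body l" using body_up[OF bc, of s'] s' by simp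
      have "T (s', c) < b" using col[OF bc, of s'] c s' I by (auto simp: asc_def)
      then have "T (s', c) \<le> a" using le_a[OF bc'] by simp
      moreover have "a \<le> T (s', c)" using row[OF bc', of j] False Sa by simp
      ultimately show ?thesis using j1_max[of c] bc' by (simp add: body_def)
    qed (use j1 in simp)
    have "excess a b (map (\<lambda>c. T (s', c)) (rev [0..<Suc j1])) \<le> (\<Sum>c\<in>{0..<Suc j1}. if j \<le> c then -1 else 0)"
      unfolding excess_map_rev_upt
    proof (intro sum_mono)
      fix c assume c: "c \<in> {0..<Suc j1}"
      then have "T (s', c) \<le> a" using row[OF b1(1), of c] b1(2) by simp
      moreover have "a \<le> T (s', c)" if "j \<le> c"
        using row[of s' c j] body_left[OF b1(1), of c] c that Sa by simp
      ultimately show "(if T (s', c) = b then 1 else 0) - (if T (s', c) = a then 1 else 0) \<le> (if j \<le> c then -1 else (0::int))"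
        using lt by auto
    qed
    also have "(\<Sum>c\<in>{0..<Suc j1}. if j \<le> c then -1 else 0) = - int (Suc j1 - j)"
    proof -
      have "{0..<Suc j1} \<inter> {c. j \<le> c} = {j..<Suc j1}" by auto
      then show ?thesis by (simp add: sum.If_cases del: sum.op_ivl_Suc)
    qed
    finally have e1: "excess a b (map (\<lambda>c. T (s', c)) (rev [0..<Suc j1])) \<le> - int (Suc j1 - j)" .
    have "excess a b (map (\<lambda>c. T (s, c)) (rev [Suc j..<l ! s])) \<le> (\<Sum>c\<in>{Suc j..<l ! s}. if c \<le> j1 then 1 else 0)"
      unfolding excess_map_rev_upt using nb by (intro sum_mono) auto
    also have "\<dots> = int (card ({Suc j..<l ! s} \<inter> {c. c \<le> j1}))" by (simp add: sum.If_cases)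
    also have "\<dots> \<le> int (card {Suc j..<Suc j1})"
      by (intro iffD2[OF of_nat_le_iff] card_mono) auto
    finally have e2: "excess a b (map (\<lambda>c. T (s, c)) (rev [Suc j..<l ! s])) \<le> int (j1 - j)" by simp
    have "excess a b (map (\<lambda>c. T (s', c)) (rev [0..<Suc j1]) @ map (\<lambda>c. T (s, c)) (rev [Suc j..<l ! s])) < 0"
      using e1 e2 j1(2) unfolding excess_append by linarith
    then show False using ph ph_ge_excess[of a b _ W] unfolding W b_def[symmetric] by (metis add.inverse_inverse linorder_not_less neg_0_le_iff_le)
  qed
qed

lemma neg_position:
  assumes "map T R @ r = U @ c # V" "c \<notin> set r"
  shows "\<exists>L1 N L2. R = L1 @ N # L2 \<and> U = map T L1 \<and> T N = c \<and> V = map T L2 @ r"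
proof -
  have "\<exists>W. map T R = U @ c # W \<and> V = W @ r"
    using assms by (auto simp: append_eq_append_conv2 Cons_eq_append_conv append_eq_Cons_conv)
  then show ?thesis by (auto simp: map_eq_append_conv Cons_eq_map_conv map_eq_Cons_conv)
qed

text \<open>The changed letter is negative while ribbon entries are positive, so it belongs to the
  body. Its new value is negative again and so still comes before the joint.\<close>

lemma tableau_words_neg_closed:
  assumes a: "a \<in> letters m" "nxt a < 0" and adm: "ph a (nxt a) U = 0" "ep a (nxt a) V = 0"
    and cd: "(c = a \<and> d = nxt a) \<or> (c = nxt a \<and> d = a)" and x: "U @ c # V \<in> tableau_words"
  shows "U @ d # V \<in> tableau_words"
proof -
  let ?R = "reading l"
  have neg: "c < 0" "d < 0" and dl: "d \<in> letters m" using cd a nxt_greater[of a] nxt_letters[OF a(1)] by auto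
  obtain T r where T: "U @ c # V = map T ?R @ r" "body_tab m l T" "r \<in> words m" "length r = length q"
    "sorted_wrt (rk r) q" "q \<noteq> [] \<longrightarrow> (\<forall>P\<in>body l. asc (T P) (r ! hd q))"
    using x unfolding tableau_words_def by blast
  have rpos: "0 < b" if "b \<in> set r" for b using r_pos[OF T(2-6) that] .
  then have "c \<notin> set r" using neg by fastforce
  then obtain L1 N L2 where L: "?R = L1 @ N # L2" "U = map T L1" "T N = c" "V = map T L2 @ r"
    using neg_position[OF T(1)[symmetric]] by blast
  obtain s j where N: "N = (s, j)" by (cases N)
  have Nb: "(s, j) \<in> body l" using L(1) N set_reading[of l] by (metis in_set_conv_decomp)
  have tab: "body_tab m l (T(N := d))"
    using cd
  proof
    assume "c = a \<and> d = nxt a"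
    then show ?thesis using move_up_tab[OF T(2) Nb a _ L(1)[unfolded N]] adm L N by blast
  next
    assume "c = nxt a \<and> d = a"
    then show ?thesis using move_down_tab[OF T(2) Nb a _ L(1)[unfolded N]] adm L N by blast
  qed
  have "N \<notin> set L1" "N \<notin> set L2" using distinct_reading[of l] unfolding L(1) by auto
  then have "U @ d # V = map (T(N := d)) ?R @ r" unfolding L by simp
  moreover have "asc ((T(N := d)) P) (r ! hd q)" if "q \<noteq> []" "P \<in> body l" for P
  proof (cases "P = N")
    case True
    have "hd q < length r" using set_q T(4) that(1) by (metis hd_in_set lessThan_iff)
    then have "0 < r ! hd q" using rpos by simp
    then show ?thesis using True neg by (simp add: asc_def)
  next
    case False
    then show ?thesis using T(6) that by simp
  qed
  ultimately show ?thesis unfolding tableau_words_def using tab T by blast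
qed

lemma tableau_words_closed:
  assumes "x \<in> tableau_words" "step m x y \<or> step m y x"
  shows "y \<in> tableau_words"
proof -
  have xw: "x \<in> words m" using assms(1) tableau_words_subset by blast
  then have yw: "y \<in> words m" using assms(2) step_words by blast
  obtain a u v where a: "a \<in> letters m" "admissible a u v"
    "(x = u @ a # v \<and> y = u @ nxt a # v) \<or> (y = u @ a # v \<and> x = u @ nxt a # v)"
    using assms(2) unfolding step_def by blast
  show ?thesis
  proof (cases "nxt a < 0")
    case True
    then have "ph a (nxt a) u = 0" "ep a (nxt a) v = 0" using a(2) by (auto simp: admissible_def)
    then show ?thesis using tableau_words_neg_closed[OF a(1) True] a(3) assms(1) by blast
  next
    case False
    then have pos: "0 < nxt a" using letters_nonzero[OF nxt_letters[OF a(1)]] by simp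
    have w: "u @ a # v \<in> words m" using a(3) xw yw by blast
    have len: "length (u @ a # v) = length x" using a(3) by auto
    show ?thesis
    proof (rule tableau_words_asc_closed[OF assms(1) yw])
      show "length y = length x" using a(3) by auto
      fix p p' assume "p < p'" "p' < length x"
      then show "asc (y ! p) (y ! p') \<longleftrightarrow> asc (x ! p) (x ! p')"
        using asc_step[OF a(1) pos w a(2), of p p'] a(3) len by auto
    qed
  qed
qed

end

text \<open>The least values possible along the ribbon. An odd letter may be repeated in a step
  downwards, which is an ascent of \<open>q\<close>, and an even letter in a step to the
  right.\<close>

fun min_entry :: "nat list \<Rightarrow> nat \<Rightarrow> rat" where
  "min_entry q 0 = 1 / 2"
| "min_entry q (Suc t) = (if (q ! t < q ! Suc t) = (min_entry q t \<notin> \<int>) then min_entry q t else nxt (min_entry q t))"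

lemma min_entry_letters: "min_entry q t \<in> letters m"
proof (induction t)
  case 0
  show ?case unfolding letters_def by (auto intro!: exI[of _ "1::nat"])
next
  case (Suc t)
  then show ?case by (simp add: nxt_letters)
qed

lemma min_entry_pos: "0 < min_entry q t"
proof (induction t)
  case (Suc t)
  then show ?case using nxt_greater[of "min_entry q t"] by auto
qed simp

section \<open>Highest weight words among the reading words\<close>

context arrangement
begin

lemma q_nth: "t < length q \<Longrightarrow> q ! t < length q"
  using set_q by (metis lessThan_iff nth_mem)

lemma q_surj: "p < length q \<Longrightarrow> \<exists>t<length q. p = q ! t"
  using set_q by (metis in_set_conv_nth lessThan_iff)

lemma q_neq: "s < t \<Longrightarrow> t < length q \<Longrightarrow> q ! s \<noteq> q ! t"
  using distinct_q by (metis less_trans nat_neq_iff nth_eq_iff_index_eq)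

lemma r_mono:
  assumes "sorted_wrt (rk r) q" "s \<le> t" "t < length q"
  shows "r ! (q ! s) \<le> r ! (q ! t)"
proof (cases "s = t")
  case False
  then have "rk r (q ! s) (q ! t)" using assms sorted_wrt_nth_less[OF assms(1), of s t] by simp
  then show ?thesis by (auto simp: rk_def)
qed simp

lemma min_entry_allowed:
  assumes "Suc t < length q" "r ! (q ! t) = min_entry q t" "rk r (q ! t) (q ! Suc t)"
    and "r ! (q ! Suc t) \<in> letters m"
  shows "min_entry q (Suc t) \<le> r ! (q ! Suc t)"
proof -
  let ?b = "min_entry q t" and ?z = "r ! (q ! Suc t)"
  have "?b \<le> ?z" using assms(2,3) by (auto simp: rk_def)
  moreover have "(q ! t < q ! Suc t) = (?b \<notin> \<int>)" if "?z = ?b"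
    using assms(2,3) that q_neq[of t "Suc t"] assms(1) by (auto simp: rk_def split: if_splits)
  ultimately show ?thesis using nxt_le[OF min_entry_letters assms(4), of q t] by force
qed

lemma hw_body:
  assumes hw: "is_hw m (map T (reading l) @ r)" and T: "body_tab m l T" "r \<in> words m" "length r = length q"
    "sorted_wrt (rk r) q" "q \<noteq> [] \<longrightarrow> (\<forall>P\<in>body l. asc (T P) (r ! hd q))"
    and P: "(s, j) \<in> body l"
  shows "T (s, j) = neg_letter m s"
proof -
  let ?R = "reading l" and ?x = "map T (reading l) @ r"
  have T': "body_tab m l T" using T(1) .
  have lett: "T N \<in> letters m" if "N \<in> body l" for N using T(1) that by (auto simp: body_tab_def)
  have xw: "?x \<in> words m" using T lett by (auto simp: words_def simp flip: set_reading)
  have node: "\<exists>N. N \<in> body l \<and> ?R ! p = N \<and> ?x ! p = T N" if "p < length ?R" for p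
    using that set_reading[of l] by (metis length_map nth_append nth_map nth_mem)
  have bef: "before (?R ! p) (?R ! p')" if "p < p'" "p' < length ?R" for p p'
    using sorted_wrt_nth_less[OF sorted_reading that] .
  have index: "\<exists>p<length ?R. ?R ! p = N \<and> ?x ! p = T N" if "N \<in> body l" for N
    using that unfolding set_reading[symmetric] by (auto simp: in_set_conv_nth nth_append)
  have row: "T (s, c) \<le> T (s, c')" if "(s, c') \<in> body l" "c \<le> c'" for s c c'
    using T(1) that unfolding body_tab_def by (cases "c = c'") (auto simp: asc_def not_less)
  \<comment> \<open>The predecessor of a negative letter must be read before it, hence in a higher
    row: in the same row, earlier means further right, where entries are not smaller.\<close>
  have low: "t \<le> i" if "t < m" "(i, c) \<in> body l" "T (i, c) = neg_letter m t" for t i c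
    using that
  proof (induction t arbitrary: i c)
    case (Suc t)
    obtain p where p: "p < length ?R" "?R ! p = (i, c)" "?x ! p = T (i, c)" using index Suc.prems by blast
    have n: "nxt (neg_letter m t) = neg_letter m (Suc t)" using Suc.prems by (simp add: nxt_neg_letter)
    obtain p' where p': "p' < p" "?x ! p' = neg_letter m t"
      using hw_neg_nth[OF hw neg_letter_letters, of t p] n neg_letter_neg[of "Suc t" m] p Suc.prems by auto
    obtain i' c' where N: "(i', c') \<in> body l" "?R ! p' = (i', c')" "T (i', c') = neg_letter m t"
      using node[of p'] p p' by (cases "?R ! p'") auto
    have "t \<le> i'" using Suc.IH[of i' c'] N Suc.prems by simp
    moreover have "before (i', c') (i, c)" using bef[OF p'(1) p(1)] p N by simp
    moreover have "i' \<noteq> i"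
    proof
      assume "i' = i"
      then have "c < c'" using \<open>before (i', c') (i, c)\<close> by (simp add: before_def)
      then have "T (i, c) \<le> T (i', c')" using row[OF N(1), of c] \<open>i' = i\<close> by simp
      then show False using N(3) Suc.prems neg_letter_less[of m t "Suc t"] by simp
    qed
    ultimately show ?case by (auto simp: before_def)
  qed simp
  have neg: "T N < 0" if N: "N \<in> body l" for N
  proof (rule ccontr)
    assume "\<not> T N < 0"
    then have pN: "0 < T N" using letters_nonzero[OF lett[OF N]] by simp
    have m0: "m \<noteq> 0" using N length_l by (auto simp: body_def)
    \<comment> \<open>The least positive letter of the word must be \<open>1 / 2\<close>. If it
      occurs in the ribbon, the joint entry is at most \<open>1 / 2\<close>; as the joint bounds the
      body, the node \<open>N\<close> then carries \<open>1 / 2\<close>.\<close>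
    have half: "\<exists>N'\<in>body l. T N' = 1 / 2"
    proof -
      define M where "M = {b \<in> set ?x. 0 < b}"
      have "finite M" unfolding M_def by (rule finite_subset[of _ "set ?x"]) auto
      moreover have "T N \<in> M" using pN N by (simp add: M_def set_reading)
      ultimately have M: "finite M" "T N \<in> M" .
      define c where "c = Min M"
      have c: "c \<in> M" "c \<le> T N" unfolding c_def using M by (auto intro: Min_in)
      have "c = 1 / 2"
      proof (rule ccontr)
        assume "c \<noteq> 1 / 2"
        then obtain y where "0 < y" "nxt y = c" "y \<in> set ?x" using hw_pos_pred[OF hw xw, of c] c by (auto simp: M_def)
        then have "c \<le> y" "y < c" unfolding c_def using M nxt_greater[of y] by (auto simp: M_def intro!: Min_le)
        then show False by simp
      qed
      then have "1 / 2 \<in> set ?x" using c(1) unfolding M_def by blast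
      then have "1 / 2 \<in> T ` body l \<or> 1 / 2 \<in> set r" by (simp only: set_append set_map set_reading Un_iff)
      then consider N' where "N' \<in> body l" "T N' = 1 / 2" | "1 / 2 \<in> set r" by fastforce
      then show ?thesis
      proof cases
        case 2
        then obtain p where p: "p < length r" "r ! p = 1 / 2" by (auto simp: in_set_conv_nth)
        have ne: "q \<noteq> []" using p T(3) by auto
        have "r ! hd q \<le> 1 / 2" using r_ge_hd[OF T(4,3) p(1)] p(2) by simp
        moreover have "T N \<le> r ! hd q" using T(5) ne N by (auto simp: asc_def)
        ultimately have "T N = 1 / 2" using pos_letter_ge[OF lett[OF N] pN] by simp
        then show ?thesis using N by blast
      qed blast
    qed
    \<comment> \<open>A \<open>-1\<close> has to be read before this \<open>1 / 2\<close>. By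
      \<open>low\<close> it sits in the last row, so it lies to the right of the
      \<open>1 / 2\<close> in that row, although it is smaller.\<close>
    then obtain i' c' where N': "(i', c') \<in> body l" "T (i', c') = 1 / 2" by (metis surj_pair)
    then obtain k where k: "k < length ?R" "?R ! k = (i', c')" "?x ! k = T (i', c')" using index by blast
    have one: "neg_letter m (m - 1) = -1" using m0 by (simp add: neg_letter_def of_nat_diff)
    have "-1 \<in> letters m" using neg_letter_letters[of "m - 1" m] m0 one by simp
    moreover have "nxt (-1) = 1 / 2" by (simp add: nxt_def)
    ultimately obtain p where p: "p < k" "?x ! p = -1" using hw_even_nth[OF hw, of "-1" k] k N' by auto
    obtain i c where N: "(i, c) \<in> body l" "?R ! p = (i, c)" "T (i, c) = -1"
      using node[of p] p k by (cases "?R ! p") auto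
    have "m - 1 \<le> i" using low[of "m - 1" i c] N m0 one by simp
    moreover have bb: "before (i, c) (i', c')" using bef[OF p(1) k(1)] k N by simp
    moreover have "i' < m" using N' length_l by (auto simp: body_def)
    ultimately have "i' = i" "c' < c" by (auto simp: before_def)
    then have "T (i', c') \<le> T (i, c)" using row[OF N(1), of c'] by simp
    then show False using N N' by simp
  qed
  obtain t where t: "t < m" "T (s, j) = neg_letter m t" using neg_letters_ex[OF lett[OF P] neg[OF P]] by blast
  have "t \<le> s" using low[OF t(1) P t(2)] .
  moreover have "neg_letter m s \<le> neg_letter m t" using col_lower[OF T(1) P] t by simp
  then have "s \<le> t" using neg_letter_less[of m t s] by (metis linorder_not_less)
  ultimately show ?thesis using t by simp
qed

text \<open>Suppose an entry exceeds the least value allowed. Its predecessor \<open>y\<close>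
  occurs in the word and can only be the preceding entry of the ribbon, with a repetition of
  \<open>y\<close> allowed. The highest weight condition asks for a \<open>y\<close> to the left of
  the entry (\<open>y\<close> even) or to the right (\<open>y\<close> odd), but all letters
  \<open>y\<close> stand on the other side.\<close>

lemma hw_ribbon:
  assumes hw: "is_hw m (map T (reading l) @ r)" and T: "body_tab m l T" "r \<in> words m" "length r = length q"
    "sorted_wrt (rk r) q" "q \<noteq> [] \<longrightarrow> (\<forall>P\<in>body l. asc (T P) (r ! hd q))"
    and t: "t < length q"
  shows "r ! (q ! t) = min_entry q t"
  using t
proof (induction t)
  let ?R = "reading l" and ?x = "map T (reading l) @ r"
  have neg: "b < 0" if "b \<in> set (map T ?R)" for b
  proof -
    have "b \<in> T ` body l" using that by (simp add: set_reading)
    then obtain s j where "(s, j) \<in> body l" "b = T (s, j)" by force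
    then show ?thesis using hw_body[OF hw T] neg_letter_neg length_l by (auto simp: body_def)
  qed
  have xw: "?x \<in> words m" using T by (auto simp: words_def body_tab_def simp flip: set_reading)
  have rw: "r ! p \<in> letters m \<and> 0 < r ! p \<and> r ! p \<in> set ?x" if "p < length q" for p
    using that T(2,3) r_pos[OF T] by (auto simp: words_def)
  have inr: "\<exists>t<length q. b = r ! (q ! t)" if "b \<in> set ?x" "0 < b" for b
  proof -
    have "b \<in> set r" using that neg[of b] by auto
    then show ?thesis using q_surj T(3) by (metis in_set_conv_nth)
  qed
  have inr': "k \<ge> length ?R \<and> (\<exists>t<length q. k = length ?R + q ! t \<and> r ! (q ! t) = ?x ! k)" if "k < length ?x" "0 < ?x ! k" for k
  proof -
    have "\<not> k < length ?R"
    proof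
      assume "k < length ?R"
      then have "?x ! k \<in> set (map T ?R)" by (simp add: nth_append)
      then show False using neg[of "?x ! k"] that by simp
    qed
    moreover then have "k - length ?R < length q" using that T(3) by simp
    then obtain t where "t < length q" "k - length ?R = q ! t" using q_surj by blast
    ultimately show ?thesis by (auto simp: nth_append intro!: exI[of _ t])
  qed
  {
    case 0
    let ?z = "r ! (q ! 0)"
    have z: "?z \<in> letters m" "0 < ?z" "?z \<in> set ?x" using rw[OF q_nth[OF 0]] by auto
    show ?case
    proof (rule ccontr)
      assume "?z \<noteq> min_entry q 0"
      then obtain y where y: "0 < y" "nxt y = ?z" "y \<in> set ?x" using hw_pos_pred[OF hw xw z(3,2)] by auto
      then obtain t where "t < length q" "y = r ! (q ! t)" using inr by blast
      then have "?z \<le> y" using r_mono[OF T(4), of 0 t] by simp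
      then show False using nxt_greater[of y] y by simp
    qed
  next
    case (Suc t)
    let ?z = "r ! (q ! Suc t)" and ?b = "min_entry q t" and ?c = "min_entry q (Suc t)"
    have IH: "r ! (q ! t) = ?b" using Suc by simp
    have z: "?z \<in> letters m" "0 < ?z" "?z \<in> set ?x" using rw[OF q_nth[OF Suc.prems]] by auto
    have rkt: "rk r (q ! t) (q ! Suc t)" using sorted_wrt_nth_less[OF T(4), of t "Suc t"] Suc.prems by simp
    have cz: "?c \<le> ?z" using min_entry_allowed[OF Suc.prems IH rkt z(1)] .
    show ?case
    proof (rule ccontr)
      assume "?z \<noteq> ?c"
      then have lt: "?c < ?z" using cz by simp
      have "1 / 2 \<le> ?c" using pos_letter_ge[OF min_entry_letters min_entry_pos] .
      then have "?z \<noteq> 1 / 2" using lt by simp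
      then obtain y where y: "y \<in> letters m" "0 < y" "nxt y = ?z" "y \<in> set ?x" using hw_pos_pred[OF hw xw z(3,2)] by auto
      have cy: "?c \<le> y"
      proof (rule ccontr)
        assume "\<not> ?c \<le> y"
        then have "nxt y \<le> ?c" using nxt_le[OF y(1) min_entry_letters, of q "Suc t"] by simp
        then show False using lt y by simp
      qed
      have yz: "y < ?z" using nxt_greater[of y] y by simp
      have bc: "?b \<le> ?c" using nxt_greater[of ?b] by auto
      have all: "u \<le> t" if "u < length q" "r ! (q ! u) = y" for u
      proof (rule ccontr)
        assume "\<not> u \<le> t"
        then show False using r_mono[OF T(4), of "Suc t" u] that yz by simp
      qed
      obtain u where u: "u < length q" "r ! (q ! u) = y" using inr[OF y(4,2)] by blast
      have "y \<le> ?b" using r_mono[OF T(4), of u t] all[OF u] u IH Suc.prems by simp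
      then have yb: "y = ?b" "?c = ?b" using bc cy by auto
      then have allow: "(q ! t < q ! Suc t) = (y \<notin> \<int>)" using nxt_greater[of ?b] by (simp split: if_splits)
      \<comment> \<open>Among the positions carrying \<open>y\<close>, \<open>q ! t\<close> comes
        last in the order: it is the leftmost one for even \<open>y\<close> and the rightmost one
        for odd \<open>y\<close>.\<close>
      have same: "if y \<in> \<int> then q ! t \<le> q ! u else q ! u \<le> q ! t" if "u < length q" "r ! (q ! u) = y" for u
      proof (cases "u = t")
        case False
        then have "rk r (q ! u) (q ! t)"
          using all[OF that] sorted_wrt_nth_less[OF T(4), of u t] Suc.prems by simp
        then show ?thesis using that IH yb by (auto simp: rk_def split: if_splits)
      qed simp
      let ?k = "length ?R + q ! Suc t"
      have k: "?k < length ?x" "?x ! ?k = nxt y" using q_nth[OF Suc.prems] T(3) y by (auto simp: nth_append)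
      have ny: "0 < nxt y" using y z by simp
      show False
      proof (cases "y \<in> \<int>")
        case True
        obtain p where p: "p < ?k" "?x ! p = y" using hw_even_nth[OF hw y(1) ny True k] by blast
        then obtain u where u: "u < length q" "p = length ?R + q ! u" "r ! (q ! u) = y"
          using inr'[of p] k y by (metis less_trans)
        then have "q ! t \<le> q ! u" using same[of u] True by simp
        moreover have "q ! Suc t < q ! t" using allow True q_neq[of t "Suc t"] Suc.prems by simp
        ultimately show False using p u by simp
      next
        case False
        obtain p where p: "?k < p" "p < length ?x" "?x ! p = y" using hw_odd_nth[OF hw y(1) ny False k] by blast
        then obtain u where u: "u < length q" "p = length ?R + q ! u" "r ! (q ! u) = y"
          using inr'[of p] y by metis
        then have "q ! u \<le> q ! t" using same[of u] False by simp
        moreover have "q ! t < q ! Suc t" using allow False by simp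
        ultimately show False using p u by simp
      qed
    qed
  }
qed

lemma hw_in_tableau_words:
  assumes "x \<in> tableau_words" "is_hw m x"
  shows "\<exists>r. x = map (\<lambda>P. neg_letter m (fst P)) (reading l) @ r \<and> length r = length q
    \<and> (\<forall>t<length q. r ! (q ! t) = min_entry q t)"
proof -
  obtain T r where T: "x = map T (reading l) @ r" "body_tab m l T" "r \<in> words m" "length r = length q"
    "sorted_wrt (rk r) q" "q \<noteq> [] \<longrightarrow> (\<forall>P\<in>body l. asc (T P) (r ! hd q))"
    using assms(1) unfolding tableau_words_def by blast
  note hw = assms(2)[unfolded T(1)]
  have "map T (reading l) = map (\<lambda>P. neg_letter m (fst P)) (reading l)"
    using hw_body[OF hw T(2-6)] by (auto simp: set_reading)
  then show ?thesis using T(1,4) hw_ribbon[OF hw T(2-6)] by auto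
qed

lemma hw_unique:
  assumes "x \<in> tableau_words" "is_hw m x" "y \<in> tableau_words" "is_hw m y"
  shows "x = y"
proof -
  obtain r where r: "x = map (\<lambda>P. neg_letter m (fst P)) (reading l) @ r" "length r = length q"
    "\<forall>t<length q. r ! (q ! t) = min_entry q t" using hw_in_tableau_words[OF assms(1,2)] by blast
  obtain r' where r': "y = map (\<lambda>P. neg_letter m (fst P)) (reading l) @ r'" "length r' = length q"
    "\<forall>t<length q. r' ! (q ! t) = min_entry q t" using hw_in_tableau_words[OF assms(3,4)] by blast
  have "r = r'"
  proof (rule nth_equalityI)
    fix p assume "p < length r"
    then obtain t where "t < length q" "p = q ! t" using q_surj r by metis
    then show "r ! p = r' ! p" using r r' by simp
  qed (use r r' in simp)
  then show ?thesis using r r' by simp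
qed

lemma component_tableau_words: "x \<in> tableau_words \<Longrightarrow> component m x = tableau_words"
  by (rule component_of_unique_hw[OF tableau_words_subset]) (use tableau_words_closed hw_unique in blast)+

end

section \<open>Ribbons\<close>

fun walk :: "nat \<times> nat \<Rightarrow> bool list \<Rightarrow> (nat \<times> nat) list" where
  "walk P [] = [P]"
| "walk P (d # ds) = P # walk (if d then (Suc (fst P), snd P) else (fst P, Suc (snd P))) ds"

fun comp_of_steps :: "bool list \<Rightarrow> nat list" where
  "comp_of_steps [] = [1]"
| "comp_of_steps (d # ds) = (if d then 1 # comp_of_steps ds
     else Suc (hd (comp_of_steps ds)) # tl (comp_of_steps ds))"

lemma comp_of_steps_nonempty: "comp_of_steps ds \<noteq> []"
  by (cases ds) auto

lemma comp_of_steps_pos: "x \<in> set (comp_of_steps ds) \<Longrightarrow> 0 < x"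
proof (induction ds arbitrary: x)
  case (Cons d ds)
  then show ?case using comp_of_steps_nonempty[of ds] by (cases "comp_of_steps ds") (auto split: if_splits)
qed auto

lemma comp_of_steps_surj: "a \<noteq> [] \<Longrightarrow> \<forall>x\<in>set a. 0 < x \<Longrightarrow> \<exists>ds. comp_of_steps ds = a"
proof (induction "sum_list a" arbitrary: a rule: less_induct)
  case less
  obtain x xs where a: "a = x # xs" using less.prems by (cases a) auto
  show ?case
  proof (cases "x = 1")
    case True
    show ?thesis
    proof (cases "xs = []")
      case True
      then show ?thesis using a \<open>x = 1\<close> by (intro exI[of _ "[]"]) simp
    next
      case False
      then obtain ds where "comp_of_steps ds = xs" using less.hyps[of xs] less.prems a by auto
      then show ?thesis using a \<open>x = 1\<close> by (intro exI[of _ "True # ds"]) simp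
    qed
  next
    case False
    then have "1 < x" using less.prems a by auto
    then obtain ds where "comp_of_steps ds = (x - 1) # xs" using less.hyps[of "(x - 1) # xs"] less.prems a by auto
    then show ?thesis using a \<open>1 < x\<close> by (intro exI[of _ "False # ds"]) simp
  qed
qed

lemma length_walk: "length (walk P ds) = Suc (length ds)"
  by (induction ds arbitrary: P) auto

lemma walk_0: "walk P ds ! 0 = P"
  by (cases ds) auto

lemma walk_Suc: "t < length ds \<Longrightarrow> walk P ds ! Suc t =
    (let N = walk P ds ! t in if ds ! t then (Suc (fst N), snd N) else (fst N, Suc (snd N)))"
proof (induction ds arbitrary: P t)
  case (Cons d ds)
  show ?case
  proof (cases t)
    case 0
    then show ?thesis by (simp add: walk_0 Let_def)
  next
    case (Suc t')
    then show ?thesis using Cons.IH[of t'] Cons.prems by simp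
  qed
qed simp

lemma ribbon_start_0: "ribbon_start a 0 = 0"
  by (simp add: ribbon_start_def)

lemma ribbon_start_Suc: "ribbon_start (x # a) (Suc k) = x - 1 + ribbon_start a k"
  unfolding ribbon_start_def by (simp add: sum.lessThan_Suc_shift del: sum.lessThan_Suc)

text \<open>The first node is arbitrary, as the induction along the walk requires.\<close>

definition ribbon_from :: "nat \<Rightarrow> nat \<Rightarrow> nat list \<Rightarrow> (nat \<times> nat) set" where
  "ribbon_from i j a = {(i + k, j + c) |k c. k < length a \<and> ribbon_start a k \<le> c \<and> c < ribbon_start a k + a ! k}"

lemma ribbon_from_Cons:
  "ribbon_from i j (x # a) = ({i} \<times> {j..<j + x}) \<union> ribbon_from (Suc i) (j + (x - 1)) a"
proof (intro equalityI subsetI)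
  fix P assume "P \<in> ribbon_from i j (x # a)"
  then obtain k c where k: "P = (i + k, j + c)" "k < Suc (length a)" "ribbon_start (x # a) k \<le> c"
    "c < ribbon_start (x # a) k + (x # a) ! k"
    unfolding ribbon_from_def by auto
  show "P \<in> ({i} \<times> {j..<j + x}) \<union> ribbon_from (Suc i) (j + (x - 1)) a"
  proof (cases k)
    case 0
    then show ?thesis using k by (simp add: ribbon_start_0)
  next
    case (Suc k')
    then show ?thesis using k unfolding ribbon_from_def
      by (intro UnI2 CollectI exI[of _ k'] exI[of _ "c - (x - 1)"]) (auto simp: ribbon_start_Suc)
  qed
next
  fix P assume "P \<in> ({i} \<times> {j..<j + x}) \<union> ribbon_from (Suc i) (j + (x - 1)) a"
  then show "P \<in> ribbon_from i j (x # a)"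
  proof
    assume "P \<in> {i} \<times> {j..<j + x}"
    then obtain c where "P = (i, c)" "j \<le> c" "c < j + x" by auto
    then show ?thesis unfolding ribbon_from_def
      by (intro CollectI exI[of _ 0] exI[of _ "c - j"]) (auto simp: ribbon_start_0)
  next
    assume "P \<in> ribbon_from (Suc i) (j + (x - 1)) a"
    then obtain k c where k: "P = (Suc i + k, j + (x - 1) + c)" "k < length a" "ribbon_start a k \<le> c"
      "c < ribbon_start a k + a ! k" unfolding ribbon_from_def by auto
    then show ?thesis unfolding ribbon_from_def
      by (intro CollectI exI[of _ "Suc k"] exI[of _ "x - 1 + c"]) (auto simp: ribbon_start_Suc)
  qed
qed

lemma set_walk: "set (walk (i, j) ds) = ribbon_from i j (comp_of_steps ds)"
proof (induction ds arbitrary: i j)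
  case Nil
  then show ?case by (auto simp: ribbon_from_Cons) (auto simp: ribbon_from_def)
next
  case (Cons d ds)
  show ?case
  proof (cases d)
    case True
    then show ?thesis using Cons by (auto simp: ribbon_from_Cons)
  next
    case False
    obtain x a where xa: "comp_of_steps ds = x # a" using comp_of_steps_nonempty by (cases "comp_of_steps ds") auto
    then have "0 < x" using comp_of_steps_pos[of x ds] by simp
    then show ?thesis using False Cons xa by (auto simp: ribbon_from_Cons)
  qed
qed

lemma ribbon_eq_walk: "ribbon m (comp_of_steps ds) = set (walk (m, 0) ds)"
  unfolding set_walk ribbon_def ribbon_from_def by auto

lemma ribbon_Nil: "ribbon m [] = {}"
  by (simp add: ribbon_def)

lemma walk_le:
  assumes "s \<le> t" "t \<le> length ds"
  shows "fst (walk P ds ! s) \<le> fst (walk P ds ! t) \<and> snd (walk P ds ! s) \<le> snd (walk P ds ! t)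
    \<and> fst (walk P ds ! t) + snd (walk P ds ! t) = fst (walk P ds ! s) + snd (walk P ds ! s) + (t - s)"
  using assms
proof (induction t)
  case (Suc t)
  show ?case
  proof (cases "s = Suc t")
    case False
    then have "s \<le> t" "t < length ds" using Suc.prems by auto
    then show ?thesis using Suc.IH walk_Suc[of t ds P] by (auto simp: Let_def)
  qed simp
qed simp

section \<open>Fillings of the diagram as words\<close>

lemma row_cond: "(x \<le> y \<and> (x \<notin> \<int> \<longrightarrow> x < y)) \<longleftrightarrow> \<not> asc y x"
  by (auto simp: asc_def)

lemma col_cond: "(x \<le> y \<and> (x \<in> \<int> \<longrightarrow> x < y)) \<longleftrightarrow> asc x y"
  by (auto simp: asc_def)

lemma asc_le_trans: "asc c b \<Longrightarrow> b \<le> d \<Longrightarrow> asc c d"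
  by (auto simp: asc_def)

lemma transp_rk: "transp (rk r)"
  unfolding transp_def rk_def by (auto split: if_splits)

definition steps_of :: "nat list \<Rightarrow> bool list" where
  "steps_of q = map (\<lambda>t. q ! t < q ! Suc t) [0..<length q - 1]"

definition comp_of :: "nat list \<Rightarrow> nat list" where
  "comp_of q = (if q = [] then [] else comp_of_steps (steps_of q))"

context arrangement
begin

definition N :: "nat \<Rightarrow> nat \<times> nat" where
  "N t = walk (m, 0) (steps_of q) ! t"

lemma N_nodes: "ribbon m (comp_of q) = N ` {..<length q}"
proof (cases "q = []")
  case True
  then show ?thesis by (simp add: comp_of_def ribbon_Nil)
next
  case False
  then have "Suc (length (steps_of q)) = length q" by (simp add: steps_of_def)
  then show ?thesis using False
    by (force simp: comp_of_def ribbon_eq_walk N_def in_set_conv_nth length_walk image_iff)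
qed

lemma N_0: "N 0 = (m, 0)"
  by (simp add: N_def walk_0)

lemma N_Suc: "Suc t < length q \<Longrightarrow> N (Suc t) = (if q ! t < q ! Suc t then (Suc (fst (N t)), snd (N t)) else (fst (N t), Suc (snd (N t))))"
  unfolding N_def using walk_Suc[of t "steps_of q" "(m, 0)"] by (simp add: steps_of_def Let_def)

lemma N_le:
  assumes "s \<le> t" "t < length q"
  shows "fst (N s) \<le> fst (N t)" "snd (N s) \<le> snd (N t)" "fst (N t) + snd (N t) = fst (N s) + snd (N s) + (t - s)"
  unfolding N_def using walk_le[of s t "steps_of q" "(m, 0)"] assms by (auto simp: steps_of_def)

lemma N_row: "t < length q \<Longrightarrow> m \<le> fst (N t)"
  using N_le(1)[of 0 t] by (simp add: N_0)

lemma N_inj: "inj_on N {..<length q}"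
proof (rule linorder_inj_onI)
  fix s t assume "s < t" "s \<in> {..<length q}" "t \<in> {..<length q}"
  then have "fst (N t) + snd (N t) = fst (N s) + snd (N s) + (t - s)" using N_le(3)[of s t] by simp
  then show "N s \<noteq> N t" using \<open>s < t\<close> by auto
qed auto

definition q_inv :: "nat \<Rightarrow> nat" where
  "q_inv p = (THE t. t < length q \<and> q ! t = p)"

lemma q_inv: "t < length q \<Longrightarrow> q_inv (q ! t) = t"
  unfolding q_inv_def using distinct_q by (auto simp: nth_eq_iff_index_eq)

text \<open>Letter \<open>p\<close> of the ribbon part belongs to node \<open>N (q_inv p)\<close>,
  since \<open>q\<close> lists positions in ribbon order. A filling \<open>T\<close> thus has the
  reading word \<open>map T nodes\<close>.\<close>

definition nodes :: "(nat \<times> nat) list" where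
  "nodes = reading l @ map (\<lambda>p. N (q_inv p)) [0..<length q]"

lemma q_inv_less: "p < length q \<Longrightarrow> q_inv p < length q \<and> q ! q_inv p = p"
  using q_surj[of p] q_inv by auto

lemma set_nodes: "set nodes = diagram l (comp_of q)"
proof -
  have "q_inv ` {0..<length q} = {..<length q}"
  proof (intro equalityI subsetI)
    fix t assume "t \<in> {..<length q}"
    then show "t \<in> q_inv ` {0..<length q}" using q_inv[of t] q_nth[of t] by (auto intro!: image_eqI[of _ _ "q ! t"])
  qed (auto simp: q_inv_less)
  then have "(\<lambda>p. N (q_inv p)) ` {0..<length q} = N ` {..<length q}" by (metis image_image)
  then show ?thesis by (simp add: nodes_def diagram_def set_reading length_l N_nodes)
qed

lemma distinct_nodes: "distinct nodes"
proof -
  have "inj_on (\<lambda>p. N (q_inv p)) {0..<length q}"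
  proof (rule inj_onI)
    fix p p' assume h: "p \<in> {0..<length q}" "p' \<in> {0..<length q}" "N (q_inv p) = N (q_inv p')"
    then have "q_inv p = q_inv p'" using N_inj q_inv_less by (auto dest: inj_onD)
    then show "p = p'" using h q_inv_less by (metis atLeastLessThan_iff)
  qed
  moreover have "P \<notin> set (reading l)" if "P \<in> (\<lambda>p. N (q_inv p)) ` {0..<length q}" for P
    using that N_row q_inv_less length_l by (force simp: set_reading body_def)
  ultimately show ?thesis unfolding nodes_def using distinct_reading by (auto simp: distinct_map)
qed

text \<open>Since \<open>rk\<close> is transitive, the ribbon conditions amount to comparing
  consecutive nodes, and an ascent of \<open>q\<close> is a step downwards. For a positive joint
  entry the two parity clauses of the joint condition merge into one statement with
  \<open>asc\<close>.\<close>

lemma tableau_iff: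
  assumes T: "T \<in> extensional (diagram l (comp_of q))"
  shows "T \<in> tableaux m l (comp_of q) \<longleftrightarrow> map T nodes \<in> tableau_words"
proof -
  let ?D = "diagram l (comp_of q)"
  define r where "r = map (\<lambda>p. T (N (q_inv p))) [0..<length q]"
  have D: "?D = body l \<union> N ` {..<length q}" by (simp add: diagram_def length_l N_nodes)
  have lr: "length r = length q" by (simp add: r_def)
  have rq: "r ! (q ! t) = T (N t)" if "t < length q" for t using that q_nth[OF that] by (simp add: r_def q_inv)
  have mapT: "map T nodes = map T (reading l) @ r" by (simp add: nodes_def r_def)
  have hdq: "r ! hd q = T (m, 0)" if "q \<noteq> []" using rq[of 0] that by (simp add: hd_conv_nth N_0)
  have ne: "comp_of q \<noteq> [] \<longleftrightarrow> q \<noteq> []" by (simp add: comp_of_def comp_of_steps_nonempty)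
  have bodyrow: "i < m" if "(i, j) \<in> body l" for i j using that length_l by (simp add: body_def)
  define letD where "letD \<longleftrightarrow> (\<forall>P\<in>?D. T P \<in> letters m)"
  define joint where "joint \<longleftrightarrow> (q \<noteq> [] \<longrightarrow> (T (m, 0) \<in> \<int> \<and> T (m, 0) > 0 \<longrightarrow> (\<forall>p\<in>body l. T p < T (m, 0)))
    \<and> (T (m, 0) \<notin> \<int> \<longrightarrow> (\<forall>p\<in>body l. T p \<le> T (m, 0))))"
  have PiE_letD: "T \<in> ?D \<rightarrow>\<^sub>E letters m \<longleftrightarrow> letD"
    using T unfolding letD_def PiE_iff by blast
  have tab: "T \<in> tableaux m l (comp_of q) \<longleftrightarrow> letD
    \<and> (\<forall>i j j'. (i, j) \<in> ?D \<and> (i, j') \<in> ?D \<and> j < j' \<longrightarrow> \<not> asc (T (i, j')) (T (i, j)))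
    \<and> (\<forall>i i' j. (i, j) \<in> ?D \<and> (i', j) \<in> ?D \<and> i < i' \<longrightarrow> asc (T (i, j)) (T (i', j))) \<and> joint"
    unfolding tableaux_def mem_Collect_eq row_cond col_cond ne joint_def Let_def PiE_letD by (rule refl)
  have rwords: "r \<in> words m" if letD
  proof -
    have "r ! p \<in> letters m" if "p < length q" for p
      using that \<open>letD\<close> q_inv_less[OF that] unfolding letD_def D r_def by auto
    then show ?thesis using lr by (auto simp: words_def in_set_conv_nth)
  qed
  show ?thesis
  proof
    assume "T \<in> tableaux m l (comp_of q)"
    note h = this[unfolded tab]
    have letD: letD using h by blast
    have row: "\<not> asc (T (i, j')) (T (i, j))" if "(i, j) \<in> ?D" "(i, j') \<in> ?D" "j < j'" for i j j' using h that by blast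
    have col: "asc (T (i, j)) (T (i', j))" if "(i, j) \<in> ?D" "(i', j) \<in> ?D" "i < i'" for i i' j using h that by blast
    have bt: "body_tab m l T"
      unfolding body_tab_def
    proof (intro conjI ballI allI impI)
      show "T P \<in> letters m" if "P \<in> body l" for P using that letD unfolding letD_def D by blast
      show "\<not> asc (T (s, j')) (T (s, j))" if "(s, j') \<in> body l" "j < j'" for s j j'
        using row[of s j j'] that body_left[of s j' j] unfolding D by auto
      show "asc (T (i, j)) (T (i', j))" if "(i', j) \<in> body l" "i < i'" for i i' j
        using col[of i j i'] that body_up[of i' j i] unfolding D by auto
    qed
    have "sorted_wrt (rk r) q"
      unfolding sorted_wrt_iff_nth_Suc_transp[OF transp_rk]
    proof (intro allI impI)
      fix t assume t: "Suc t < length q"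
      have in_D: "N t \<in> ?D" "N (Suc t) \<in> ?D" using t unfolding D by auto
      have neq: "q ! t \<noteq> q ! Suc t" using q_neq[of t "Suc t"] t by simp
      show "rk r (q ! t) (q ! Suc t)"
      proof (cases "q ! t < q ! Suc t")
        case True
        then have "N (Suc t) = (Suc (fst (N t)), snd (N t))" using N_Suc[OF t] by simp
        then have "asc (T (N t)) (T (N (Suc t)))" using col[of "fst (N t)" "snd (N t)" "Suc (fst (N t))"] in_D by simp
        then show ?thesis using True neq rq t by (simp add: rk_iff_asc)
      next
        case False
        then have "N (Suc t) = (fst (N t), Suc (snd (N t)))" using N_Suc[OF t] by simp
        then have "\<not> asc (T (N (Suc t))) (T (N t))" using row[of "fst (N t)" "snd (N t)" "Suc (snd (N t))"] in_D by simp
        then show ?thesis using False neq rq t by (simp add: rk_iff_asc)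
      qed
    qed
    \<comment> \<open>The joint condition on fillings is silent about a negative joint entry. The
      first column of the body lies above the joint and forces a positive entry there.\<close>
    moreover have "asc (T P) (r ! hd q)" if P: "q \<noteq> []" "P \<in> body l" for P
    proof -
      let ?b = "T (m, 0)"
      have in_D: "(m, 0) \<in> ?D" using P(1) N_0 unfolding D by (metis UnI2 image_eqI length_greater_0_conv lessThan_iff)
      have m0: "m \<noteq> 0" using P(2) length_l by (auto simp: body_def)
      then have b1: "(m - 1, 0) \<in> body l" using full[OF P(1)] length_l by (simp add: body_def)
      have "neg_letter m (m - 1) \<le> T (m - 1, 0)" using col_lower[OF bt b1] .
      moreover have "asc (T (m - 1, 0)) ?b" using col[of "m - 1" 0 m] b1 in_D m0 unfolding D by auto
      ultimately have "neg_letter m (m - 1) < ?b" by (rule asc_int_less[OF neg_letter_Ints])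
      then have b: "-1 < ?b" using m0 by (simp add: neg_letter_def of_nat_diff)
      have "?b \<in> letters m" using letD in_D by (simp add: letD_def)
      from this b have "0 < ?b" by (cases rule: letters_cases) auto
      moreover have joint using h by blast
      ultimately show ?thesis unfolding joint_def hdq[OF P(1)] asc_def using P by (metis le_less)
    qed
    ultimately show "map T nodes \<in> tableau_words" unfolding tableau_words_def mapT using bt rwords[OF letD] lr by blast
  next
    assume "map T nodes \<in> tableau_words"
    then obtain T0 r0 where "map T nodes = map T0 (reading l) @ r0" and T0: "body_tab m l T0" "r0 \<in> words m"
      "length r0 = length q" "sorted_wrt (rk r0) q" "q \<noteq> [] \<longrightarrow> (\<forall>P\<in>body l. asc (T0 P) (r0 ! hd q))"
      unfolding tableau_words_def by blast
    then have "map T (reading l) = map T0 (reading l)" "r = r0" unfolding mapT by auto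
    then have eq: "T P = T0 P" if "P \<in> body l" for P using that by (auto simp: set_reading)
    note tableau_words = T0[folded \<open>r = r0\<close>]
    have bt: "body_tab m l T"
      unfolding body_tab_def
    proof (intro conjI ballI allI impI)
      show "T P \<in> letters m" if "P \<in> body l" for P
        using tableau_words(1) eq[OF that] that unfolding body_tab_def by simp
      show "\<not> asc (T (s, j')) (T (s, j))" if "(s, j') \<in> body l" "j < j'" for s j j'
        using tableau_words(1) eq[of "(s, j')"] eq[of "(s, j)"] that body_left[of s j' j] unfolding body_tab_def by auto
      show "asc (T (i, j)) (T (i', j))" if "(i', j) \<in> body l" "i < i'" for i i' j
        using tableau_words(1) eq[of "(i, j)"] eq[of "(i', j)"] that body_up[of i' j i] unfolding body_tab_def by auto
    qed
    have asc_hd: "asc (T P) (T (m, 0))" if "q \<noteq> []" "P \<in> body l" for P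
      using tableau_words(5) that hdq eq by simp
    have mono: "T (N s) \<le> T (N t)" if "s \<le> t" "t < length q" for s t
      using r_mono[OF tableau_words(4) that] rq that by simp
    have ge_hd: "T (m, 0) \<le> T (N t)" if "t < length q" for t using mono[of 0 t] that by (simp add: N_0)
    have rkN: "rk r (q ! t) (q ! Suc t)" if "Suc t < length q" for t
      using sorted_wrt_nth_less[OF tableau_words(4), of t "Suc t"] that by simp
    have letD: letD
      unfolding letD_def D
    proof
      fix P assume "P \<in> body l \<union> N ` {..<length q}"
      then show "T P \<in> letters m"
      proof
        assume "P \<in> N ` {..<length q}"
        then obtain t where t: "t < length q" "P = N t" by auto
        then have "T P \<in> set r" using rq[OF t(1)] q_nth[OF t(1)] lr by (metis nth_mem)
        then show ?thesis using tableau_words(2) by (auto simp: words_def)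
      qed (use bt in \<open>auto simp: body_tab_def\<close>)
    qed
    have inbody: "P \<in> body l" if P: "P \<in> ?D" "fst P < m" for P
    proof (rule ccontr)
      assume "P \<notin> body l"
      then obtain t where "t < length q" "P = N t" using P(1) unfolding D by blast
      then show False using N_row[of t] P(2) by simp
    qed
    have inrib: "\<exists>t<length q. N t = P" if P: "P \<in> ?D" "\<not> fst P < m" for P
    proof -
      have "P \<notin> body l" using bodyrow[of "fst P" "snd P"] P(2) by auto
      then show ?thesis using P(1) unfolding D by blast
    qed
    have row: "\<not> asc (T (i, j')) (T (i, j))" if hh: "(i, j) \<in> ?D" "(i, j') \<in> ?D" "j < j'" for i j j'
    proof (cases "i < m")
      case True
      then have "(i, j') \<in> body l" using inbody[OF hh(2)] by simp
      then show ?thesis using bt hh(3) by (simp add: body_tab_def)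
    next
      case False
      then obtain t t' where t: "t < length q" "t' < length q" "N t = (i, j)" "N t' = (i, j')"
        using inrib[OF hh(1)] inrib[OF hh(2)] by auto
      have tt: "t < t'"
      proof (rule ccontr)
        assume "\<not> t < t'"
        then show False using N_le(2)[of t' t] t hh(3) by simp
      qed
      \<comment> \<open>Both nodes lie in row \<open>i\<close>, so the step after \<open>t\<close>
        goes to the right. Strictness at this step and weak growth along the ribbon settle nodes
        that are not adjacent.\<close>
      have "fst (N (Suc t)) \<le> i" using N_le(1)[of "Suc t" t'] tt t by simp
      then have "\<not> q ! t < q ! Suc t" using N_Suc[of t] tt t by (auto split: if_splits)
      then have "T (N t) \<noteq> T (N (Suc t)) \<or> T (N t) \<in> \<int>" using rkN[of t] tt t rq by (auto simp: rk_def split: if_splits)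
      moreover have "T (N t) \<le> T (N (Suc t))" "T (N (Suc t)) \<le> T (N t')" using mono[of t "Suc t"] mono[of "Suc t" t'] tt t by auto
      ultimately show ?thesis using t by (auto simp: asc_def)
    qed
    have col: "asc (T (i, j)) (T (i', j))" if hh: "(i, j) \<in> ?D" "(i', j) \<in> ?D" "i < i'" for i i' j
    proof (cases "i' < m")
      case True
      then have "(i', j) \<in> body l" using inbody[OF hh(2)] by simp
      then show ?thesis using bt hh(3) by (simp add: body_tab_def)
    next
      case i': False
      then obtain t' where t': "t' < length q" "N t' = (i', j)"
        using inrib[OF hh(2)] by auto
      have ne: "q \<noteq> []" using t' by auto
      show ?thesis
      proof (cases "i < m")
        case True
        then have "(i, j) \<in> body l" using inbody[OF hh(1)] by simp
        then show ?thesis using asc_le_trans[OF asc_hd[OF ne] ge_hd[OF t'(1)]] t' by simp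
      next
        case False
        then obtain t where t: "t < length q" "N t = (i, j)"
          using inrib[OF hh(1)] by auto
        have tt: "t < t'"
        proof (rule ccontr)
          assume "\<not> t < t'"
          then show False using N_le(1)[of t' t] t t' hh(3) by simp
        qed
        have "snd (N (Suc t)) \<le> j" using N_le(2)[of "Suc t" t'] tt t' by simp
        then have "q ! t < q ! Suc t" using N_Suc[of t] tt t t' by (auto split: if_splits)
        then have "T (N t) \<noteq> T (N (Suc t)) \<or> T (N t) \<notin> \<int>" using rkN[of t] tt t t' rq by (auto simp: rk_def split: if_splits)
        moreover have "T (N t) \<le> T (N (Suc t))" "T (N (Suc t)) \<le> T (N t')" using mono[of t "Suc t"] mono[of "Suc t" t'] tt t' by auto
        ultimately have "asc (T (N t)) (T (N t'))"
          by (cases "T (N t) = T (N t')") (auto simp: asc_def)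
        then show ?thesis using t t' by simp
      qed
    qed
    have "T P \<le> T (m, 0) \<and> (T (m, 0) \<in> \<int> \<longrightarrow> T P < T (m, 0))" if "q \<noteq> []" "P \<in> body l" for P
      using asc_hd[OF that] unfolding asc_def by auto
    then have joint unfolding joint_def by blast
    then show "T \<in> tableaux m l (comp_of q)" unfolding tab using letD row col by blast
  qed
qed

lemma ch_tableaux_tableau_words: "ch_tableaux m (l, comp_of q) = character tableau_words wt"
proof -
  let ?D = "diagram l (comp_of q)" and ?T = "tableaux m l (comp_of q)"
  let ?g = "\<lambda>T. map T nodes"
  have ext: "T \<in> extensional ?D" if "T \<in> ?T" for T using that by (auto simp: tableaux_def PiE_def)
  have inj: "inj_on ?g ?T"
  proof (rule inj_onI)
    fix T T' assume h: "T \<in> ?T" "T' \<in> ?T" "?g T = ?g T'"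
    then have "T P = T' P" if "P \<in> ?D" for P using that set_nodes by auto
    then show "T = T'" using extensionalityI ext h by blast
  qed
  have "?g ` ?T = tableau_words"
  proof (intro equalityI subsetI)
    fix x assume "x \<in> ?g ` ?T"
    then show "x \<in> tableau_words" using tableau_iff ext by auto
  next
    fix x assume x: "x \<in> tableau_words"
    then have "length x = length nodes" by (auto simp: tableau_words_def nodes_def)
    then obtain T where T: "map T nodes = x" using map_distinct_ex[OF distinct_nodes] by blast
    then have "map (restrict T ?D) nodes = x" using set_nodes by auto
    moreover have "restrict T ?D \<in> ?T" using tableau_iff[of "restrict T ?D"] calculation x by simp
    ultimately show "x \<in> ?g ` ?T" by blast
  qed
  moreover have "wt (?g T) = content ?D T" for T
    unfolding wt_def content_def set_nodes[symmetric]
    by (simp add: sum.distinct_set_conv_list[OF distinct_nodes] o_def)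
  ultimately show ?thesis
    using character_reindex[OF inj, of wt "content ?D"] unfolding ch_tableaux_def by simp
qed

end

section \<open>Linear independence\<close>

context arrangement
begin

definition top_word :: word where
  "top_word = map (\<lambda>P. neg_letter m (fst P)) (reading l) @ map (\<lambda>p. min_entry q (q_inv p)) [0..<length q]"

lemma rows_in_tableau_words:
  assumes "r \<in> words m" "length r = length q" "sorted_wrt (rk r) q" "\<forall>b\<in>set r. 0 < b"
  shows "map (\<lambda>P. neg_letter m (fst P)) (reading l) @ r \<in> tableau_words"
proof -
  let ?T = "\<lambda>P. neg_letter m (fst P)"
  have "body_tab m l ?T"
    unfolding body_tab_def using length_l
    by (auto simp: body_def neg_letter_letters asc_def neg_letter_Ints neg_letter_less)
  moreover have "asc (?T P) (r ! hd q)" if "q \<noteq> []" "P \<in> body l" for P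
  proof -
    have "hd q < length r" using that set_q assms(2) by (metis hd_in_set lessThan_iff)
    then have "0 < r ! hd q" using assms(4) by simp
    moreover have "?T P < 0" using that length_l by (auto simp: body_def neg_letter_neg)
    ultimately show ?thesis by (simp add: asc_def)
  qed
  ultimately show ?thesis unfolding tableau_words_def using assms by blast
qed

lemma top_word_in_tableau_words: "top_word \<in> tableau_words"
  unfolding top_word_def
proof (rule rows_in_tableau_words)
  let ?r = "map (\<lambda>p. min_entry q (q_inv p)) [0..<length q]"
  have rq: "?r ! (q ! t) = min_entry q t" if "t < length q" for t using that q_nth[OF that] by (simp add: q_inv)
  show "?r \<in> words m" by (auto simp: words_def min_entry_letters)
  show "sorted_wrt (rk ?r) q"
    unfolding sorted_wrt_iff_nth_Suc_transp[OF transp_rk]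
  proof (intro allI impI)
    fix t assume t: "Suc t < length q"
    have "q ! t \<noteq> q ! Suc t" using q_neq[of t "Suc t"] t by simp
    then show "rk ?r (q ! t) (q ! Suc t)"
      unfolding rk_def using rq[of t] rq[of "Suc t"] t nxt_greater[of "min_entry q t"] by auto
  qed
qed (auto simp: min_entry_pos)

lemma hw_eq_top_word:
  assumes "x \<in> tableau_words" "is_hw m x"
  shows "x = top_word"
proof -
  obtain r where r: "x = map (\<lambda>P. neg_letter m (fst P)) (reading l) @ r" "length r = length q"
    "\<forall>t<length q. r ! (q ! t) = min_entry q t" using hw_in_tableau_words[OF assms] by blast
  have "r = map (\<lambda>p. min_entry q (q_inv p)) [0..<length q]"
  proof (rule nth_equalityI)
    fix p assume "p < length r"
    then obtain t where "t < length q" "p = q ! t" using q_surj r by metis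
    then show "r ! p = map (\<lambda>p. min_entry q (q_inv p)) [0..<length q] ! p"
      using r q_nth by (simp add: q_inv)
  qed (use r in simp)
  then show ?thesis using r by (simp add: top_word_def)
qed

text \<open>Following arrows backwards lowers the height and can only end in a highest weight word,
  of which there is just one.\<close>

lemma height_top_word: "x \<in> tableau_words \<Longrightarrow> x \<noteq> top_word \<Longrightarrow> height m top_word < height m x"
proof (induction "height m x" arbitrary: x rule: less_induct)
  case less
  then have "\<not> is_hw m x" using hw_eq_top_word by blast
  then obtain y where y: "step m y x" by (auto simp: is_hw_def)
  then have "y \<in> tableau_words" using tableau_words_closed less.prems by blast
  then show ?case using less.hyps[OF step_height[OF y]] step_height[OF y] by (cases "y = top_word") auto
qed

lemma ch_tableaux_component:
  assumes "x \<in> tableau_words"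
  shows "ch_tableaux m (l, comp_of q) = ch_component m x"
  unfolding ch_tableaux_tableau_words ch_component_def component_tableau_words[OF assms] ..

lemma top_word_words: "top_word \<in> words m"
  using top_word_in_tableau_words tableau_words_subset by blast

lemma count_top_word: "s < m \<Longrightarrow> count_list top_word (neg_letter m s) = l ! s"
proof -
  assume s: "s < m"
  have "count_list (map (\<lambda>P. neg_letter m (fst P)) (rows_between l 0 n)) (neg_letter m s) = (if s < n then l ! s else 0)" for n
  proof (induction n)
    case 0
    then show ?case by (simp add: rows_between_def)
  next
    case (Suc n)
    have "map (\<lambda>P. neg_letter m (fst P)) (row_nodes l n) = replicate (l ! n) (neg_letter m n)"
      by (simp add: row_nodes_def o_def map_replicate_const)
    then have "count_list (map (\<lambda>P. neg_letter m (fst P)) (row_nodes l n)) (neg_letter m s) = (if s = n then l ! n else 0)"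
      by (simp add: count_list_replicate neg_letter_eq)
    then show ?case using Suc by (auto simp: rows_between_def)
  qed
  moreover have "neg_letter m s \<notin> set (map (\<lambda>p. min_entry q (q_inv p)) [0..<length q])"
    using neg_letter_neg[OF s] min_entry_pos[of q] by (auto dest: sym) (metis order_less_asym)
  then have "count_list (map (\<lambda>p. min_entry q (q_inv p)) [0..<length q]) (neg_letter m s) = 0"
    unfolding count_list_0_iff .
  ultimately show ?thesis using s by (simp add: top_word_def reading_def length_l)
qed

lemma pos_part_top_word:
  "mset (filter (\<lambda>b. 0 < b) top_word) = mset (map (min_entry q) [0..<length q])"
proof -
  have "filter (\<lambda>b. 0 < b) (map (\<lambda>P. neg_letter m (fst P)) (reading l)) = []"
    using neg_letter_neg length_l by (auto simp: filter_empty_conv set_reading body_def dest: less_asym)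
  moreover have "filter (\<lambda>b. 0 < b) (map (\<lambda>p. min_entry q (q_inv p)) [0..<length q]) = map (\<lambda>p. min_entry q (q_inv p)) [0..<length q]"
    by (auto simp: filter_id_conv min_entry_pos)
  moreover have "mset (map (\<lambda>p. min_entry q (q_inv p)) [0..<length q]) = mset (map (\<lambda>p. min_entry q (q_inv p)) q)"
  proof -
    have "mset [0..<length q] = mset q"
      using distinct_q set_q by (intro set_eq_iff_mset_eq_distinct[THEN iffD1]) (auto simp: atLeast0LessThan)
    then show ?thesis by simp
  qed
  moreover have "map (\<lambda>p. min_entry q (q_inv p)) q = map (min_entry q) [0..<length q]"
    by (rule nth_equalityI) (auto simp: q_inv)
  ultimately show ?thesis by (simp add: top_word_def)
qed

end

section \<open>Recovering the shape from the content of the top word\<close>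

lemma min_entry_mono: "s \<le> t \<Longrightarrow> min_entry q s \<le> min_entry q t"
proof (induction t)
  case (Suc t)
  have "min_entry q t \<le> min_entry q (Suc t)" using nxt_greater[of "min_entry q t"] by auto
  then show ?case using Suc by (cases "s = Suc t") auto
qed simp

text \<open>Exactly one direction allows a given letter to be repeated, so the direction can be read
  off from the parity and from whether a repetition took place.\<close>

lemma step_from_min_entry:
  "q ! t < q ! Suc t \<longleftrightarrow> (min_entry q (Suc t) = min_entry q t) = (min_entry q t \<notin> \<int>)"
  using nxt_greater[of "min_entry q t"] by auto

text \<open>The negative letters count the nodes in the rows of the body. Sorting the positive
  letters recovers the minimal ribbon entries in ribbon order, and these reveal the steps.\<close>

lemma top_word_inj:
  assumes A: "arrangement m l q" and A': "arrangement m l' q'"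
    and h: "mset (arrangement.top_word m l q) = mset (arrangement.top_word m l' q')"
  shows "l = l' \<and> comp_of q = comp_of q'"
proof
  have "count_list (arrangement.top_word m l q) b = count_list (arrangement.top_word m l' q') b" for b
    using h unfolding mset_eq_count_list by (rule spec)
  then have "l ! s = l' ! s" if "s < m" for s
    using arrangement.count_top_word[OF A that] arrangement.count_top_word[OF A' that] by metis
  then show "l = l'" using A A' by (intro nth_equalityI) (auto simp: arrangement_def)
  have "mset (map (min_entry q) [0..<length q]) = mset (map (min_entry q') [0..<length q'])"
    using h arrangement.pos_part_top_word[OF A] arrangement.pos_part_top_word[OF A'] by (metis mset_filter)
  note ms = this
  have so: "sorted (map (min_entry q) [0..<length q])" for q
    by (auto simp: sorted_iff_nth_mono min_entry_mono)
  have e: "map (min_entry q) [0..<length q] = map (min_entry q') [0..<length q']"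
    using properties_for_sort[OF ms so] properties_for_sort[OF refl so, of q'] by (rule trans[OF sym])
  then have len: "length q = length q'" by (metis diff_zero length_map length_upt)
  have "min_entry q t = min_entry q' t" if "t < length q" for t
    using arg_cong[OF e, of "\<lambda>w. w ! t"] that len by simp
  then have "steps_of q = steps_of q'"
    unfolding steps_of_def using len by (auto simp: step_from_min_entry simp del: min_entry.simps)
  then show "comp_of q = comp_of q'" using len by (auto simp: comp_of_def)
qed

lemma steps_of_Cons: "steps_of (x # y # ys) = (x < y) # steps_of (y # ys)"
proof -
  have "[0..<length (x # y # ys) - 1] = 0 # map Suc [0..<length (y # ys) - 1]"
    by (simp add: upt_conv_Cons map_Suc_upt del: upt_Suc)
  then show ?thesis by (simp add: steps_of_def)
qed

lemma steps_of_map_Suc: "steps_of (map Suc q) = steps_of q"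
  by (auto simp: steps_of_def)

text \<open>A new first entry below or above all others realises the first step and keeps the
  remaining ones.\<close>

lemma perm_of_steps: "\<exists>q. distinct q \<and> set q = {..<length q} \<and> q \<noteq> [] \<and> steps_of q = ds"
proof (induction ds)
  case Nil
  show ?case by (intro exI[of _ "[0]"]) (auto simp: steps_of_def)
next
  case (Cons d ds)
  then obtain q where q: "distinct q" "set q = {..<length q}" "q \<noteq> []" "steps_of q = ds" by blast
  obtain y ys where y: "q = y # ys" using q(3) by (cases q) auto
  show ?case
  proof (cases d)
    case True
    have "steps_of (0 # map Suc q) = d # ds"
      using steps_of_Cons[of 0 "Suc y" "map Suc ys"] steps_of_map_Suc[of q] q(4) True y by simp
    moreover have "distinct (0 # map Suc q)" using q(1) by (simp add: distinct_map)
    moreover have "set (0 # map Suc q) = {..<length (0 # map Suc q)}"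
      using q(2) by (simp add: lessThan_Suc_eq_insert_0)
    ultimately show ?thesis by blast
  next
    case False
    have "y < length q" using q(2) y by (metis lessThan_iff list.set_intros(1))
    then have "steps_of (length q # q) = d # ds"
      using steps_of_Cons[of "length q" y ys] q(4) False y by simp
    moreover have "distinct (length q # q)" using q(1,2) by simp
    moreover have "set (length q # q) = {..<length (length q # q)}"
      using q(2) by (simp add: lessThan_Suc)
    ultimately show ?thesis by blast
  qed
qed

lemma shape_arrangement:
  assumes "(l, a) \<in> shapes m"
  shows "\<exists>q. arrangement m l q \<and> comp_of q = a"
proof (cases "a = []")
  case True
  have "arrangement m l []" using assms by unfold_locales (auto simp: shapes_def)
  then show ?thesis using True by (auto simp: comp_of_def)
next
  case False
  have "\<forall>x\<in>set a. 0 < x" using assms by (auto simp: shapes_def)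
  then obtain ds where ds: "comp_of_steps ds = a" using comp_of_steps_surj[OF False] by blast
  obtain q where q: "distinct q" "set q = {..<length q}" "q \<noteq> []" "steps_of q = ds" using perm_of_steps by blast
  then have "arrangement m l q" using assms False by unfold_locales (auto simp: shapes_def)
  then show ?thesis using q ds by (auto simp: comp_of_def)
qed

lemma arrangement_shape: "arrangement m l q \<Longrightarrow> (l, comp_of q) \<in> shapes m"
  using comp_of_steps_pos by (auto simp: arrangement_def shapes_def comp_of_def)

section \<open>Unitriangularity with respect to the height\<close>

lemma coeff_scale: "coeff (of_int k * f) \<mu> = k * coeff f \<mu>"
proof -
  have nat: "coeff (of_nat n * f) \<mu> = int n * coeff f \<mu>" for n
    by (induction n) (simp_all add: zero_series.rep_eq plus_series.rep_eq algebra_simps)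
  show ?thesis
  proof (cases k)
    case (nonneg n)
    then show ?thesis using nat by simp
  next
    case (neg n)
    have "(of_int k * f :: 'a series) = - (of_nat (Suc n) * f)" unfolding neg by (simp add: algebra_simps)
    then show ?thesis using nat[of "Suc n"] unfolding neg by (simp only: uminus_series.rep_eq mult_minus_left)
  qed
qed

text \<open>A permutation with the given composition has to be picked, because the diagram does not
  single one out.\<close>

definition lead :: "nat \<Rightarrow> nat list \<times> nat list \<Rightarrow> word" where
  "lead m \<sigma> = arrangement.top_word m (fst \<sigma>) (SOME q. arrangement m (fst \<sigma>) q \<and> comp_of q = snd \<sigma>)"

lemma lead_props:
  assumes "\<sigma> \<in> shapes m"
  obtains q where "arrangement m (fst \<sigma>) q" "comp_of q = snd \<sigma>" "lead m \<sigma> = arrangement.top_word m (fst \<sigma>) q"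
  using shape_arrangement[of "fst \<sigma>" "snd \<sigma>" m] assms unfolding lead_def
  by (metis (mono_tags, lifting) prod.collapse someI_ex)

lemma ch_tableaux_lead:
  assumes "\<sigma> \<in> shapes m"
  shows "lead m \<sigma> \<in> words m" "ch_tableaux m \<sigma> = ch_component m (lead m \<sigma>)"
    and "x \<in> component m (lead m \<sigma>) \<Longrightarrow> x \<noteq> lead m \<sigma> \<Longrightarrow> height m (lead m \<sigma>) < height m x"
proof -
  obtain q where q: "arrangement m (fst \<sigma>) q" "comp_of q = snd \<sigma>" "lead m \<sigma> = arrangement.top_word m (fst \<sigma>) q"
    using lead_props[OF assms] by blast
  note tableau_words = arrangement.top_word_in_tableau_words[OF q(1)]
  show "lead m \<sigma> \<in> words m" using arrangement.top_word_words[OF q(1)] q(3) by simp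
  show "ch_tableaux m \<sigma> = ch_component m (lead m \<sigma>)"
    using arrangement.ch_tableaux_component[OF q(1) tableau_words] q by simp
  show "height m (lead m \<sigma>) < height m x" if "x \<in> component m (lead m \<sigma>)" "x \<noteq> lead m \<sigma>"
    using that arrangement.component_tableau_words[OF q(1) tableau_words] arrangement.height_top_word[OF q(1)] q(3) by simp
qed

lemma lead_inj:
  assumes "\<sigma> \<in> shapes m" "\<tau> \<in> shapes m" "mset (lead m \<sigma>) = mset (lead m \<tau>)"
  shows "\<sigma> = \<tau>"
proof -
  obtain q where q: "arrangement m (fst \<sigma>) q" "comp_of q = snd \<sigma>" "lead m \<sigma> = arrangement.top_word m (fst \<sigma>) q"
    using lead_props[OF assms(1)] by blast
  obtain q' where q': "arrangement m (fst \<tau>) q'" "comp_of q' = snd \<tau>" "lead m \<tau> = arrangement.top_word m (fst \<tau>) q'"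
    using lead_props[OF assms(2)] by blast
  show ?thesis using top_word_inj[OF q(1) q'(1)] q q' assms(3) by (simp add: prod_eq_iff)
qed

text \<open>A word with the content of \<open>lead m \<tau>\<close> has height at most that of
  \<open>lead m \<sigma>\<close>. In the component of \<open>lead m \<sigma>\<close> only this word
  itself is so low, and then equality of contents gives equality of shapes.\<close>

lemma coeff_lead:
  assumes "\<sigma> \<in> shapes m" "\<tau> \<in> shapes m" "height m (lead m \<tau>) \<le> height m (lead m \<sigma>)"
  shows "coeff (ch_tableaux m \<sigma>) (wt (lead m \<tau>)) = (if \<sigma> = \<tau> then 1 else 0)"
proof -
  let ?A = "{x \<in> component m (lead m \<sigma>). wt x = (wt (lead m \<tau>) :: rat \<Rightarrow>\<^sub>0 nat)}"
  have "x = lead m \<sigma> \<and> \<sigma> = \<tau>" if "x \<in> ?A" for x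
  proof -
    have ms: "mset x = mset (lead m \<tau>)" using that by (simp add: wt_eq_iff)
    then have "\<not> height m (lead m \<sigma>) < height m x" using assms(3) height_mset[OF ms, of m] by simp
    then have "x = lead m \<sigma>" using ch_tableaux_lead(3)[OF assms(1)] that by blast
    then show ?thesis using lead_inj[OF assms(1,2)] ms by simp
  qed
  then have "?A = (if \<sigma> = \<tau> then {lead m \<sigma>} else {})" by (auto simp: component_self)
  then show ?thesis unfolding ch_tableaux_lead(2)[OF assms(1)] ch_component_def coeff_character by simp
qed

lemma ch_tableaux_inj: "inj_on (ch_tableaux m) (shapes m)"
proof (rule inj_onI)
  fix \<sigma> \<tau> assume s: "\<sigma> \<in> shapes m" "\<tau> \<in> shapes m" "ch_tableaux m \<sigma> = ch_tableaux m \<tau>"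
  have *: "\<sigma> = \<tau>" if "\<sigma> \<in> shapes m" "\<tau> \<in> shapes m" "ch_tableaux m \<sigma> = ch_tableaux m \<tau>"
    "height m (lead m \<tau>) \<le> height m (lead m \<sigma>)" for \<sigma> \<tau>
    using coeff_lead[OF that(1,2,4)] coeff_lead[OF that(2,2)] that(3) by (auto split: if_splits)
  show "\<sigma> = \<tau>" using *[OF s] *[OF s(2,1) s(3)[symmetric]] nat_le_linear by blast
qed

lemma ch_tableaux_independent: "\<not> series.dependent (ch_tableaux m ` shapes m)"
proof
  assume "series.dependent (ch_tableaux m ` shapes m)"
  then obtain t u where t: "finite t" "t \<subseteq> ch_tableaux m ` shapes m"
    "(\<Sum>v\<in>t. of_int (u v) * v) = 0" "\<exists>v\<in>t. u v \<noteq> 0"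
    unfolding series.dependent_explicit by blast
  obtain S where S: "S \<subseteq> shapes m" "t = ch_tableaux m ` S" using t(2) by (meson subset_image_iff)
  have injS: "inj_on (ch_tableaux m) S" using ch_tableaux_inj S(1) inj_on_subset by blast
  define c where "c \<sigma> = u (ch_tableaux m \<sigma>)" for \<sigma>
  \<comment> \<open>With the least height among the shapes that have a nonzero coefficient,
    \<open>\<tau>\<close> is the only one contributing at its leading weight.\<close>
  define \<tau> where "\<tau> = arg_min (\<lambda>\<sigma>. height m (lead m \<sigma>)) (\<lambda>\<sigma>. \<sigma> \<in> S \<and> c \<sigma> \<noteq> 0)"
  obtain \<sigma>0 where "\<sigma>0 \<in> S \<and> c \<sigma>0 \<noteq> 0" using t(4) S(2) by (auto simp: c_def)
  then have \<tau>: "\<tau> \<in> S \<and> c \<tau> \<noteq> 0" "\<And>\<sigma>. \<sigma> \<in> S \<and> c \<sigma> \<noteq> 0 \<Longrightarrow> height m (lead m \<tau>) \<le> height m (lead m \<sigma>)"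
    unfolding \<tau>_def by (fact arg_min_natI) (rule arg_min_nat_le)
  have fS: "finite S" using t(1) S(2) injS finite_imageD by blast
  have "0 = coeff (\<Sum>v\<in>t. of_int (u v) * v) (wt (lead m \<tau>))" using t(3) by (simp add: zero_series.rep_eq)
  also have "\<dots> = (\<Sum>\<sigma>\<in>S. c \<sigma> * coeff (ch_tableaux m \<sigma>) (wt (lead m \<tau>)))"
    unfolding S(2) sum.reindex[OF injS] coeff_sum by (simp add: coeff_scale c_def o_def)
  also have "\<dots> = (\<Sum>\<sigma>\<in>S. if \<sigma> = \<tau> then c \<sigma> else 0)"
  proof (rule sum.cong[OF refl])
    fix \<sigma> assume s: "\<sigma> \<in> S"
    show "c \<sigma> * coeff (ch_tableaux m \<sigma>) (wt (lead m \<tau>)) = (if \<sigma> = \<tau> then c \<sigma> else 0)"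
    proof (cases "c \<sigma> = 0")
      case False
      have "\<sigma> \<in> shapes m" "\<tau> \<in> shapes m" using \<tau>(1) s S(1) by blast+
      from coeff_lead[OF this \<tau>(2)] False s show ?thesis by simp
    qed auto
  qed
  also have "\<dots> = c \<tau>" using fS \<tau>(1) by simp
  finally show False using \<tau>(1) by simp
qed

section \<open>Separating the negative letters from the positive ones\<close>

fun sel :: "bool list \<Rightarrow> 'a list \<Rightarrow> 'a list" where
  "sel (t # ts) (x # xs) = (if t then x # sel ts xs else sel ts xs)"
| "sel _ _ = []"

lemma sel_append: "length ts = length xs \<Longrightarrow> sel (ts @ ts') (xs @ ys) = sel ts xs @ sel ts' ys"
  by (induction ts xs rule: list_induct2) auto

lemma length_sel: "length ts = length xs \<Longrightarrow> length (sel ts xs) = length (filter id ts)"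
  by (induction ts xs rule: list_induct2) auto

lemma set_sel: "set (sel ts xs) \<subseteq> set xs"
  by (induction ts xs rule: sel.induct) auto

lemma set_sel_Un: "length ts = length xs \<Longrightarrow> set (sel ts xs) \<union> set (sel (map Not ts) xs) = set xs"
  by (induction ts xs rule: list_induct2) auto

lemma mset_sel: "length ts = length xs \<Longrightarrow> mset (sel ts xs @ sel (map Not ts) xs) = mset xs"
  by (induction ts xs rule: list_induct2) auto

lemma sel_inj:
  "length ts = length xs \<Longrightarrow> length ts = length ys \<Longrightarrow> sel ts xs = sel ts ys
    \<Longrightarrow> sel (map Not ts) xs = sel (map Not ts) ys \<Longrightarrow> xs = ys"
proof (induction ts xs arbitrary: ys rule: list_induct2)
  case (Cons t ts x xs)
  then obtain y ys' where y: "ys = y # ys'" by (cases ys) auto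
  have "x = y \<and> sel ts xs = sel ts ys' \<and> sel (map Not ts) xs = sel (map Not ts) ys'"
    using Cons.prems unfolding y by (cases t) auto
  then show ?case using Cons.IH[of ys'] Cons.prems y by simp
qed simp

lemma sel_split:
  "length ts = length xs \<Longrightarrow> sel ts xs = u1 @ c # u2 \<Longrightarrow>
    \<exists>ts1 ts2 p s. ts = ts1 @ True # ts2 \<and> xs = p @ c # s \<and> length ts1 = length p \<and> sel ts1 p = u1 \<and> sel ts2 s = u2"
proof (induction ts xs arbitrary: u1 rule: list_induct2)
  case (Cons t ts x xs)
  show ?case
  proof (cases "t \<and> u1 = []")
    case True
    then show ?thesis using Cons by (intro exI[of _ "[]"] exI[of _ ts] exI[of _ xs]) auto
  next
    case False
    define v where "v = (if t then tl u1 else u1)"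
    have "sel ts xs = v @ c # u2" using False Cons.prems by (cases u1) (auto simp: v_def split: if_splits)
    then obtain ts1 ts2 p s where "ts = ts1 @ True # ts2" "xs = p @ c # s" "length ts1 = length p" "sel ts1 p = v" "sel ts2 s = u2"
      using Cons.IH by blast
    moreover have "(if t then x # v else v) = u1" using False Cons.prems by (cases u1) (auto simp: v_def split: if_splits)
    ultimately show ?thesis
      by (intro exI[of _ "t # ts1"] exI[of _ ts2] exI[of _ "x # p"] exI[of _ s]) auto
  qed
qed simp

lemma ep_sel:
  "length ts = length xs \<Longrightarrow> a \<notin> set (sel (map Not ts) xs) \<Longrightarrow> b \<notin> set (sel (map Not ts) xs)
    \<Longrightarrow> ep a b (sel ts xs) = ep a b xs \<and> excess a b (sel ts xs) = excess a b xs"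
  by (induction ts xs rule: list_induct2) (auto simp: ep_nonneg max_def split: if_splits)

lemma ph_sel:
  "length ts = length xs \<Longrightarrow> a \<notin> set (sel (map Not ts) xs) \<Longrightarrow> b \<notin> set (sel (map Not ts) xs)
    \<Longrightarrow> ph a b (sel ts xs) = ph a b xs"
  using ep_sel[of ts xs a b] ep_ph[of a b xs] ep_ph[of a b "sel ts xs"] by simp

lemma ep_avoid: "a \<notin> set v \<Longrightarrow> b \<notin> set v \<Longrightarrow> ep a b v = 0 \<and> excess a b v = 0"
  by (induction v) auto

lemma length_filter_take_mono:
  assumes "i \<le> j"
  shows "length (filter P (take i xs)) \<le> length (filter P (take j xs))"
proof -
  have "take j xs = take i xs @ drop i (take j xs)" using assms by (metis append_take_drop_id min.absorb1 take_take)
  then show ?thesis by (metis filter_append le_add1 length_append)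
qed

text \<open>A word \<open>x\<close> is a shuffle of \<open>U x\<close> (at the positions marked in \<open>\<beta>\<close>) and \<open>R x\<close>, where all of
  \<open>U x\<close> precedes all of \<open>R x\<close> in the order of positions, and \<open>Z\<close> is the first position of \<open>R x\<close> in
  this order. That the last position of \<open>U x\<close> stands to the left of \<open>Z\<close> is what allows to move \<open>U x\<close>
  in front of \<open>R x\<close>.\<close>

locale shuffle =
  fixes m :: nat and \<beta> :: "bool list" and u0 :: word and Z :: nat
  assumes Z: "Z < length \<beta>" "\<not> \<beta> ! Z" and u0: "u0 \<in> words m"
    and good: "\<And>u. u \<in> component m u0 \<Longrightarrow> \<exists>p<length (filter id (take Z \<beta>)). p < length u \<and> (\<forall>p'<length u. p' \<noteq> p \<longrightarrow> rk u p' p)"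
    and big: "\<And>u. u \<in> component m u0 \<Longrightarrow> \<exists>c\<in>set u. -1 \<le> c"
begin

text \<open>An index of \<open>U x\<close> is below \<open>k1\<close> iff the corresponding position
  of \<open>x\<close> stands to the left of \<open>Z\<close>. Likewise \<open>s0\<close> is the
  index that position \<open>Z\<close> receives in \<open>R x\<close>.\<close>

definition k1 where "k1 = length (filter id (take Z \<beta>))"
definition s0 where "s0 = length (filter Not (take Z \<beta>))"

definition U where "U x = sel \<beta> x" for x :: word
definition R where "R x = sel (map Not \<beta>) x" for x :: word

definition S where "S = {x \<in> words m. length x = length \<beta> \<and> U x \<in> component m u0
  \<and> (\<forall>c\<in>set (U x). \<forall>d\<in>set (R x). asc c d) \<and> (\<forall>s<length (R x). s \<noteq> s0 \<longrightarrow> rk (R x) s0 s)}"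

lemma filter_Not: "length (filter id (map Not ts)) = length (filter Not ts)"
  by (induction ts) auto

lemma length_R: "length x = length \<beta> \<Longrightarrow> length (R x) = length (filter Not \<beta>)"
  unfolding R_def using length_sel[of "map Not \<beta>" x] by (simp add: filter_Not)

lemma s0_less: "s0 < length (filter Not \<beta>)"
proof -
  have "length (filter Not (take (Suc Z) \<beta>)) \<le> length (filter Not \<beta>)"
    using length_filter_take_mono[of "Suc Z" "length \<beta>" Not \<beta>] Z by simp
  then show ?thesis using Z by (simp add: s0_def take_Suc_conv_app_nth)
qed

text \<open>Every letter of \<open>R x\<close> comes after some letter of \<open>U x\<close> that is
  at least \<open>-1\<close>.\<close>

lemma R_pos:
  assumes "x \<in> S" "d \<in> set (R x)"
  shows "0 < d"
proof -
  have "U x \<in> component m u0" using assms(1) by (simp add: S_def)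
  then obtain c where "c \<in> set (U x)" "-1 \<le> c" using big by blast
  then have "asc c d" using assms by (auto simp: S_def)
  then have d: "-1 < d" using asc_int_less[of "-1" c d] \<open>-1 \<le> c\<close> by simp
  have "d \<in> set x" using assms(2) set_sel unfolding R_def by fast
  then have "d \<in> letters m" using assms(1) by (auto simp: S_def words_def)
  from this d show ?thesis by (cases rule: letters_cases) auto
qed

lemma between: "a \<in> letters m \<Longrightarrow> x \<in> letters m \<Longrightarrow> a \<le> x \<Longrightarrow> x \<le> nxt a \<Longrightarrow> x = a \<or> x = nxt a"
  using nxt_le[of a m x] by force

text \<open>Let \<open>p\<close> be the last position of \<open>U x\<close> in the order;
  \<open>s0\<close> is the first one of \<open>R x\<close>. From \<open>c\<close> to
  \<open>p\<close> to \<open>s0\<close> to \<open>s'\<close> the letters weakly increase, so all of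
  them are \<open>a\<close> or \<open>nxt a\<close> as soon as both ends are.\<close>

lemma separating_letters:
  assumes x: "x \<in> S" and a: "a \<in> letters m" "0 < nxt a"
    and c: "c \<in> set (U x)" "c = a \<or> c = nxt a"
    and e: "s' < length (R x)" "R x ! s' = a \<or> R x ! s' = nxt a"
  obtains p where "p < k1" "p < length (U x)" "U x ! p = a \<or> U x ! p = nxt a"
    "s0 < length (R x)" "R x ! s0 = a \<or> R x ! s0 = nxt a" "a \<in> \<int> \<longrightarrow> s0 \<le> s'"
    "a \<notin> \<int> \<longrightarrow> (\<forall>p'<length (U x). U x ! p' = a \<or> U x ! p' = nxt a \<longrightarrow> p' \<le> p)"
proof -
  let ?u = "U x" and ?r = "R x" and ?b = "nxt a"
  have lt: "a < ?b" by (rule nxt_greater)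
  have par: "?b \<in> \<int> \<longleftrightarrow> a \<notin> \<int>" using nxt_pos_parity[OF a] .
  have lett: "d \<in> letters m" if "d \<in> set x" for d using x that by (auto simp: S_def words_def)
  have ul: "d \<in> letters m" if "d \<in> set ?u" for d using lett that set_sel unfolding U_def by fast
  have rl: "d \<in> letters m" if "d \<in> set ?r" for d using lett that set_sel unfolding R_def by fast
  have J: "asc c d" if "c \<in> set ?u" "d \<in> set ?r" for c d using x that by (auto simp: S_def)
  have s0: "s0 < length ?r" using s0_less length_R x by (simp add: S_def)
  obtain p where p: "p < k1" "p < length ?u" "\<forall>p'<length ?u. p' \<noteq> p \<longrightarrow> rk ?u p' p"
    using good[of ?u] x unfolding k1_def S_def by blast
  have cp: "c \<le> ?u ! p"
  proof -
    obtain p' where "p' < length ?u" "?u ! p' = c" using c(1) by (auto simp: in_set_conv_nth)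
    then show ?thesis using p(3) by (cases "p' = p") (auto simp: rk_def)
  qed
  have rs: "?r ! s0 \<le> ?r ! s'" using x e(1) by (cases "s' = s0") (auto simp: S_def rk_def)
  have asc1: "asc (?u ! p) (?r ! s0)" using J p(2) s0 by simp
  then have ur: "?u ! p \<le> ?r ! s0" by (auto simp: asc_def)
  have up: "?u ! p = a \<or> ?u ! p = ?b" using between[OF a(1) ul[of "?u ! p"]] p(2) cp ur rs c(2) e(2) lt by force
  have rp: "?r ! s0 = a \<or> ?r ! s0 = ?b" using between[OF a(1) rl[of "?r ! s0"]] s0 cp ur rs c(2) e(2) lt by force
  \<comment> \<open>Two equal even letters do not ascend, so \<open>s0\<close> and \<open>s'\<close>
    both carry the odd letter \<open>nxt a\<close>. These are ordered from left to right, with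
    \<open>s0\<close> first.\<close>
  have ev: "s0 \<le> s'" if "a \<in> \<int>"
  proof (rule ccontr)
    assume n: "\<not> s0 \<le> s'"
    have "?r ! s0 = ?b" using asc1 up rp that par lt by (auto simp: asc_def)
    moreover have "?r ! s' = ?b" using calculation rs e(2) lt by auto
    moreover have "rk ?r s0 s'" using x e(1) n by (auto simp: S_def)
    ultimately show False using n that par by (simp add: rk_def)
  qed
  \<comment> \<open>Here \<open>p\<close> carries the odd letter \<open>a\<close>, and so does every
    position of \<open>U x\<close> with letter \<open>a\<close> or \<open>nxt a\<close>. The last of
    them in the order is the rightmost.\<close>
  have od: "p' \<le> p" if "a \<notin> \<int>" "p' < length ?u" "?u ! p' = a \<or> ?u ! p' = ?b" for p'
  proof (rule ccontr)
    assume n: "\<not> p' \<le> p"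
    have "?u ! p = a" using asc1 up rp that(1) par lt by (auto simp: asc_def)
    moreover have "rk ?u p' p" using p(3) that(2) n by auto
    ultimately have "?u ! p' = a" using that(3) lt by (auto simp: rk_def)
    then show False using \<open>rk ?u p' p\<close> n that(1) \<open>?u ! p = a\<close> by (simp add: rk_def)
  qed
  show ?thesis using that[of p] p up s0 rp ev od by blast
qed

text \<open>If position \<open>Z\<close> lies in the prefix \<open>p\<close>, or is the changed
  position itself, then all \<open>k1\<close> letters of \<open>U x\<close> standing before
  \<open>Z\<close> lie in \<open>p\<close>.\<close>

lemma split_counts:
  assumes "\<beta> = \<beta>1 @ t # \<beta>2" "length \<beta>1 = length p"
  shows "s0 < length (sel (map Not \<beta>1) p) \<Longrightarrow> k1 \<le> length (sel \<beta>1 p)"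
    and "\<not> t \<Longrightarrow> s0 \<le> length (sel (map Not \<beta>1) p) \<Longrightarrow> k1 \<le> length (sel \<beta>1 p)"
proof -
  have l: "length (sel \<beta>1 p) = length (filter id (take (length p) \<beta>))"
    "length (sel (map Not \<beta>1) p) = length (filter Not (take (length p) \<beta>))"
    using assms length_sel[of \<beta>1 p] length_sel[of "map Not \<beta>1" p] by (simp_all add: filter_Not)
  show "k1 \<le> length (sel \<beta>1 p)" if "s0 < length (sel (map Not \<beta>1) p)"
  proof -
    have "\<not> length p \<le> Z" using length_filter_take_mono[of "length p" Z Not \<beta>] that unfolding l s0_def by linarith
    then show ?thesis unfolding l k1_def by (intro length_filter_take_mono) simp
  qed
  show "k1 \<le> length (sel \<beta>1 p)" if "\<not> t" "s0 \<le> length (sel (map Not \<beta>1) p)"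
  proof -
    have "take (Suc (length p)) \<beta> = take (length p) \<beta> @ [t]" using assms by simp
    then have "\<not> Suc (length p) \<le> Z"
      using length_filter_take_mono[of "Suc (length p)" Z Not \<beta>] that unfolding l s0_def by auto
    then show ?thesis unfolding l k1_def by (intro length_filter_take_mono) simp
  qed
qed

text \<open>Where the letter \<open>c\<close> of \<open>x = p @ c # s\<close> ends up in \<open>U x @ R x\<close>.\<close>

definition left_part where
  "left_part \<beta>1 t \<beta>2 p s = (if t then sel \<beta>1 p else sel \<beta>1 p @ sel \<beta>2 s @ sel (map Not \<beta>1) p)"
definition right_part where
  "right_part \<beta>1 t \<beta>2 p s = (if t then sel \<beta>2 s @ sel (map Not \<beta>1) p @ sel (map Not \<beta>2) s else sel (map Not \<beta>2) s)"

lemma UR_split: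
  assumes "\<beta> = \<beta>1 @ t # \<beta>2" "length \<beta>1 = length p"
  shows "U (p @ c # s) = (if t then sel \<beta>1 p @ c # sel \<beta>2 s else sel \<beta>1 p @ sel \<beta>2 s)"
    and "R (p @ c # s) = (if t then sel (map Not \<beta>1) p @ sel (map Not \<beta>2) s else sel (map Not \<beta>1) p @ c # sel (map Not \<beta>2) s)"
    and "U (p @ c # s) @ R (p @ c # s) = left_part \<beta>1 t \<beta>2 p s @ c # right_part \<beta>1 t \<beta>2 p s"
  unfolding U_def R_def left_part_def right_part_def unfolding assms(1) using assms(2) by (simp_all add: sel_append)

text \<open>For negative \<open>nxt a\<close> the letters of \<open>R x\<close> are no brackets.
  Otherwise the concern is that \<open>U x\<close> and \<open>R x\<close> both contain
  \<open>a\<close> or \<open>nxt a\<close>. For even \<open>a\<close>, \<open>U x\<close> has such a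
  letter to the left of \<open>Z\<close> and \<open>R x\<close> has none there, so the leftmost one
  is in \<open>U x\<close> before and after the rearrangement. For odd \<open>a\<close>, all those
  of \<open>U x\<close> stand to the left of \<open>Z\<close>, and \<open>Z\<close> carries one of
  \<open>R x\<close>, so the rightmost one is in \<open>R x\<close> both times.\<close>

lemma admissible_shuffle_iff:
  assumes x: "p @ c # s \<in> S" and b: "\<beta> = \<beta>1 @ t # \<beta>2" "length \<beta>1 = length p"
    and a: "a \<in> letters m" and c: "c = a \<or> c = nxt a"
  shows "admissible a p s \<longleftrightarrow> admissible a (left_part \<beta>1 t \<beta>2 p s) (right_part \<beta>1 t \<beta>2 p s)"
proof -
  let ?x = "p @ c # s" and ?b = "nxt a"
  let ?u1 = "sel \<beta>1 p" and ?u2 = "sel \<beta>2 s" and ?r1 = "sel (map Not \<beta>1) p" and ?r2 = "sel (map Not \<beta>2) s"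
  note UR = UR_split[OF b, of c s]
  have lt: "a < ?b" by (rule nxt_greater)
  have "length ?x = length \<beta>" using x by (simp add: S_def)
  then have b2: "length \<beta>2 = length s" unfolding b(1) using b(2) by simp
  have sp: "set p = set ?u1 \<union> set ?r1" using set_sel_Un[OF b(2)] by blast
  have ss: "set s = set ?u2 \<union> set ?r2" using set_sel_Un[OF b2] by blast
  show ?thesis
  proof (cases "?b < 0")
    case True
    have neg: "a < 0" "c < 0" using True lt c by auto
    have rpos: "0 < d" if "d \<in> set (R ?x)" for d using R_pos[OF x that] .
    have t: t
    proof (rule ccontr)
      assume "\<not> t"
      then have "c \<in> set (R ?x)" using UR(2) by simp
      then show False using rpos neg by fastforce
    qed
    have n: "a \<notin> set ?r1" "?b \<notin> set ?r1" "a \<notin> set ?r2" "?b \<notin> set ?r2"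
      using rpos neg True t UR(2) by fastforce+
    have "ph a ?b ?u1 = ph a ?b p" using ph_sel[OF b(2)] n by simp
    moreover have "ep a ?b ?u2 = ep a ?b s" using ep_sel[OF b2] n by simp
    moreover have "ep a ?b (?u2 @ ?r1 @ ?r2) = ep a ?b ?u2"
      using ep_avoid[of a "?r1 @ ?r2" ?b] n ep_ge_excess[of a ?b ?u2 "[]"] by (simp add: ep_append)
    ultimately show ?thesis using True t by (simp add: admissible_def left_part_def right_part_def)
  next
    case False
    then have bp: "0 < ?b" using letters_nonzero[OF nxt_letters[OF a]] by simp
    define hit where "hit w \<longleftrightarrow> a \<in> set w \<or> ?b \<in> set w" for w
    have hitI: "hit w" if "i < length w" "w ! i = a \<or> w ! i = ?b" for w i
      using that unfolding hit_def by (metis nth_mem)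
    have hitE: "\<exists>i<length w. w ! i = a \<or> w ! i = ?b" if "hit w" for w
      using that unfolding hit_def by (metis in_set_conv_nth)
    have hit_app: "hit (v @ w) \<longleftrightarrow> hit v \<or> hit w" for v w unfolding hit_def by auto
    have hp: "hit p \<longleftrightarrow> hit ?u1 \<or> hit ?r1" unfolding hit_def sp by blast
    have hs: "hit s \<longleftrightarrow> hit ?u2 \<or> hit ?r2" unfolding hit_def ss by blast
    have adm: "admissible a v w \<longleftrightarrow> (if a \<in> \<int> then \<not> hit v else \<not> hit w)" for v w
      unfolding admissible_def hit_def using bp by auto
    have lenU: "length (U ?x) = length ?u1 + (if t then 1 else 0) + length ?u2" using UR(1) by simp
    have U1: "U ?x ! i = ?u1 ! i" if "i < length ?u1" for i using that UR(1) by (simp add: nth_append)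
    have R1: "R ?x ! i = ?r1 ! i" if "i < length ?r1" for i using that UR(2) by (simp add: nth_append)
    have lenR1: "length ?r1 \<le> length (R ?x)" using UR(2) by simp
    show ?thesis
    proof (cases t)
      case True
      have cU: "c \<in> set (U ?x)" using UR(1) True by simp
      have key: "False" if r1: "hit ?r1" and no: "if a \<in> \<int> then \<not> hit ?u1 else \<not> hit ?u2 \<and> \<not> hit ?r2"
      proof -
        obtain s' where s': "s' < length ?r1" "?r1 ! s' = a \<or> ?r1 ! s' = ?b" using hitE[OF r1] by blast
        have s'R: "s' < length (R ?x)" "R ?x ! s' = a \<or> R ?x ! s' = ?b" using s' lenR1 R1 by auto
        obtain k where k: "k < k1" "k < length (U ?x)" "U ?x ! k = a \<or> U ?x ! k = ?b"
          "s0 < length (R ?x)" "R ?x ! s0 = a \<or> R ?x ! s0 = ?b" "a \<in> \<int> \<longrightarrow> s0 \<le> s'"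
          "a \<notin> \<int> \<longrightarrow> (\<forall>p'<length (U ?x). U ?x ! p' = a \<or> U ?x ! p' = ?b \<longrightarrow> p' \<le> k)"
          using separating_letters[OF x a bp cU c s'R] by blast
        show False
        proof (cases "a \<in> \<int>")
          case i: True
          then have "k1 \<le> length ?u1" using split_counts(1)[OF b] k(6) s' by simp
          then have "hit ?u1" using hitI[of k ?u1] k U1 by simp
          then show False using no i by simp
        next
          case i: False
          have "s0 < length ?r1"
          proof (rule ccontr)
            assume "\<not> s0 < length ?r1"
            then have "R ?x ! s0 = ?r2 ! (s0 - length ?r1)" "s0 - length ?r1 < length ?r2"
              using k(4) UR(2) True by (auto simp: nth_append)
            then have "hit ?r2" using hitI k(5) by metis
            then show False using no i by simp
          qed
          then have "k1 \<le> length ?u1" using split_counts(1)[OF b] by simp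
          moreover have "U ?x ! length ?u1 = c" "length ?u1 < length (U ?x)" using UR(1) True by auto
          ultimately show False using k(1,7) i c by force
        qed
      qed
      show ?thesis unfolding adm left_part_def right_part_def using True key hp hs
        by (auto simp: hit_app)
    next
      case False
      have cR: "length ?r1 < length (R ?x)" "R ?x ! length ?r1 = a \<or> R ?x ! length ?r1 = ?b"
        using UR(2) False c by (auto simp: nth_append)
      have key: "False" if u2: "hit ?u2" and no: "if a \<in> \<int> then \<not> hit ?u1 else \<not> hit ?r2"
      proof -
        obtain i where i: "i < length ?u2" "?u2 ! i = a \<or> ?u2 ! i = ?b" using hitE[OF u2] by blast
        have iU: "length ?u1 + i < length (U ?x)" "U ?x ! (length ?u1 + i) = ?u2 ! i"
          using UR(1) False i by (auto simp: nth_append)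
        have dU: "?u2 ! i \<in> set (U ?x)" using iU by (metis nth_mem)
        obtain k where k: "k < k1" "k < length (U ?x)" "U ?x ! k = a \<or> U ?x ! k = ?b"
          "s0 < length (R ?x)" "R ?x ! s0 = a \<or> R ?x ! s0 = ?b" "a \<in> \<int> \<longrightarrow> s0 \<le> length ?r1"
          "a \<notin> \<int> \<longrightarrow> (\<forall>p'<length (U ?x). U ?x ! p' = a \<or> U ?x ! p' = ?b \<longrightarrow> p' \<le> k)"
          using separating_letters[OF x a bp dU i(2) cR] by blast
        show False
        proof (cases "a \<in> \<int>")
          case ia: True
          then have "k1 \<le> length ?u1" using split_counts(2)[OF b] False k(6) by simp
          then have "hit ?u1" using hitI[of k ?u1] k U1 by simp
          then show False using no ia by simp
        next
          case ia: False
          have "s0 \<le> length ?r1"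
          proof (rule ccontr)
            assume "\<not> s0 \<le> length ?r1"
            then obtain i' where i': "s0 = length ?r1 + Suc i'" by (metis add_Suc_right less_imp_Suc_add not_le)
            then have "R ?x ! s0 = ?r2 ! i'" "i' < length ?r2"
              using k(4) UR(2) False by (simp_all add: nth_append)
            then have "hit ?r2" using hitI k(5) by metis
            then show False using no ia by simp
          qed
          then have "k1 \<le> length ?u1" using split_counts(2)[OF b] False by simp
          then show False using k(1,7) ia iU i(2) by force
        qed
      qed
      show ?thesis unfolding adm left_part_def right_part_def using False key hp hs
        by (auto simp: hit_app)
    qed
  qed
qed

lemma split_beta:
  assumes "length (p @ c # s) = length \<beta>"
  obtains \<beta>1 t \<beta>2 where "\<beta> = \<beta>1 @ t # \<beta>2" "length \<beta>1 = length p"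
proof -
  have "length p < length \<beta>" using assms by simp
  then show ?thesis using that[of "take (length p) \<beta>" "\<beta> ! length p" "drop (Suc (length p)) \<beta>"]
    by (simp add: id_take_nth_drop)
qed

text \<open>A change among negative letters affects \<open>U x\<close> alone and keeps it below
  \<open>R x\<close>. In the other case admissibility carries over to \<open>U x @ R x\<close>, so
  the order of positions in that word is unchanged, and the remaining conditions depend on this
  order.\<close>

lemma S_move:
  assumes x: "p @ c # s \<in> S" and a: "a \<in> letters m" "admissible a p s"
    and cd: "(c = a \<and> d = nxt a) \<or> (c = nxt a \<and> d = a)"
  shows "p @ d # s \<in> S"
proof -
  let ?x = "p @ c # s" and ?y = "p @ d # s" and ?b = "nxt a"
  have xS: "?x \<in> words m" "length ?x = length \<beta>" "U ?x \<in> component m u0"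
    "\<And>c d. c \<in> set (U ?x) \<Longrightarrow> d \<in> set (R ?x) \<Longrightarrow> asc c d" "\<And>s. s < length (R ?x) \<Longrightarrow> s \<noteq> s0 \<Longrightarrow> rk (R ?x) s0 s"
    using x by (auto simp: S_def)
  obtain \<beta>1 t \<beta>2 where b: "\<beta> = \<beta>1 @ t # \<beta>2" "length \<beta>1 = length p" using split_beta[OF xS(2)] by blast
  have lt: "a < ?b" by (rule nxt_greater)
  have dl: "d \<in> letters m" using cd a nxt_letters by auto
  have yw: "?y \<in> words m" using xS(1) dl by (auto simp: words_append words_Cons)
  define V where "V = left_part \<beta>1 t \<beta>2 p s"
  define W where "W = right_part \<beta>1 t \<beta>2 p s"
  have adm: "admissible a V W" using admissible_shuffle_iff[OF x b a(1)] cd a(2) unfolding V_def W_def by blast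
  have Dx: "U ?x @ R ?x = V @ c # W" and Dy: "U ?y @ R ?y = V @ d # W"
    unfolding V_def W_def by (rule UR_split(3)[OF b])+
  have lU: "length (U ?y) = length (U ?x)" and lR: "length (R ?y) = length (R ?x)"
    using UR_split(1,2)[OF b] by auto
  have ab: "V @ a # W \<in> words m"
  proof -
    have "set (U ?x @ R ?x) \<subseteq> set ?x" using set_sel unfolding U_def R_def by (metis Un_subset_iff set_append)
    then have "U ?x @ R ?x \<in> words m" using xS(1) by (auto simp: words_def)
    then show ?thesis unfolding Dx using a(1) by (auto simp: words_append words_Cons)
  qed
  have same: "asc ((V @ d # W) ! i) ((V @ d # W) ! j) \<longleftrightarrow> asc ((V @ c # W) ! i) ((V @ c # W) ! j)"
    if "0 < ?b" "i < j" "j < length (V @ c # W)" for i j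
    using asc_step[OF a(1) that(1) ab adm that(2)] that(3) cd by auto
  have U_eq: "\<not> t \<Longrightarrow> U ?y = U ?x" and R_eq: "t \<Longrightarrow> R ?y = R ?x"
    using UR_split(1,2)[OF b] by auto
  have comp: "U ?y \<in> component m u0"
  proof (cases t)
    case True
    then have "admissible a (sel \<beta>1 p) (sel \<beta>2 s)"
      using adm admissible_append(1) unfolding V_def W_def left_part_def right_part_def by auto
    then have "step m (U ?x) (U ?y) \<or> step m (U ?y) (U ?x)"
      using True cd a(1) UR_split(1)[OF b] unfolding step_def by auto
    then show ?thesis using component_step[OF xS(3)] component_words[OF u0 xS(3)] by blast
  qed (use U_eq xS in simp)
  have J: "asc e f" if ef: "e \<in> set (U ?y)" "f \<in> set (R ?y)" for e f
  proof (cases "?b < 0")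
    case True
    have neg: "c < 0" "d < 0" using True lt cd by auto
    have t: t
    proof (rule ccontr)
      assume "\<not> t"
      then have "c \<in> set (R ?x)" using UR_split(2)[OF b] by simp
      then show False using R_pos[OF x] neg by fastforce
    qed
    have f: "f \<in> set (R ?x)" using ef R_eq t by simp
    have "e = d \<or> e \<in> set (U ?x)" using ef(1) UR_split(1)[OF b] t by auto
    then show ?thesis using xS(4) f R_pos[OF x f] neg by (auto simp: asc_def)
  next
    case False
    then have bp: "0 < ?b" using letters_nonzero[OF nxt_letters[OF a(1)]] by simp
    obtain i where i: "i < length (U ?y)" "e = U ?y ! i" using ef by (auto simp: in_set_conv_nth)
    obtain j where j: "j < length (R ?y)" "f = R ?y ! j" using ef by (auto simp: in_set_conv_nth)
    have "asc (U ?x ! i) (R ?x ! j)" using xS(4) i j lU lR by simp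
    then show ?thesis using same[OF bp, of i "length (U ?x) + j"] i j lU lR unfolding Dx[symmetric] Dy[symmetric]
      by (simp add: nth_append)
  qed
  have rkR: "rk (R ?y) s0 s'" if s': "s' < length (R ?y)" "s' \<noteq> s0" for s'
  proof (cases t)
    case True
    then show ?thesis using R_eq xS(5) s' by simp
  next
    case t: False
    have "0 < c" using R_pos[OF x, of c] UR_split(2)[OF b] t by simp
    then have bp: "0 < ?b" using cd lt by auto
    have s0l: "s0 < length (R ?y)" using s0_less length_R xS(2) lR by simp
    have eq: "asc (R ?y ! i) (R ?y ! j) \<longleftrightarrow> asc (R ?x ! i) (R ?x ! j)" if "i < j" "j < length (R ?y)" for i j
      using same[OF bp, of "length (U ?x) + i" "length (U ?x) + j"] that lU lR unfolding Dx[symmetric] Dy[symmetric]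
      by (simp add: nth_append)
    have "rk (R ?x) s0 s'" using xS(5) s' lR by simp
    then show ?thesis using eq[of s0 s'] eq[of s' s0] s' s0l by (auto simp: rk_iff_asc split: if_splits)
  qed
  show ?thesis unfolding S_def using yw xS(2) comp J rkR by simp
qed

lemma ch_component_shuffle:
  assumes w: "w \<in> S"
  shows "ch_component m (U w @ R w) = ch_component m w"
proof (rule ch_component_transfer[where S = S and D = "\<lambda>x. U x @ R x"])
  show "w \<in> words m" "w \<in> S" using w by (auto simp: S_def)
  have "set (U w @ R w) \<subseteq> set w" using set_sel unfolding U_def R_def by (metis Un_subset_iff set_append)
  then show "U w @ R w \<in> words m" using w by (auto simp: S_def words_def)
  show "y \<in> S" if "x \<in> S" "step m x y \<or> step m y x" for x y
    using that S_move unfolding step_def by blast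
  show "step m (U x @ R x) (U y @ R y)" if x: "x \<in> S" "step m x y" for x y
  proof -
    obtain a p s where a: "a \<in> letters m" "x = p @ a # s" "y = p @ nxt a # s" "admissible a p s"
      using x(2) unfolding step_def by blast
    obtain \<beta>1 t \<beta>2 where b: "\<beta> = \<beta>1 @ t # \<beta>2" "length \<beta>1 = length p"
      using split_beta[of p a s] x(1) a(2) by (auto simp: S_def)
    have "admissible a (left_part \<beta>1 t \<beta>2 p s) (right_part \<beta>1 t \<beta>2 p s)"
      using admissible_shuffle_iff[OF x(1)[unfolded a(2)] b a(1)] a(4) by blast
    then show ?thesis unfolding step_def a(2,3) UR_split(3)[OF b] using a(1) by blast
  qed
  \<comment> \<open>Each position of \<open>U x @ R x\<close> comes from a position of
    \<open>x\<close>, so an arrow at the rearranged word is an arrow at \<open>x\<close>.\<close>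
  have lift: "\<exists>p s. x = p @ c # s \<and> U (p @ d # s) @ R (p @ d # s) = V @ d # W \<and> admissible a p s"
    if x: "x \<in> S" "U x @ R x = V @ c # W" "admissible a V W" "a \<in> letters m" "c = a \<or> c = nxt a" for x V W a c d
  proof -
    have len: "length \<beta> = length x" using x(1) by (simp add: S_def)
    have "\<exists>\<beta>1 t \<beta>2 p s. \<beta> = \<beta>1 @ t # \<beta>2 \<and> x = p @ c # s \<and> length \<beta>1 = length p
      \<and> V = left_part \<beta>1 t \<beta>2 p s \<and> W = right_part \<beta>1 t \<beta>2 p s"
    proof -
      from x(2) consider (u) u2 where "U x = V @ c # u2" "W = u2 @ R x" | (r) r1 where "V = U x @ r1" "R x = r1 @ c # W"
        by (auto simp: append_eq_append_conv2 Cons_eq_append_conv append_eq_Cons_conv)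
      then show ?thesis
      proof cases
        case u
        obtain \<beta>1 \<beta>2 p s where h: "\<beta> = \<beta>1 @ True # \<beta>2" "x = p @ c # s" "length \<beta>1 = length p" "sel \<beta>1 p = V" "sel \<beta>2 s = u2"
          using sel_split[OF len u(1)[unfolded U_def]] by blast
        have "R x = sel (map Not \<beta>1) p @ sel (map Not \<beta>2) s" unfolding h(2) using UR_split(2)[OF h(1,3)] by simp
        then show ?thesis using h u(2)
          by (intro exI[of _ \<beta>1] exI[of _ True] exI[of _ \<beta>2] exI[of _ p] exI[of _ s]) (simp add: left_part_def right_part_def)
      next
        case r
        have len': "length (map Not \<beta>) = length x" using len by simp
        obtain \<gamma>1 \<gamma>2 p s where h: "map Not \<beta> = \<gamma>1 @ True # \<gamma>2" "x = p @ c # s" "length \<gamma>1 = length p" "sel \<gamma>1 p = r1" "sel \<gamma>2 s = W"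
          using sel_split[OF len' r(2)[unfolded R_def]] by blast
        have nn: "map Not (map Not ts) = ts" for ts by (induction ts) auto
        have b: "\<beta> = map Not \<gamma>1 @ False # map Not \<gamma>2" using arg_cong[OF h(1), of "map Not"] nn by simp
        have "U x = sel (map Not \<gamma>1) p @ sel (map Not \<gamma>2) s" unfolding h(2) using UR_split(1)[OF b] h(3) by simp
        then show ?thesis using h r(1) b nn
          by (intro exI[of _ "map Not \<gamma>1"] exI[of _ False] exI[of _ "map Not \<gamma>2"] exI[of _ p] exI[of _ s])
            (simp add: left_part_def right_part_def)
      qed
    qed
    then obtain \<beta>1 t \<beta>2 p s where b: "\<beta> = \<beta>1 @ t # \<beta>2" "x = p @ c # s" "length \<beta>1 = length p"
      "V = left_part \<beta>1 t \<beta>2 p s" "W = right_part \<beta>1 t \<beta>2 p s" by blast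
    have "admissible a p s" using admissible_shuffle_iff[OF x(1)[unfolded b(2)] b(1,3) x(4,5)] x(3) b(4,5) by blast
    then show ?thesis using b UR_split(3)[OF b(1,3)] by blast
  qed
  show "\<exists>y. z = U y @ R y \<and> step m x y" if x: "x \<in> S" "step m (U x @ R x) z" for x z
  proof -
    obtain a V W where a: "a \<in> letters m" "U x @ R x = V @ a # W" "z = V @ nxt a # W" "admissible a V W"
      using x(2) unfolding step_def by blast
    then show ?thesis using lift[OF x(1) a(2,4,1), of "nxt a"] unfolding step_def by metis
  qed
  show "\<exists>y. z = U y @ R y \<and> step m y x" if x: "x \<in> S" "step m z (U x @ R x)" for x z
  proof -
    obtain a V W where a: "a \<in> letters m" "U x @ R x = V @ nxt a # W" "z = V @ a # W" "admissible a V W"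
      using x(2) unfolding step_def by blast
    then show ?thesis using lift[OF x(1) a(2,4,1), of a] unfolding step_def by metis
  qed
  show "inj_on (\<lambda>x. U x @ R x) S"
  proof (rule inj_onI)
    fix x y assume h: "x \<in> S" "y \<in> S" "U x @ R x = U y @ R y"
    have l: "length \<beta> = length x" "length \<beta> = length y" using h by (auto simp: S_def)
    then have "length (U x) = length (U y)" by (simp add: U_def length_sel)
    then have "U x = U y" "R x = R y" using h(3) by auto
    then show "x = y" using sel_inj[OF l] by (simp add: U_def R_def)
  qed
  show "mset (U x @ R x) = mset x" if "x \<in> S" for x
    using that mset_sel[of \<beta> x] by (simp add: S_def U_def R_def)
qed

end

section \<open>The theorem\<close>

lemma sorted_wrt_exists:
  assumes "finite A" "transp P" "\<And>x y. x \<in> A \<Longrightarrow> y \<in> A \<Longrightarrow> x \<noteq> y \<Longrightarrow> P x y \<or> P y x"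
  shows "\<exists>xs. distinct xs \<and> set xs = A \<and> sorted_wrt P xs"
  using assms(1,3)
proof (induction A rule: finite_induct)
  case (insert x A)
  then obtain xs where xs: "distinct xs" "set xs = A" "sorted_wrt P xs" by auto
  let ?ys = "filter (\<lambda>y. P y x) xs @ x # filter (\<lambda>y. \<not> P y x) xs"
  have "P x z" if "z \<in> A" "\<not> P z x" for z using insert.prems[of x z] insert.hyps that by auto
  then have "sorted_wrt P ?ys"
    using xs transpD[OF assms(2)] by (auto simp: sorted_wrt_append sorted_wrt_filter)
  moreover have "distinct ?ys" using xs insert.hyps by auto
  moreover have "set ?ys = insert x A" using xs by auto
  ultimately show ?case by blast
qed simp

lemma rank_order_exists: "\<exists>q. distinct q \<and> set q = {..<length r} \<and> length q = length r \<and> sorted_wrt (rk r) q"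
proof -
  obtain q where q: "distinct q" "set q = {..<length r}" "sorted_wrt (rk r) q"
    using sorted_wrt_exists[OF finite_lessThan transp_rk, of "length r" r]
    by (auto simp: rk_def) (metis linorder_neqE linorder_neqE_nat)
  moreover have "length q = length r" using q(1,2) by (metis card_lessThan distinct_card)
  ultimately show ?thesis by blast
qed

lemma count_list_neg_letter: "count_list (map (neg_letter m) v) (neg_letter m s) = count_list v s"
  by (induction v) (auto simp: neg_letter_eq)

lemma ep_filter_neg: "a < 0 \<Longrightarrow> b < 0 \<Longrightarrow> ep a b (filter (\<lambda>c. c < 0) w) = ep a b w"
  by (induction w) (auto simp: ep_nonneg max_def)

text \<open>Vanishing of \<open>ep\<close> for two neighbouring negative letters bounds the excess
  of every prefix by zero, which is the Yamanouchi condition for these letters.\<close>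

lemma hw_neg_part:
  assumes "w \<in> words m" "is_hw m w"
  shows "\<exists>v. filter (\<lambda>b. b < 0) w = map (neg_letter m) v \<and> yam v \<and> set v \<subseteq> {..<m}"
proof -
  let ?u = "filter (\<lambda>b. b < 0) w"
  have nl: "\<exists>s<m. b = neg_letter m s" if "b \<in> set ?u" for b
    using that assms(1) neg_letters_ex by (auto simp: words_def)
  then obtain v where v: "?u = map (neg_letter m) v" by (metis ex_map_conv)
  have sv: "set v \<subseteq> {..<m}"
  proof
    fix s assume "s \<in> set v"
    then have "neg_letter m s \<in> set ?u" unfolding v by simp
    then obtain t where "t < m" "neg_letter m s = neg_letter m t" using nl by blast
    then show "s \<in> {..<m}" by (simp add: neg_letter_eq)
  qed
  have "count_list (take k v) (Suc s) \<le> count_list (take k v) s" for k s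
  proof (cases "Suc s < m")
    case True
    let ?a = "neg_letter m s" and ?b = "neg_letter m (Suc s)"
    have n: "nxt ?a = ?b" "?b < 0" using True nxt_neg_letter neg_letter_neg by auto
    have ne: "?a \<noteq> ?b" by (simp add: neg_letter_eq)
    have "ep ?a ?b w = 0" using hw_ep[OF assms(2), of ?a] neg_letter_letters[of s m] True n by simp
    then have "ep ?a ?b (map (neg_letter m) (take k v) @ map (neg_letter m) (drop k v)) = 0"
      using ep_filter_neg[of ?a ?b w] neg_letter_neg[of s m] True n(2) v
      by (metis Suc_lessD append_take_drop_id map_append)
    then have "ep ?a ?b (map (neg_letter m) (take k v)) = 0" by (rule ep_prefix_zero)
    then have "excess ?a ?b (map (neg_letter m) (take k v)) \<le> 0"
      using ep_ge_excess[of ?a ?b "map (neg_letter m) (take k v)" "[]"] by simp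
    then show ?thesis by (simp only: excess_count[OF ne] count_list_neg_letter)
  next
    case False
    then have "Suc s \<notin> set (take k v)" using sv by (meson in_set_takeD lessThan_iff subsetD)
    then have "count_list (take k v) (Suc s) = 0" unfolding count_list_0_iff .
    then show ?thesis by simp
  qed
  then show ?thesis using v sv by (auto simp: yam_def antitone_def)
qed

lemma reading_rows:
  "map (\<lambda>P. neg_letter m (fst P)) (reading l) = map (neg_letter m) (row_word (length l) (\<lambda>s. l ! s))"
proof -
  have "map fst (row_nodes l s) = replicate (l ! s) s" for s
    by (simp add: row_nodes_def o_def map_replicate_const)
  then have "map fst (reading l) = row_word (length l) (\<lambda>s. l ! s)"
    by (simp add: reading_def rows_between_def row_word_def map_concat o_def)
  then show ?thesis by (metis (no_types, lifting) map_map comp_def map_cong)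
qed

lemma yam_component:
  assumes v: "yam v" "set v \<subseteq> {..<m}" and r: "r \<in> words m" "\<forall>b\<in>set r. 0 < b" "r \<noteq> [] \<longrightarrow> m = 0 \<or> m - 1 \<in> set v"
    and q: "distinct q" "set q = {..<length r}" "length q = length r" "sorted_wrt (rk r) q"
    and l: "l = map (count_list v) [0..<m]"
  shows "arrangement m l q" "ch_component m (map (neg_letter m) v @ r) = ch_tableaux m (l, comp_of q)"
proof -
  have "sorted_wrt (\<ge>) l"
    unfolding l sorted_wrt_iff_nth_less using antitoneD[OF yam_antitone[OF v(1)]] by simp
  moreover have "m = 0 \<or> l ! (m - 1) \<noteq> 0" if "q \<noteq> []"
  proof (cases "m = 0")
    case False
    then have "m - 1 \<in> set v" using that r(3) q(3) by auto
    then show ?thesis using False by (simp add: l count_list_0_iff)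
  qed simp
  ultimately show A: "arrangement m l q" using q l by unfold_locales auto
  have row: "row_word (length l) (\<lambda>s. l ! s) = row_word m (count_list v)"
    unfolding row_word_def l by (auto intro!: arg_cong[of _ _ concat])
  have "mset v = mset (row_word m (count_list v))"
    unfolding mset_eq_count_list count_row_word using v(2) by (auto simp: count_list_0_iff)
  then have "ch_component m (map (neg_letter m) v @ r) = ch_component m (map (neg_letter m) (row_word m (count_list v)) @ r)"
    using ch_component_yam[OF v(1) yam_row_word[OF yam_antitone[OF v(1)]] _ v(2) r(1)] by blast
  also have "\<dots> = ch_tableaux m (l, comp_of q)"
    using arrangement.ch_tableaux_component[OF A arrangement.rows_in_tableau_words[OF A r(1) _ q(4) r(2)]] q(3)
    unfolding reading_rows row by simp
  finally show "ch_component m (map (neg_letter m) v @ r) = ch_tableaux m (l, comp_of q)" .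
qed

text \<open>The shape of \<open>v\<close> has \<open>m\<close> rows, and the last entry of the first column is at least \<open>-1\<close>.\<close>

lemma component_big_letter:
  assumes v: "yam v" "set v \<subseteq> {..<m}" "m \<noteq> 0" "m - 1 \<in> set v"
    and x: "x \<in> component m (map (neg_letter m) v)"
  shows "\<exists>c\<in>set x. -1 \<le> c"
proof -
  define l where "l = map (count_list v) [0..<m]"
  have A: "arrangement m l []" and ch: "ch_component m (map (neg_letter m) v) = ch_tableaux m (l, comp_of [])"
    using yam_component[OF v(1,2), of "[]" "[]" l] by (auto simp: l_def words_def)
  let ?tableau_words = "arrangement.tableau_words m l []"
  have fin: "finite {a \<in> C. wt a = (wt x :: rat \<Rightarrow>\<^sub>0 nat)}" for C
    by (rule finite_subset[OF _ finite_words_of_weight[of "wt x"]]) auto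
  have "x \<in> {a \<in> component m (map (neg_letter m) v). wt a = (wt x :: rat \<Rightarrow>\<^sub>0 nat)}" using x by simp
  then have "0 < card {a \<in> component m (map (neg_letter m) v). wt a = (wt x :: rat \<Rightarrow>\<^sub>0 nat)}"
    using fin by (simp only: card_gt_0_iff) blast
  then have "0 < card {a \<in> ?tableau_words. wt a = (wt x :: rat \<Rightarrow>\<^sub>0 nat)}"
    using arg_cong[OF ch, of "\<lambda>f. coeff f (wt x)"]
    unfolding arrangement.ch_tableaux_tableau_words[OF A] ch_component_def coeff_character by simp
  then have "{a \<in> ?tableau_words. wt a = (wt x :: rat \<Rightarrow>\<^sub>0 nat)} \<noteq> {}" unfolding card_gt_0_iff by (rule conjunct1)
  then obtain y where "y \<in> ?tableau_words" "wt y = (wt x :: rat \<Rightarrow>\<^sub>0 nat)" by blast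
  then obtain T where T: "y = map T (reading l)" "body_tab m l T" unfolding arrangement.tableau_words_def[OF A] by auto
  have "set x = set y" using \<open>wt y = wt x\<close> unfolding wt_eq_iff by (metis mset_eq_setD)
  have "l ! (m - 1) \<noteq> 0" using v by (simp add: l_def count_list_0_iff)
  then have b: "(m - 1, 0) \<in> body l" using v(3) by (simp add: body_def l_def)
  have "neg_letter m (m - 1) \<le> T (m - 1, 0)" by (rule arrangement.col_lower[OF A T(2) b])
  moreover have "neg_letter m (m - 1) = -1" using v(3) by (simp add: neg_letter_def of_nat_diff)
  moreover have "T (m - 1, 0) \<in> set x" unfolding \<open>set x = set y\<close> T(1) using b by (simp add: set_reading)
  ultimately show ?thesis by auto
qed

lemma component_append_split:
  assumes "z \<in> component m (x @ y)" "x @ y \<in> words m"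
  shows "\<exists>x' y'. z = x' @ y' \<and> x' \<in> component m x \<and> y' \<in> component m y"
  using assms
proof (induction rule: component_induct)
  case base
  then show ?case using component_self by blast
next
  case (step z z')
  obtain x' y' where xy: "z = x' @ y'" "x' \<in> component m x" "y' \<in> component m y" using step.IH by blast
  have w: "x' \<in> words m" "y' \<in> words m" using step.hyps(2) xy(1) by (simp_all add: words_append)
  have "(\<exists>x''. z' = x'' @ y' \<and> (step m x' x'' \<or> step m x'' x')) \<or> (\<exists>y''. z' = x' @ y'' \<and> (step m y' y'' \<or> step m y'' y'))"
    using step.hyps(4) step_appendD step_appendD' unfolding xy(1) by blast
  then show ?case using component_step[OF xy(2) w(1)] component_step[OF xy(3) w(2)] xy by blast
qed

lemma neg_ge_minus_one: "c \<in> letters m \<Longrightarrow> c < 0 \<Longrightarrow> -1 \<le> c \<Longrightarrow> c = -1"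
  by (erule letters_cases) auto

lemma neg_le_minus_one: "c \<in> letters m \<Longrightarrow> c < 0 \<Longrightarrow> c \<le> -1"
  by (erule letters_cases) auto

definition top_before :: "nat \<Rightarrow> word \<Rightarrow> bool" where
  "top_before k u \<longleftrightarrow> (\<exists>p<k. p < length u \<and> (\<forall>p'<length u. p' \<noteq> p \<longrightarrow> rk u p' p))"

text \<open>Equal even letters are ordered from right to left, so the leftmost \<open>-1\<close>
  comes last of all.\<close>

lemma top_before_neg:
  assumes "u \<in> words m" "\<forall>c\<in>set u. c < 0" "-1 \<in> set (take k u)"
  shows "top_before k u"
proof -
  define p where "p = (LEAST p. p < length u \<and> u ! p = -1)"
  obtain i where i: "i < k" "i < length u" "u ! i = -1" using assms(3) by (auto simp: in_set_conv_nth)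
  have p: "p < length u" "u ! p = -1" "p \<le> i"
    using LeastI[of "\<lambda>p. p < length u \<and> u ! p = -1" i] Least_le[of "\<lambda>p. p < length u \<and> u ! p = -1" i] i
    unfolding p_def by auto
  have "rk u p' p" if "p' < length u" "p' \<noteq> p" for p'
  proof -
    have "u ! p' \<in> set u" using that by simp
    then have "u ! p' \<le> -1" using neg_le_minus_one[of "u ! p'" m] assms by (auto simp: words_def)
    moreover have "p < p'" if "u ! p' = -1"
      using Least_le[of "\<lambda>p. p < length u \<and> u ! p = -1" p'] that \<open>p' < length u\<close> \<open>p' \<noteq> p\<close>
      unfolding p_def by (metis le_neq_implies_less)
    ultimately show ?thesis using p(2) by (auto simp: rk_def)
  qed
  then show ?thesis unfolding top_before_def using p i by (intro exI[of _ p]) auto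
qed

text \<open>While all letters are negative, the first \<open>k\<close> letters stay in the component
  of the Yamanouchi word \<open>take k v\<close>, and \<open>component_big_letter\<close> provides a
  \<open>-1\<close> among them. Once a positive letter is present, the last position carries one:
  operators of negative index leave it alone, and the others preserve the order.\<close>

lemma component_top_before:
  assumes v: "yam v" "set v \<subseteq> {..<m}" "m \<noteq> 0" "m - 1 \<in> set (take k v)"
    and u: "u \<in> component m (map (neg_letter m) v)"
  shows "top_before k u"
proof -
  let ?u0 = "map (neg_letter m) v"
  have u0: "?u0 \<in> words m" using v(2) neg_letter_letters[of _ m] by (auto simp: words_def subset_iff)
  have one: "neg_letter m (m - 1) = -1" using v(3) by (simp add: neg_letter_def of_nat_diff)
  have k: "length (take k ?u0) = min (length v) k" by simp
  have yk: "yam (take k v)" using v(1) unfolding yam_def by (simp add: take_take)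
  have sk: "set (take k v) \<subseteq> {..<m}" using v(2) set_take_subset by fast
  have negc: "top_before k x" if x: "x \<in> component m ?u0" "\<forall>c\<in>set x. c < 0" for x
  proof -
    have xw: "x \<in> words m" using component_words[OF u0 x(1)] .
    have tw: "take k ?u0 \<in> words m" using u0 by (auto simp: words_def dest: in_set_takeD)
    obtain x' y' where xy: "x = x' @ y'" "x' \<in> component m (take k ?u0)"
      using component_append_split[of x m "take k ?u0" "drop k ?u0"] x(1) u0 by auto
    have "length x' = min (length v) k" using component_length[OF tw xy(2)] by simp
    moreover have "length x = length v" using component_length[OF u0 x(1)] by simp
    ultimately have "take k x = x'" using xy(1) by (cases "length v \<le> k") (auto simp: min_def)
    moreover obtain c where "c \<in> set x'" "-1 \<le> c"
      using component_big_letter[OF yk sk v(3,4), of x'] xy(2) by (auto simp: take_map)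
    ultimately have c: "c \<in> set (take k x)" "-1 \<le> c" by auto
    then have "c \<in> set x" by (metis in_set_takeD)
    then have "c = -1" using neg_ge_minus_one[of c m] c x(2) xw by (auto simp: words_def)
    then show ?thesis using top_before_neg[OF xw x(2)] c by simp
  qed
  show ?thesis using u u0
  proof (induction rule: component_induct)
    case base
    have "\<forall>c\<in>set ?u0. c < 0" using v(2) neg_letter_neg by auto
    then show ?case using negc component_self by blast
  next
    case (step x y)
    have yc: "y \<in> component m ?u0" using component_step step by blast
    show ?case
    proof (cases "\<forall>c\<in>set y. c < 0")
      case True
      then show ?thesis using negc yc by blast
    next
      case False
      obtain p where p: "p < k" "p < length x" "\<forall>p'<length x. p' \<noteq> p \<longrightarrow> rk x p' p"
        using step.IH unfolding top_before_def by blast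
      obtain a w w' where a: "a \<in> letters m" "admissible a w w'"
        "(x = w @ a # w' \<and> y = w @ nxt a # w') \<or> (y = w @ a # w' \<and> x = w @ nxt a # w')"
        using step.hyps(4) unfolding step_def by blast
      have len: "length y = length x" using a(3) by auto
      have other: "y ! i = x ! i" if "i \<noteq> length w" for i
        using a(3) that by (auto simp: nth_append nth_Cons split: nat.splits)
      have "rk y p' p" if p': "p' < length x" "p' \<noteq> p" for p'
      proof (cases "nxt a < 0")
        case True
        have at: "x ! length w < 0" "y ! length w < 0" using a(3) True nxt_greater[of a] by auto
        obtain i where i: "i < length y" "\<not> y ! i < 0" using False by (auto simp: in_set_conv_nth)
        have iw: "i \<noteq> length w" using i at by auto
        \<comment> \<open>The nonnegative letter of \<open>y\<close> is not at the changed position,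
          so \<open>x\<close> has it as well, and the last position of \<open>x\<close> carries a
          letter at least as large.\<close>
        have "\<not> x ! p < 0"
        proof (cases "i = p")
          case False
          then have "x ! i \<le> x ! p" using p(3) i len by (auto simp: rk_def)
          then show ?thesis using i other[OF iw] by simp
        qed (use i other[OF iw] in simp)
        then have pw: "p \<noteq> length w" using at by auto
        show ?thesis
        proof (cases "p' = length w")
          case True
          then show ?thesis using at \<open>\<not> x ! p < 0\<close> other[OF pw] by (simp add: rk_def)
        next
          case False
          then show ?thesis using p(3) p' other[OF pw] other[OF False] by (simp add: rk_def)
        qed
      next
        case False
        then have bp: "0 < nxt a" using letters_nonzero[OF nxt_letters[OF a(1)]] by simp
        have ww: "w @ a # w' \<in> words m" using a(3) step.hyps(2,3) by blast
        have "asc (y ! i) (y ! j) \<longleftrightarrow> asc (x ! i) (x ! j)" if "i < j" "j < length x" for i j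
          using asc_step[OF a(1) bp ww a(2) that(1)] that(2) a(3) by auto
        then show ?thesis using p(2,3) p' by (auto simp: rk_iff_asc split: if_splits)
      qed
      then show ?thesis unfolding top_before_def using p len by auto
    qed
  qed
qed

lemma sel_map_filter: "sel (map P x) x = filter P x" "sel (map Not (map P x)) x = filter (\<lambda>b. \<not> P b) x"
  by (induction x) auto

lemma component_is_shape:
  assumes "w \<in> words m"
  shows "\<exists>\<sigma>\<in>shapes m. ch_component m w = ch_tableaux m \<sigma>"
proof -
  obtain w0 where w0: "w0 \<in> component m w" "is_hw m w0" using hw_exists[OF assms] by blast
  have w0w: "w0 \<in> words m" using component_words[OF assms w0(1)] .
  have chw: "ch_component m w = ch_component m w0" unfolding ch_component_def component_eq[OF w0(1)] ..
  obtain v where v: "filter (\<lambda>b. b < 0) w0 = map (neg_letter m) v" "yam v" "set v \<subseteq> {..<m}"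
    using hw_neg_part[OF w0w w0(2)] by blast
  let ?u = "map (neg_letter m) v"
  define r where "r = filter (\<lambda>b. \<not> b < 0) w0"
  have rw: "r \<in> words m" using w0w by (auto simp: r_def words_def)
  have rpos: "\<forall>b\<in>set r. 0 < b"
  proof
    fix b assume "b \<in> set r"
    then have "b \<in> letters m" "\<not> b < 0" using w0w by (auto simp: r_def words_def)
    then show "0 < b" using letters_nonzero by fastforce
  qed
  obtain q where q: "distinct q" "set q = {..<length r}" "length q = length r" "sorted_wrt (rk r) q"
    using rank_order_exists by blast
  define l where "l = map (count_list v) [0..<m]"
  have finish: ?thesis if "ch_component m w0 = ch_component m (?u @ r)" "r \<noteq> [] \<longrightarrow> m = 0 \<or> m - 1 \<in> set v"
    using yam_component[OF v(2,3) rw rpos that(2) q l_def] arrangement_shape that(1) chw by metis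
  \<comment> \<open>In these cases one of the two parts is empty and nothing has to be
    moved.\<close>
  have neg_split: "w0 = ?u @ r" if "r = [] \<or> m = 0"
  proof (cases "r = []")
    case True
    then have "filter (\<lambda>b. b < 0) w0 = w0" unfolding r_def filter_empty_conv filter_id_conv by blast
    then show ?thesis using v(1) True by simp
  next
    case False
    then have "v = []" using that v(3) by auto
    then have "\<forall>b\<in>set w0. \<not> b < 0" using v(1) by (simp add: filter_empty_conv)
    then show ?thesis using \<open>v = []\<close> unfolding r_def by (simp add: filter_id_conv)
  qed
  show ?thesis
  proof (cases "r = [] \<or> m = 0")
    case True
    then show ?thesis using finish neg_split by auto
  next
    case False
    then have ne: "r \<noteq> []" and m0: "m \<noteq> 0" by auto
    define \<beta> where "\<beta> = map (\<lambda>b. b < (0::rat)) w0"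
    have lb: "length \<beta> = length w0" by (simp add: \<beta>_def)
    have selU: "sel \<beta> w0 = ?u" and selR: "sel (map Not \<beta>) w0 = r"
      unfolding \<beta>_def sel_map_filter r_def using v(1) by auto
    obtain s q' where qs: "q = s # q'" using ne q(3) by (cases q) auto
    have s: "s < length r" using q(2) qs by auto
    have "sel (map Not \<beta>) w0 = take s r @ r ! s # drop (Suc s) r"
      unfolding selR using s by (simp add: id_take_nth_drop)
    then obtain ts1 ts2 pre post where sp: "map Not \<beta> = ts1 @ True # ts2" "w0 = pre @ r ! s # post"
      "length ts1 = length pre" "sel ts1 pre = take s r"
      using sel_split[of "map Not \<beta>" w0] lb by (metis length_map)
    \<comment> \<open>\<open>Z\<close> is the position in \<open>w0\<close> of the letter of
      \<open>r\<close> that comes first in the order.\<close>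
    define Z where "Z = length pre"
    have tz: "take Z (map Not \<beta>) = ts1" "(map Not \<beta>) ! Z" "Z < length \<beta>"
    proof -
      have "length \<beta> = length (map Not \<beta>)" by simp
      then show "Z < length \<beta>" unfolding sp(1) using sp(3) by (simp add: Z_def)
      show "take Z (map Not \<beta>) = ts1" "(map Not \<beta>) ! Z" unfolding sp(1) using sp(3) by (simp_all add: Z_def nth_append)
    qed
    have wZ: "w0 ! Z = r ! s" "Z < length w0" using sp(2) by (auto simp: Z_def)
    have s_eq: "length (filter Not (take Z \<beta>)) = s"
    proof -
      have "length (filter Not (take Z \<beta>)) = length (filter id (map Not (take Z \<beta>)))"
        by (simp add: filter_map o_def)
      also have "map Not (take Z \<beta>) = ts1" using tz(1) by (simp add: take_map)
      also have "length (filter id ts1) = s" using length_sel[OF sp(3)] sp(4) s by simp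
      finally show ?thesis .
    qed
    have first: "r ! s \<le> b" if "b \<in> set r" for b
    proof -
      obtain i where "i < length r" "b = r ! i" using \<open>b \<in> set r\<close> unfolding in_set_conv_nth by blast
      moreover have "i \<in> set q" using q(2) \<open>i < length r\<close> by simp
      ultimately show ?thesis using q(4) unfolding qs by (auto simp: rk_def)
    qed
    have rs: "r ! s \<in> set w0" using wZ by (metis nth_mem)
    have rs0: "0 < r ! s" using rpos s by simp
    \<comment> \<open>The least positive letter of a highest weight word has no positive
      predecessor. For \<open>1 / 2\<close> the highest weight condition then supplies the
      \<open>-1\<close> to its left, on which the separation rests.\<close>
    have half: "r ! s = 1 / 2"
    proof (rule ccontr)
      assume "r ! s \<noteq> 1 / 2"
      then obtain y where y: "0 < y" "nxt y = r ! s" "y \<in> set w0" using hw_pos_pred[OF w0(2) w0w rs rs0] by blast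
      then have "y \<in> set r" by (simp add: r_def)
      then show False using first[of y] y nxt_greater[of y] by simp
    qed
    have one: "neg_letter m (m - 1) = -1" using m0 by (simp add: neg_letter_def of_nat_diff)
    have "-1 \<in> letters m" using neg_letter_letters[of "m - 1" m] m0 one by simp
    moreover have "nxt (-1) = 1 / 2" by (simp add: nxt_def)
    ultimately obtain i where i: "i < Z" "w0 ! i = -1" using hw_even_nth[OF w0(2), of "-1" Z] wZ half by auto
    define k where "k = length (filter id (take Z \<beta>))"
    have "filter (\<lambda>b. b < 0) (take Z w0) = take k ?u"
    proof -
      have "?u = filter (\<lambda>b. b < 0) (take Z w0) @ filter (\<lambda>b. b < 0) (drop Z w0)"
        unfolding v(1)[symmetric] filter_append[symmetric] by simp
      moreover have "length (filter (\<lambda>b. b < 0) (take Z w0)) = k"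
        by (simp add: k_def \<beta>_def take_map filter_map o_def)
      ultimately show ?thesis by simp
    qed
    moreover have "-1 \<in> set (filter (\<lambda>b. b < 0) (take Z w0))"
      using i wZ(2) by (auto simp: in_set_conv_nth)
    ultimately have "neg_letter m (m - 1) \<in> set (map (neg_letter m) (take k v))" using one by (simp add: take_map)
    then have mk: "m - 1 \<in> set (take k v)" by (auto simp: neg_letter_eq)
    then have mv: "m - 1 \<in> set v" by (rule in_set_takeD)
    have uw: "?u \<in> words m" using v(3) neg_letter_letters[of _ m] by (auto simp: words_def subset_iff)
    interpret sh: shuffle m \<beta> ?u Z
    proof
      show "Z < length \<beta>" "\<not> \<beta> ! Z" using tz by auto
      show "?u \<in> words m" by (rule uw)
      show "\<exists>p<length (filter id (take Z \<beta>)). p < length u \<and> (\<forall>p'<length u. p' \<noteq> p \<longrightarrow> rk u p' p)"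
        if "u \<in> component m ?u" for u
        using component_top_before[OF v(2,3) m0 mk that] unfolding top_before_def k_def .
      show "\<exists>c\<in>set u. -1 \<le> c" if "u \<in> component m ?u" for u
        using component_big_letter[OF v(2,3) m0 mv that] .
    qed
    have UR: "sh.U w0 = ?u" "sh.R w0 = r" unfolding sh.U_def sh.R_def by (fact selU, fact selR)
    have "asc c d" if "c \<in> set ?u" "d \<in> set r" for c d
    proof -
      have "c < 0" using that v(3) neg_letter_neg by auto
      then show ?thesis using rpos that by (auto simp: asc_def)
    qed
    moreover have "rk r s s'" if "s' < length r" "s' \<noteq> s" for s'
    proof -
      have "s' \<in> set q" using q(2) that(1) by simp
      then show ?thesis using q(4) that(2) unfolding qs by auto
    qed
    ultimately have "w0 \<in> sh.S"
      unfolding sh.S_def mem_Collect_eq UR sh.s0_def s_eq using w0w lb component_self by simp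
    from sh.ch_component_shuffle[OF this] have "ch_component m w0 = ch_component m (?u @ r)"
      unfolding UR by (rule sym)
    then show ?thesis using finish mv by blast
  qed
qed

lemma span_ch_tableaux: "series.span (ch_tableaux m ` shapes m) = R_carrier m"
proof -
  have "ch_tableaux m ` shapes m = ch_component m ` words m"
  proof (intro equalityI subsetI)
    fix f assume "f \<in> ch_tableaux m ` shapes m"
    then show "f \<in> ch_component m ` words m" using ch_tableaux_lead by blast
  next
    fix f assume "f \<in> ch_component m ` words m"
    then show "f \<in> ch_tableaux m ` shapes m" using component_is_shape by blast
  qed
  then show ?thesis by (simp add: R_carrier_def)
qed

theorem proposition6p1:
  fixes m :: nat
  shows "cring (R_ring m)
    \<and> inj_on (ch_tableaux m) (shapes m)
    \<and> \<not> series.dependent (ch_tableaux m ` shapes m)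
    \<and> series.span (ch_tableaux m ` shapes m) = R_carrier m"
  using cring_R ch_tableaux_inj ch_tableaux_independent span_ch_tableaux by blast

end
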